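(* For each lock $\ell$ let $k_\ell$ be the bound on the maximum point contention possible on $\ell$, and for a tryLock attempt with descriptor $p$ let $C_p = \sum_{\ell \in p.\mathrm{lockList}} k_\ell$ be the sum of the bounds on the point contention across all locks in $p$'s lock list. The Lock Algorithm (described in the context) provides wait-free fine-grained locks against an oblivious scheduler and an adaptive player such that the probability that $p$ succeeds in its tryLock is at least $\frac{1}{C_p}$.
   Context: **Model.** Asynchronous processes communicate via shared memory with atomic Read, Write and CAS. A step is a memory operation or an invocation or response of a procedure. A thunk is a procedure without arguments or return value using Read, Write and CAS (a critical section), containing no tryLock. A run of a thunk $\mathcal T$ is the sequence of steps of a single process executing or helping to execute $\mathcal T$. Thunks are executed in idempotent form: in any valid execution $E$ there is a subsequence $E'$ of the steps of $E$ belonging to runs of $\mathcal T$ such that, if some run finishes, the last step of the first finished run is the end of $E'$, and deleting from $E$ all steps of $\mathcal T$ not in $E'$ leaves a valid history consistent with a single run of $\mathcal T$. The interval of a thunk is from the first step of any of its runs until the last step of its first completed run. A tryLock takes a lock set and a thunk and returns whether it succeeded. It must satisfy mutual exclusion with idempotence: if an attempt with thunk $\mathcal T$ and lock set $\mathcal L$ succeeds, then some run of $\mathcal T$ executed to completion and $\mathcal T$'s interval does not overlap the interval of any other thunk whose lock set intersects $\mathcal L$; if it fails, there is no run of $\mathcal T$. An attempt is live on $\ell$ from its invocation to its response if $\ell$ is in its lock set. The point contention of $\ell$ at a time is the number of attempts live on $\ell$ at that time, and $k_\ell$ bounds it at all times over all possible executions. $\kappa$ is an upper bound on all $k_\ell$,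 $L$ on the size of lock sets, $T$ on the number of steps of a thunk; $\kappa, L, T$ are known to the algorithm. (Randomized) wait-free: each process takes a finite expected number of steps until its operation succeeds (retrying failed attempts). **Adversaries.** The scheduler adversary is oblivious: a function, fixed in advance, from time steps to the process taking a step. The player adversary is adaptive: a function from the history so far and a process to whether that process starts a new tryLock at its next step and with which locks, respecting the bounds above. **Multi active set.** An active set is a linearizable object with operations insert, remove (each taking $O(\kappa)$ steps) and getSet (constant time), the latter returning the elements inserted and not yet removed. Items carry a flag. multiInsert$(x,\mathcal C)$: $x$.clearFlag(); insert $x$ into each active set in $\mathcal C$; $x$.setFlag(). multiRemove$(x,\mathcal C)$: $x$.clearFlag(); remove $x$ from each active set in $\mathcal C$. getSet$(A)$: obtain $S=A.$getSet(), then return those $x\in S$ for which $x$.getFlag() is read as true. **Lock Algorithm.** Each lock is an active set. Each attempt has its own unique descriptor $p$ with fields lockList, thunk, priority (initially $-1$), and status $\in\{\text{active},\text{won},\text{lost}\}$ (initially active). For descriptors: getFlag() returns (priority $>0$); clearFlag() sets priority to $-1$; setFlag() first delays until the process has taken $T_0=c\,\kappa^2L^2T$ steps in total since the start of the attempt, and then writes to priority a uniformly random positive value (the reveal step). Priorities are assumed not to conflict. tryLocks(lockList, thunk): create $p$; for each $\ell$ in $p$.lockList, compute getSet$(\ell)$ and call run$(p')$ for each $p'$ in it; then multiInsert$(p,p.\text{lockList})$; run$(p)$; multiRemove$(p,p.\text{lockList})$; finally delay until $T_1=c'\kappa LT$ steps have been taken since the previous delay. The attempt succeeds iff its final status is won.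 Here $c,c'$ are sufficiently large constants. run$(p)$: for each $\ell$ in $p$.lockList: let $S=$ getSet$(\ell)$; if $p$.status = active, then for each $p'\in S$: [if $p'$.status = active: if $p$.priority $>p'$.priority then eliminate$(p')$, else if $p\ne p'$ then eliminate$(p)$]; then celebrateIfWon$(p')$. After all locks: decide$(p)$; celebrateIfWon$(p)$. decide$(p)$: CAS($p$.status, active, won). eliminate$(p)$: CAS($p$.status, active, lost). celebrateIfWon$(p)$: if $p$.status = won, execute $p$.thunk.
   Formalization: The success bound is stated for attempts whose process the scheduler grants enough steps to return (a starved attempt never succeeds), and the adaptive player is taken to be measurable so that probabilities exist. *)

theory Defs
  imports "HOL-Probability.Infinite_Product_Measure" "HOL-Library.Monad_Syntax"
begin

type_synonym lock = nat
type_synonym proc = nat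

text \<open>
  A descriptor is a value holding the fields that never change after creation: a unique identity
  (the time of the invocation of its attempt), the lock list, and the thunk, given as the name of a
  procedure of the system.  The mutable fields, priority and status, live in shared memory.
\<close>

datatype desc = Desc (ident: nat) (lockList: "lock list") (thunk: nat)

datatype status = Active | Won | Lost

text \<open>
  Shared-memory code on words (natural numbers) at addresses (natural numbers); used for thunks and
  for active set operations.  The code of a thunk stands for its idempotent form, that is, what each
  run executes; the guarantees below hold for arbitrary code, so idempotence is not assumed.
\<close>

datatype 'a code =
    Done 'a
  | ReadWord nat "nat \<Rightarrow> 'a code"
  | WriteWord nat nat "'a code"
  | CasWord nat nat nat "bool \<Rightarrow> 'a code"

primrec max_steps :: "'a code \<Rightarrow> nat \<Rightarrow> bool" where
  "max_steps (Done a) n = True"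
| "max_steps (ReadWord x f) n = (\<exists>m. n = Suc m \<and> (\<forall>v. max_steps (f v) m))"
| "max_steps (WriteWord x v p) n = (\<exists>m. n = Suc m \<and> max_steps p m)"
| "max_steps (CasWord x u v f) n = (\<exists>m. n = Suc m \<and> (\<forall>b. max_steps (f b) m))"

text \<open>Each active set has its own memory, disjoint from the memory used by the thunks.\<close>

datatype region = ActiveSetMem lock | ThunkMem

datatype as_op = Insert desc | Remove desc | GetSet

text \<open>
  Invocations and responses of procedures.  The response of an active set operation carries the
  list returned by getSet, and \<open>[]\<close> for the operations without result.
\<close>

datatype event =
    TryInv desc
  | TryResp desc bool
  | ThunkInv desc
  | ThunkResp desc
  | ASInv lock as_op
  | ASResp lock "desc list"

text \<open>
  \<open>RandomPriority\<close> writes a fresh random priority.  \<open>DelayUntil n\<close> takes idle steps as long as the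
  process has taken fewer than \<open>n\<close> steps since the start of its current attempt, and is not itself
  a step.
\<close>

datatype 'a prog =
    Return 'a
  | ReadPriority desc "real \<Rightarrow> 'a prog"
  | WritePriority desc real "'a prog"
  | RandomPriority desc "'a prog"
  | ReadStatus desc "status \<Rightarrow> 'a prog"
  | CasStatus desc status status "bool \<Rightarrow> 'a prog"
  | Read region nat "nat \<Rightarrow> 'a prog"
  | Write region nat nat "'a prog"
  | Cas region nat nat nat "bool \<Rightarrow> 'a prog"
  | Event event "'a prog"
  | DelayUntil nat "'a prog"

primrec bind_prog :: "'a prog \<Rightarrow> ('a \<Rightarrow> 'b prog) \<Rightarrow> 'b prog" where
  "bind_prog (Return a) g = g a"
| "bind_prog (ReadPriority p f) g = ReadPriority p (\<lambda>x. bind_prog (f x) g)"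
| "bind_prog (WritePriority p x r) g = WritePriority p x (bind_prog r g)"
| "bind_prog (RandomPriority p r) g = RandomPriority p (bind_prog r g)"
| "bind_prog (ReadStatus p f) g = ReadStatus p (\<lambda>x. bind_prog (f x) g)"
| "bind_prog (CasStatus p x y f) g = CasStatus p x y (\<lambda>b. bind_prog (f b) g)"
| "bind_prog (Read R a f) g = Read R a (\<lambda>v. bind_prog (f v) g)"
| "bind_prog (Write R a v r) g = Write R a v (bind_prog r g)"
| "bind_prog (Cas R a u v f) g = Cas R a u v (\<lambda>b. bind_prog (f b) g)"
| "bind_prog (Event e r) g = Event e (bind_prog r g)"
| "bind_prog (DelayUntil n r) g = DelayUntil n (bind_prog r g)"

adhoc_overloading Monad_Syntax.bind \<rightleftharpoons> bind_prog

primrec exec_code :: "region \<Rightarrow> 'a code \<Rightarrow> 'a prog" where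
  "exec_code R (Done a) = Return a"
| "exec_code R (ReadWord x f) = Read R x (\<lambda>v. exec_code R (f v))"
| "exec_code R (WriteWord x v p) = Write R x v (exec_code R p)"
| "exec_code R (CasWord x u v f) = Cas R x u v (\<lambda>b. exec_code R (f b))"

primrec for_each :: "'x list \<Rightarrow> ('x \<Rightarrow> unit prog) \<Rightarrow> unit prog" where
  "for_each [] f = Return ()"
| "for_each (x # xs) f = do { f x; for_each xs f }"

abbreviation skip :: "unit prog" where
  "skip \<equiv> Return ()"

abbreviation event :: "event \<Rightarrow> unit prog" where
  "event e \<equiv> Event e skip"

record active_set =
  as_init :: "nat \<Rightarrow> nat"
  as_insert :: "desc \<Rightarrow> unit code"
  as_remove :: "desc \<Rightarrow> unit code"
  as_getSet :: "desc list code"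

datatype label =
    Ev event
  | PriorityRead desc real
  | PriorityWrite desc real
  | StatusRead desc status
  | StatusCas desc status status bool
  | WordRead region nat nat
  | WordWrite region nat nat
  | WordCas region nat nat nat bool
  | Idling

type_synonym history = "(proc \<times> label) list"

text \<open>
  A system: the active set implementation, the procedures available as thunks and their initial
  memory, the two delays, and the two adversaries.  The scheduler is oblivious: a function of time
  only.  The player is adaptive: from the history so far and a process it decides whether the
  process starts a tryLock, and with which locks and which thunk.
\<close>

record system =
  actset :: active_set
  thunk_code :: "nat \<Rightarrow> unit code"
  thunk_mem :: "nat \<Rightarrow> nat"
  T0 :: nat
  T1 :: nat
  sched :: "nat \<Rightarrow> proc"
  player :: "history \<Rightarrow> proc \<Rightarrow> (lock list \<times> nat) option"

definition lock_insert :: "system \<Rightarrow> lock \<Rightarrow> desc \<Rightarrow> unit prog" where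
  "lock_insert S l x = do {
     event (ASInv l (Insert x));
     exec_code (ActiveSetMem l) (as_insert (actset S) x);
     event (ASResp l []) }"

definition lock_remove :: "system \<Rightarrow> lock \<Rightarrow> desc \<Rightarrow> unit prog" where
  "lock_remove S l x = do {
     event (ASInv l (Remove x));
     exec_code (ActiveSetMem l) (as_remove (actset S) x);
     event (ASResp l []) }"

definition raw_getSet :: "system \<Rightarrow> lock \<Rightarrow> desc list prog" where
  "raw_getSet S l = do {
     event (ASInv l GetSet);
     xs \<leftarrow> exec_code (ActiveSetMem l) (as_getSet (actset S));
     event (ASResp l xs);
     Return xs }"

definition getFlag :: "desc \<Rightarrow> bool prog" where
  "getFlag x = ReadPriority x (\<lambda>v. Return (v > 0))"

definition clearFlag :: "desc \<Rightarrow> unit prog" where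
  "clearFlag x = WritePriority x (- 1) skip"

definition setFlag :: "system \<Rightarrow> desc \<Rightarrow> unit prog" where
  "setFlag S x = DelayUntil (T0 S) (RandomPriority x skip)"

primrec flagged :: "desc list \<Rightarrow> desc list prog" where
  "flagged [] = Return []"
| "flagged (x # xs) = do {
     b \<leftarrow> getFlag x;
     ys \<leftarrow> flagged xs;
     Return (if b then x # ys else ys) }"

definition getSet :: "system \<Rightarrow> lock \<Rightarrow> desc list prog" where
  "getSet S l = do { xs \<leftarrow> raw_getSet S l; flagged xs }"

definition multiInsert :: "system \<Rightarrow> desc \<Rightarrow> lock list \<Rightarrow> unit prog" where
  "multiInsert S x C = do { clearFlag x; for_each C (\<lambda>l. lock_insert S l x); setFlag S x }"

definition multiRemove :: "system \<Rightarrow> desc \<Rightarrow> lock list \<Rightarrow> unit prog" where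
  "multiRemove S x C = do { clearFlag x; for_each C (\<lambda>l. lock_remove S l x) }"

definition decide :: "desc \<Rightarrow> unit prog" where
  "decide p = CasStatus p Active Won (\<lambda>_. skip)"

definition eliminate :: "desc \<Rightarrow> unit prog" where
  "eliminate p = CasStatus p Active Lost (\<lambda>_. skip)"

definition run_thunk :: "system \<Rightarrow> desc \<Rightarrow> unit prog" where
  "run_thunk S p = do {
     event (ThunkInv p);
     exec_code ThunkMem (thunk_code S (thunk p));
     event (ThunkResp p) }"

definition celebrateIfWon :: "system \<Rightarrow> desc \<Rightarrow> unit prog" where
  "celebrateIfWon S p = ReadStatus p (\<lambda>s. if s = Won then run_thunk S p else skip)"

definition compete :: "desc \<Rightarrow> desc \<Rightarrow> unit prog" where
  "compete p p' = ReadStatus p' (\<lambda>s.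
     if s = Active then
       ReadPriority p (\<lambda>x. ReadPriority p' (\<lambda>x'.
         if x > x' then eliminate p'
         else if p \<noteq> p' then eliminate p
         else skip))
     else skip)"

definition run :: "system \<Rightarrow> desc \<Rightarrow> unit prog" where
  "run S p = do {
     for_each (lockList p) (\<lambda>l. do {
       xs \<leftarrow> getSet S l;
       ReadStatus p (\<lambda>s.
         if s = Active
         then for_each xs (\<lambda>p'. do { compete p p'; celebrateIfWon S p' })
         else skip) });
     decide p;
     celebrateIfWon S p }"

text \<open>
  The first delay ends after exactly \<open>T0\<close> steps when \<open>T0\<close> is large enough for the work before it
  (which is what the constant in \<open>T0\<close> is for), so that \<open>T1\<close> steps after that delay means
  \<open>T0 + T1\<close> steps after the start of the attempt.
\<close>

definition tryLocks :: "system \<Rightarrow> desc \<Rightarrow> unit prog" where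
  "tryLocks S p = do {
     for_each (lockList p) (\<lambda>l. do { xs \<leftarrow> getSet S l; for_each xs (run S) });
     multiInsert S p (lockList p);
     run S p;
     multiRemove S p (lockList p);
     ReadStatus p (\<lambda>s. DelayUntil (T0 S + T1 S) (event (TryResp p (s = Won)))) }"

record memory =
  priority :: "desc \<Rightarrow> real"
  stat :: "desc \<Rightarrow> status"
  word :: "region \<Rightarrow> nat \<Rightarrow> nat"

text \<open>
  One step of a program: \<open>u\<close> is the value drawn if the step is a reveal, and \<open>n\<close> is the number of
  steps the process has taken since the start of its current attempt.
\<close>

primrec prog_step ::
  "real \<Rightarrow> nat \<Rightarrow> memory \<Rightarrow> unit prog \<Rightarrow> label \<times> memory \<times> unit prog" where
  "prog_step u n m (Return a) = (Idling, m, Return a)"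
| "prog_step u n m (ReadPriority p f) = (PriorityRead p (priority m p), m, f (priority m p))"
| "prog_step u n m (WritePriority p x r) =
     (PriorityWrite p x, m\<lparr>priority := (priority m)(p := x)\<rparr>, r)"
| "prog_step u n m (RandomPriority p r) =
     (PriorityWrite p u, m\<lparr>priority := (priority m)(p := u)\<rparr>, r)"
| "prog_step u n m (ReadStatus p f) = (StatusRead p (stat m p), m, f (stat m p))"
| "prog_step u n m (CasStatus p x y f) =
     (let b = (stat m p = x) in
       (StatusCas p x y b, if b then m\<lparr>stat := (stat m)(p := y)\<rparr> else m, f b))"
| "prog_step u n m (Read R a f) = (WordRead R a (word m R a), m, f (word m R a))"
| "prog_step u n m (Write R a v r) =
     (WordWrite R a v, m\<lparr>word := (word m)(R := (word m R)(a := v))\<rparr>, r)"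
| "prog_step u n m (Cas R a x y f) =
     (let b = (word m R a = x) in
       (WordCas R a x y b,
        if b then m\<lparr>word := (word m)(R := (word m R)(a := y))\<rparr> else m, f b))"
| "prog_step u n m (Event e r) = (Ev e, m, r)"
| "prog_step u n m (DelayUntil k r) =
     (if n < k then (Idling, m, DelayUntil k r) else prog_step u n m r)"

text \<open>\<open>Busy r n\<close>: inside an attempt, with remaining program \<open>r\<close>, after \<open>n\<close> steps of it.\<close>

datatype proc_state = Idle | Busy "unit prog" nat

record config =
  shared :: memory
  local :: "proc \<Rightarrow> proc_state"

definition init_config :: "system \<Rightarrow> config" where
  "init_config S =
     \<lparr>shared = \<lparr>priority = (\<lambda>_. - 1), stat = (\<lambda>_. Active),
        word = (\<lambda>R. case R of ActiveSetMem _ \<Rightarrow> as_init (actset S) | ThunkMem \<Rightarrow> thunk_mem S)\<rparr>,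
      local = (\<lambda>_. Idle)\<rparr>"

definition system_step ::
  "system \<Rightarrow> nat \<Rightarrow> real \<Rightarrow> history \<Rightarrow> config \<Rightarrow> label \<times> config" where
  "system_step S t u h c = (let q = sched S t in
     case local c q of
       Idle \<Rightarrow>
         (case player S h q of
            None \<Rightarrow> (Idling, c)
          | Some (ls, th) \<Rightarrow>
              let p = Desc t ls th in
                (Ev (TryInv p), c\<lparr>local := (local c)(q := Busy (tryLocks S p) 1)\<rparr>))
     | Busy r n \<Rightarrow>
         (let (l, m, r') = prog_step u n (shared c) r;
              s = (if r' = Return () then Idle else Busy r' (Suc n))
          in (l, \<lparr>shared = m, local = (local c)(q := s)\<rparr>)))"

text \<open>
  The execution is determined by the values \<open>\<omega> t\<close> that a reveal step at time \<open>t\<close> writes.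
  \<open>exec S \<omega> t\<close> is the configuration and the history before the step at time \<open>t\<close>.
\<close>

primrec exec :: "system \<Rightarrow> (nat \<Rightarrow> real) \<Rightarrow> nat \<Rightarrow> config \<times> history" where
  "exec S \<omega> 0 = (init_config S, [])"
| "exec S \<omega> (Suc t) =
     (let (c, h) = exec S \<omega> t; (l, c') = system_step S t (\<omega> t) h c
      in (c', h @ [(sched S t, l)]))"

definition config_at :: "system \<Rightarrow> (nat \<Rightarrow> real) \<Rightarrow> nat \<Rightarrow> config" where
  "config_at S \<omega> t = fst (exec S \<omega> t)"

definition hist :: "system \<Rightarrow> (nat \<Rightarrow> real) \<Rightarrow> nat \<Rightarrow> history" where
  "hist S \<omega> t = snd (exec S \<omega> t)"

definition step_at :: "system \<Rightarrow> (nat \<Rightarrow> real) \<Rightarrow> nat \<Rightarrow> proc \<times> label" where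
  "step_at S \<omega> t = hist S \<omega> (Suc t) ! t"

text \<open>
  Random priorities are independent and uniform on \<open>{0<..<1}\<close>, hence positive, and distinct almost
  surely.  The elements of \<open>space priorities\<close> are exactly the possible outcomes.
\<close>

definition priorities :: "(nat \<Rightarrow> real) measure" where
  "priorities = (\<Pi>\<^sub>M t\<in>(UNIV :: nat set). restrict_space lborel {0<..<1::real})"

text \<open>
  Everything before time \<open>s\<close> depends only on \<open>\<omega> t\<close> for \<open>t < s\<close>.  Hence fixing \<open>\<omega>\<close> and drawing \<open>\<omega>'\<close>
  at random gives the conditional distribution of the execution given its history up to time \<open>s\<close>.
\<close>

definition resume :: "nat \<Rightarrow> (nat \<Rightarrow> real) \<Rightarrow> (nat \<Rightarrow> real) \<Rightarrow> (nat \<Rightarrow> real)" where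
  "resume s \<omega> \<omega>' = (\<lambda>t. if t < s then \<omega> t else \<omega>' t)"

definition as_returns :: "(nat \<Rightarrow> proc \<times> label) \<Rightarrow> lock \<Rightarrow> nat \<Rightarrow> nat \<Rightarrow> desc list \<Rightarrow> bool" where
  "as_returns \<sigma> l i j xs \<longleftrightarrow> i < j \<and>
     (\<exists>q op. \<sigma> i = (q, Ev (ASInv l op)) \<and> \<sigma> j = (q, Ev (ASResp l xs)) \<and>
        (\<forall>m ys. i < m \<and> m < j \<longrightarrow> \<sigma> m \<noteq> (q, Ev (ASResp l ys))))"

definition as_contents ::
  "(nat \<Rightarrow> proc \<times> label) \<Rightarrow> lock \<Rightarrow> (nat \<Rightarrow> ereal) \<Rightarrow> ereal \<Rightarrow> desc set" where
  "as_contents \<sigma> l \<tau> z =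
     {x. \<exists>i q. \<sigma> i = (q, Ev (ASInv l (Insert x))) \<and> \<tau> i < z \<and>
        \<not> (\<exists>j q'. \<sigma> j = (q', Ev (ASInv l (Remove x))) \<and> \<tau> i < \<tau> j \<and> \<tau> j < z)}"

text \<open>
  \<open>\<tau> i\<close> is the linearization point of the operation invoked at time \<open>i\<close>, strictly between its
  invocation and its response; \<open>\<infinity>\<close> stands for a pending operation without effect.
\<close>

definition linearizable :: "(nat \<Rightarrow> proc \<times> label) \<Rightarrow> lock \<Rightarrow> bool" where
  "linearizable \<sigma> l \<longleftrightarrow> (\<exists>\<tau> :: nat \<Rightarrow> ereal.
     (\<forall>i q op. \<sigma> i = (q, Ev (ASInv l op)) \<longrightarrow> ereal (real i) < \<tau> i) \<and>
     (\<forall>i j xs. as_returns \<sigma> l i j xs \<longrightarrow> \<tau> i < ereal (real j)) \<and>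
     inj_on \<tau> {i. (\<exists>q op. \<sigma> i = (q, Ev (ASInv l op))) \<and> \<tau> i \<noteq> \<infinity>} \<and>
     (\<forall>i q j xs. \<sigma> i = (q, Ev (ASInv l GetSet)) \<and> as_returns \<sigma> l i j xs \<longrightarrow>
        distinct xs \<and> set xs = as_contents \<sigma> l \<tau> (\<tau> i)))"

text \<open>\<open>b\<close> is the constant hidden in the step bounds of the operations.\<close>

definition active_sets_ok :: "nat \<Rightarrow> nat \<Rightarrow> system \<Rightarrow> bool" where
  "active_sets_ok b \<kappa> S \<longleftrightarrow>
     (\<forall>x. max_steps (as_insert (actset S) x) (b * \<kappa>)) \<and>
     (\<forall>x. max_steps (as_remove (actset S) x) (b * \<kappa>)) \<and>
     max_steps (as_getSet (actset S)) b \<and>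
     (\<forall>\<omega>\<in>space priorities. \<forall>l. linearizable (step_at S \<omega>) l)"

definition live :: "system \<Rightarrow> (nat \<Rightarrow> real) \<Rightarrow> lock \<Rightarrow> nat \<Rightarrow> desc set" where
  "live S \<omega> l t = {p. l \<in> set (lockList p) \<and>
     (\<exists>i\<le>t. \<exists>q. step_at S \<omega> i = (q, Ev (TryInv p))) \<and>
     (\<forall>j\<le>t. \<forall>q r. step_at S \<omega> j \<noteq> (q, Ev (TryResp p r)))}"

definition respects_bounds ::
  "nat \<Rightarrow> nat \<Rightarrow> nat \<Rightarrow> (lock \<Rightarrow> nat) \<Rightarrow> system \<Rightarrow> bool" where
  "respects_bounds \<kappa> L T k S \<longleftrightarrow>
     (\<forall>\<omega>\<in>space priorities. \<forall>l t. card (live S \<omega> l t) \<le> k l) \<and>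
     (\<forall>l. k l \<le> \<kappa>) \<and>
     (\<forall>\<omega>\<in>space priorities. \<forall>t q p. step_at S \<omega> t = (q, Ev (TryInv p)) \<longrightarrow>
        distinct (lockList p) \<and> length (lockList p) \<le> L) \<and>
     (\<forall>th. max_steps (thunk_code S th) T)"

text \<open>Priorities are real numbers, so the player has to be measurable for probabilities to exist.\<close>

definition measurable_player :: "system \<Rightarrow> bool" where
  "measurable_player S \<longleftrightarrow>
     (\<forall>t q. (\<lambda>\<omega>. player S (hist S \<omega> t) q) \<in> measurable priorities (count_space UNIV))"

text \<open>
  Every run of a thunk begins with its invocation and, if completed, ends with its response.  If no
  run is completed, the interval extends forever.
\<close>

definition thunk_interval :: "system \<Rightarrow> (nat \<Rightarrow> real) \<Rightarrow> desc \<Rightarrow> nat set" where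
  "thunk_interval S \<omega> p =
     {t. (\<exists>i\<le>t. \<exists>q. step_at S \<omega> i = (q, Ev (ThunkInv p))) \<and>
         \<not> (\<exists>j<t. \<exists>q. step_at S \<omega> j = (q, Ev (ThunkResp p)))}"

definition mutual_exclusion_with_idempotence :: "system \<Rightarrow> bool" where
  "mutual_exclusion_with_idempotence S \<longleftrightarrow>
     (\<forall>\<omega>\<in>space priorities. \<forall>t q p.
        (step_at S \<omega> t = (q, Ev (TryResp p True)) \<longrightarrow>
           (\<exists>i<t. \<exists>q'. step_at S \<omega> i = (q', Ev (ThunkResp p))) \<and>
           (\<forall>p'. p' \<noteq> p \<and> set (lockList p) \<inter> set (lockList p') \<noteq> {} \<longrightarrow>
              thunk_interval S \<omega> p \<inter> thunk_interval S \<omega> p' = {})) \<and>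
        (step_at S \<omega> t = (q, Ev (TryResp p False)) \<longrightarrow>
           (\<forall>i q'. step_at S \<omega> i \<noteq> (q', Ev (ThunkInv p)))))"

definition succeeded :: "system \<Rightarrow> (nat \<Rightarrow> real) \<Rightarrow> proc \<Rightarrow> nat \<Rightarrow> nat \<Rightarrow> bool" where
  "succeeded S \<omega> q s t \<longleftrightarrow>
     (\<exists>i p. s \<le> i \<and> i < t \<and> step_at S \<omega> i = (q, Ev (TryResp p True)))"

text \<open>
  In \<open>\<omega>\<close>, process \<open>q\<close> retries the operation started with descriptor \<open>p\<close> at time \<open>s\<close> until it succeeds:
  whenever an attempt has failed, its next step starts a new one with the same locks and thunk.
\<close>

definition retries :: "system \<Rightarrow> (nat \<Rightarrow> real) \<Rightarrow> proc \<Rightarrow> nat \<Rightarrow> desc \<Rightarrow> bool" where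
  "retries S \<omega> q s p \<longleftrightarrow>
     (\<forall>t>s. sched S t = q \<and> local (config_at S \<omega> t) q = Idle \<and> \<not> succeeded S \<omega> q s t \<longrightarrow>
        player S (hist S \<omega> t) q = Some (lockList p, thunk p))"

definition steps_until_success :: "system \<Rightarrow> proc \<Rightarrow> nat \<Rightarrow> (nat \<Rightarrow> real) \<Rightarrow> ennreal" where
  "steps_until_success S q s \<omega> =
     (\<Sum>t. if s \<le> t \<and> sched S t = q \<and> \<not> succeeded S \<omega> q s t then 1 else 0)"

text \<open>The expectation is conditional on an arbitrary history up to the start of the operation.\<close>

definition wait_free :: "system \<Rightarrow> bool" where
  "wait_free S \<longleftrightarrow>
     (\<forall>\<omega>\<in>space priorities. \<forall>s q p.
        step_at S \<omega> s = (q, Ev (TryInv p)) \<and>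
        (\<forall>\<omega>'\<in>space priorities. retries S (resume s \<omega> \<omega>') q s p) \<longrightarrow>
        (\<integral>\<^sup>+\<omega>'. steps_until_success S q s (resume s \<omega> \<omega>') \<partial>priorities) < \<infinity>)"

text \<open>
  An attempt takes \<open>T0 + T1 + 1\<close> steps of its process, from its invocation to its response; the
  scheduler lets it finish only if it grants the process that many steps.
\<close>

definition allowed_to_finish :: "system \<Rightarrow> proc \<Rightarrow> nat \<Rightarrow> bool" where
  "allowed_to_finish S q s \<longleftrightarrow>
     (\<exists>t. T0 S + T1 S + 1 \<le> card {i. s \<le> i \<and> i < t \<and> sched S i = q})"

definition success_probability ::
  "system \<Rightarrow> (nat \<Rightarrow> real) \<Rightarrow> proc \<Rightarrow> nat \<Rightarrow> desc \<Rightarrow> real" where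
  "success_probability S \<omega> q s p =
     measure priorities {\<omega>' \<in> space priorities.
       \<exists>t. step_at S (resume s \<omega> \<omega>') t = (q, Ev (TryResp p True))}"

end

(*
  A run of p decides p only after it has looked at every lock of p, so it deals with each conflicting
  attempt that was revealed before the run started; this orders any two conflicting winners and gives
  mutual exclusion.  An attempt takes T0 steps to its reveal and T0 + T1 + 1 steps in total, whatever
  happens, so these times depend on its start and the schedule only.  An attempt p can be eliminated
  only by a rival with at least the same priority, where a rival conflicts with p, starts before the
  reveal of p (later ones first help p), is live at that reveal, and is revealed after the start of p
  (earlier ones are helped by p first).  At most C_p - 1 attempts are rivals, and whether an attempt
  is a rival is settled when it starts, before its priority is drawn and without knowledge of the
  priority of p.  A martingale argument then shows that p beats all rivals with probability at least
  1 / C_p.  Since failed attempts have a fixed length, retries start at times determined by the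
  schedule, and the number of attempts is dominated by a geometric distribution.
*)

theory Submission
  imports Defs
begin

section \<open>Executions and program logic\<close>

text \<open>Counting steps is circular: bounds need \<open>getSet\<close> to return at most \<kappa>
  items, which holds because listed items belong to live attempts, which rests on the order of
  insertion, reveal, decision and removal. That order is therefore proved first, with counting
  switched off. Facts about one execution hold for every outcome with positive draws, ties included:
  a tie eliminates the attempt whose run makes the comparison, so a loss yields only a weak
  inequality, and success is guaranteed to a strict maximum among the rivals. Measurability needs
  care because histories show priority values to the player, while programs only compare them; the
  player's answers and the order pattern of finitely many draws form a code with countably many
  values that determines the relevant events. The value 1 / C_p is the mean of x ^ m for uniform x
  and m = C_p - 1. The squares in \<open>T0\<close> arise because an attempt helps up to \<kappa>
  runs on each of up to L locks, and each run costs O(\<kappa> L T).\<close>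

lemma prog_step_effect:
  "prog_step u n m r = (l, m', r') \<Longrightarrow>
     stat m' = (case l of StatusCas x y z b \<Rightarrow> if b then (stat m)(x := z) else stat m | _ \<Rightarrow> stat m) \<and>
     priority m' = (case l of PriorityWrite x v \<Rightarrow> (priority m)(x := v) | _ \<Rightarrow> priority m) \<and>
     (\<forall>x y z b. l = StatusCas x y z b \<longrightarrow> b = (stat m x = y))"
  by (induction r) (auto simp: Let_def split: if_splits)

lemma bind_Return_iff: "bind_prog r g = Return b \<longleftrightarrow> (\<exists>a. r = Return a \<and> g a = Return b)"
  by (cases r) auto

lemma tryLocks_not_Return: "tryLocks S p \<noteq> Return a"
  by (auto simp: tryLocks_def bind_Return_iff multiInsert_def clearFlag_def)

definition word_label :: "label \<Rightarrow> bool" where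
  "word_label l \<longleftrightarrow> (case l of WordRead _ _ _ \<Rightarrow> True | WordWrite _ _ _ \<Rightarrow> True | WordCas _ _ _ _ _ \<Rightarrow> True | _ \<Rightarrow> False)"

lemma word_label_simps [simp]:
  "word_label (WordRead R x v)" "word_label (WordWrite R x v)" "word_label (WordCas R x v w d)"
  "\<not> word_label (Ev e)" "\<not> word_label (StatusCas p s s' d)"
  by (auto simp: word_label_def)

section \<open>Steps of a fixed execution and quantities determined by the schedule\<close>

locale execution =
  fixes S :: system and \<omega> :: "nat \<Rightarrow> real"
begin

abbreviation "\<sigma> \<equiv> step_at S \<omega>"
abbreviation "mem t \<equiv> shared (config_at S \<omega> t)"
abbreviation "lcl t \<equiv> local (config_at S \<omega> t)"
abbreviation "stt t \<equiv> stat (mem t)"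

lemma length_hist: "length (hist S \<omega> t) = t"
  by (induction t) (auto simp: hist_def split: prod.split)

lemma step_at_eq: "\<sigma> t = (sched S t, fst (system_step S t (\<omega> t) (hist S \<omega> t) (config_at S \<omega> t)))"
  using length_hist[of t]
  by (auto simp: step_at_def hist_def config_at_def nth_append split: prod.split)

lemma config_Suc:
  "config_at S \<omega> (Suc t) = snd (system_step S t (\<omega> t) (hist S \<omega> t) (config_at S \<omega> t))"
  by (auto simp: hist_def config_at_def split: prod.split)

lemma fst_step_at [simp]: "fst (\<sigma> t) = sched S t"
  by (simp add: step_at_eq)

lemma step_at_sched: "\<sigma> t = (q, l) \<Longrightarrow> sched S t = q"
  by (metis fst_conv fst_step_at)

text \<open>The identity of a descriptor is its invocation time, so the schedule alone determines
  the owner and \<omega> does not occur. The same holds for \<open>taken\<close>, so both can be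
  shared by different executions.\<close>

definition owner :: "desc \<Rightarrow> proc" where
  "owner x = sched S (ident x)"

text \<open>Phrased by the state and the player's answer before the step at \<open>ident x\<close>,
  not by the label \<open>TryInv x\<close>: in this form it depends only on draws before
  \<open>ident x\<close>, as \<open>started_cong\<close> requires.\<close>

definition started :: "desc \<Rightarrow> bool" where
  "started x \<longleftrightarrow> lcl (ident x) (owner x) = Idle \<and>
     player S (hist S \<omega> (ident x)) (owner x) = Some (lockList x, thunk x)"

lemma started_inj:
  assumes "started x" "started y" "ident y = ident x"
  shows "y = x"
proof -
  have "owner y = owner x" using assms(3) by (simp add: owner_def)
  with assms have "Some (lockList y, thunk y) = Some (lockList x, thunk x)"
    by (metis started_def)
  with assms(3) show ?thesis by (auto intro: desc.expand)
qed

text \<open>The invocation step counts, so the value is 1 when \<open>tryLocks\<close> begins, in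
  agreement with the counter in \<open>Busy\<close>. Counting goes on after the response, which
  later serves to locate the starts of retries.\<close>

definition taken :: "desc \<Rightarrow> nat \<Rightarrow> nat" where
  "taken x t = card {i. ident x \<le> i \<and> i < t \<and> sched S i = owner x}"

lemma taken_Suc:
  "ident x \<le> t \<Longrightarrow> taken x (Suc t) = (if sched S t = owner x then Suc (taken x t) else taken x t)"
proof -
  assume "ident x \<le> t"
  then have "{i. ident x \<le> i \<and> i < Suc t \<and> sched S i = owner x} =
     (if sched S t = owner x then insert t {i. ident x \<le> i \<and> i < t \<and> sched S i = owner x}
      else {i. ident x \<le> i \<and> i < t \<and> sched S i = owner x})"
    by (auto simp: less_Suc_eq)
  then show ?thesis by (simp add: taken_def)
qed

lemma taken_start: "taken x (Suc (ident x)) = 1"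
  by (simp add: taken_Suc) (simp add: owner_def taken_def)

lemma taken_mono: "t \<le> t' \<Longrightarrow> taken x t \<le> taken x t'"
  unfolding taken_def by (rule card_mono) auto

lemma taken_strict:
  assumes "ident x \<le> t" "t < t'" "sched S t = owner x"
  shows "taken x t < taken x t'"
  using taken_mono[of "Suc t" t' x] assms by (simp add: taken_Suc)

lemma idle_step:
  assumes "lcl t q = Idle" "sched S t = q"
  obtains "\<sigma> t = (q, Idling)" "config_at S \<omega> (Suc t) = config_at S \<omega> t" "player S (hist S \<omega> t) q = None"
  | x where "ident x = t" "owner x = q" "started x" "\<sigma> t = (q, Ev (TryInv x))"
      "mem (Suc t) = mem t" "lcl (Suc t) = (lcl t)(q := Busy (tryLocks S x) 1)"
proof (cases "player S (hist S \<omega> t) q")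
  case None
  with assms show ?thesis
    by (intro that(1)) (auto simp: step_at_eq config_Suc system_step_def)
next
  case (Some a)
  obtain ls th where a: "a = (ls, th)" by (cases a)
  show ?thesis
    by (rule that(2)[of "Desc t ls th"])
      (use assms Some a in \<open>auto simp: step_at_eq config_Suc system_step_def started_def owner_def Let_def\<close>)
qed

lemma busy_step:
  assumes "lcl t q = Busy r n" "sched S t = q"
  obtains l m r' where "prog_step (\<omega> t) n (mem t) r = (l, m, r')" "\<sigma> t = (q, l)" "mem (Suc t) = m"
    "lcl (Suc t) = (lcl t)(q := if r' = Return () then Idle else Busy r' (Suc n))"
proof -
  obtain l m r' where "prog_step (\<omega> t) n (mem t) r = (l, m, r')" by (metis prod_cases3)
  with assms show ?thesis
    by (intro that[of l m r']) (auto simp: step_at_eq config_Suc system_step_def Let_def)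
qed

lemma lcl_other: "sched S t \<noteq> q \<Longrightarrow> lcl (Suc t) q = lcl t q"
  by (auto simp: config_Suc system_step_def Let_def split: proc_state.split option.split prod.split)

lemma step_cases:
  obtains "lcl t (sched S t) = Idle" | r n where "lcl t (sched S t) = Busy r n"
  by (cases "lcl t (sched S t)") auto

lemma stat_Suc:
  "stt (Suc t) = (case snd (\<sigma> t) of StatusCas x y z b \<Rightarrow> if b then (stt t)(x := z) else stt t | _ \<Rightarrow> stt t)"
proof (rule step_cases[of t])
  assume "lcl t (sched S t) = Idle"
  then show ?thesis by (rule idle_step) auto
next
  fix r n assume "lcl t (sched S t) = Busy r n"
  then show ?thesis by (rule busy_step) (use prog_step_effect in \<open>simp_all\<close>)
qed

lemma priority_Suc:
  "priority (mem (Suc t)) =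
     (case snd (\<sigma> t) of PriorityWrite x v \<Rightarrow> (priority (mem t))(x := v) | _ \<Rightarrow> priority (mem t))"
proof (rule step_cases[of t])
  assume "lcl t (sched S t) = Idle"
  then show ?thesis by (rule idle_step) auto
next
  fix r n assume "lcl t (sched S t) = Busy r n"
  then show ?thesis by (rule busy_step) (use prog_step_effect in \<open>simp_all\<close>)
qed

lemma cas_result: "\<sigma> t = (q, StatusCas x y z d) \<Longrightarrow> d = (stt t x = y)"
proof (rule step_cases[of t])
  assume "lcl t (sched S t) = Idle" "\<sigma> t = (q, StatusCas x y z d)"
  then show ?thesis by (elim idle_step) auto
next
  fix r n assume a: "lcl t (sched S t) = Busy r n" "\<sigma> t = (q, StatusCas x y z d)"
  from a(1) obtain l m r' where "prog_step (\<omega> t) n (mem t) r = (l, m, r')" "\<sigma> t = (sched S t, l)"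
    by (rule busy_step) auto
  with a prog_step_effect show ?thesis by fastforce
qed

lemma priority_0: "priority (mem 0) x = -1" and stat_0: "stt 0 x = Active" and lcl_0: "lcl 0 q = Idle"
  by (simp_all add: config_at_def init_config_def)

section \<open>A program logic relative to one execution\<close>

definition nextstep :: "proc \<Rightarrow> nat \<Rightarrow> nat \<Rightarrow> label \<Rightarrow> bool" where
  "nextstep q t u l \<longleftrightarrow> t \<le> u \<and> (\<forall>i. t \<le> i \<and> i < u \<longrightarrow> sched S i \<noteq> q) \<and> \<sigma> u = (q, l)"

text \<open>
  \<open>wp q G r Q t n\<close>: if process \<open>q\<close> is about to execute \<open>r\<close> at time \<open>t\<close> as its \<open>n\<close>-th step, then each
  step of \<open>r\<close> that occurs in the execution satisfies \<open>G\<close>, and \<open>Q\<close> holds if and when \<open>r\<close> returns.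
  A delay directly before \<open>Return\<close> is excluded because it would idle forever.
\<close>

primrec wp :: "proc \<Rightarrow> (nat \<Rightarrow> nat \<Rightarrow> label \<Rightarrow> bool) \<Rightarrow> 'a prog \<Rightarrow> ('a \<Rightarrow> nat \<Rightarrow> nat \<Rightarrow> bool) \<Rightarrow>
    nat \<Rightarrow> nat \<Rightarrow> bool" where
  "wp q G (Return a) Q t n = Q a t n"
| "wp q G (ReadPriority p f) Q t n = (\<forall>u. nextstep q t u (PriorityRead p (priority (mem u) p)) \<longrightarrow>
     G u n (PriorityRead p (priority (mem u) p)) \<and> wp q G (f (priority (mem u) p)) Q (Suc u) (Suc n))"
| "wp q G (WritePriority p v r) Q t n = (\<forall>u. nextstep q t u (PriorityWrite p v) \<longrightarrow>
     G u n (PriorityWrite p v) \<and> wp q G r Q (Suc u) (Suc n))"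
| "wp q G (RandomPriority p r) Q t n = (\<forall>u. nextstep q t u (PriorityWrite p (\<omega> u)) \<longrightarrow>
     G u n (PriorityWrite p (\<omega> u)) \<and> wp q G r Q (Suc u) (Suc n))"
| "wp q G (ReadStatus p f) Q t n = (\<forall>u. nextstep q t u (StatusRead p (stt u p)) \<longrightarrow>
     G u n (StatusRead p (stt u p)) \<and> wp q G (f (stt u p)) Q (Suc u) (Suc n))"
| "wp q G (CasStatus p x y f) Q t n = (\<forall>u. nextstep q t u (StatusCas p x y (stt u p = x)) \<longrightarrow>
     G u n (StatusCas p x y (stt u p = x)) \<and> wp q G (f (stt u p = x)) Q (Suc u) (Suc n))"
| "wp q G (Read R x f) Q t n = (\<forall>u v. nextstep q t u (WordRead R x v) \<longrightarrow>
     G u n (WordRead R x v) \<and> wp q G (f v) Q (Suc u) (Suc n))"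
| "wp q G (Write R x v r) Q t n = (\<forall>u. nextstep q t u (WordWrite R x v) \<longrightarrow>
     G u n (WordWrite R x v) \<and> wp q G r Q (Suc u) (Suc n))"
| "wp q G (Cas R x v w f) Q t n = (\<forall>u d. nextstep q t u (WordCas R x v w d) \<longrightarrow>
     G u n (WordCas R x v w d) \<and> wp q G (f d) Q (Suc u) (Suc n))"
| "wp q G (Event e r) Q t n = (\<forall>u. nextstep q t u (Ev e) \<longrightarrow>
     G u n (Ev e) \<and> wp q G r Q (Suc u) (Suc n))"
| "wp q G (DelayUntil k r) Q t n = ((\<forall>a. r \<noteq> Return a) \<and>
     (\<forall>u j. n \<le> j \<and> j < k \<longrightarrow> G u j Idling) \<and>
     (\<forall>t'\<ge>t. (n < k \<or> t' = t) \<and> (\<forall>u. t \<le> u \<and> u < t' \<and> sched S u = q \<longrightarrow> \<sigma> u = (q, Idling)) \<longrightarrow>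
        wp q G r Q t' (max n k)))"

text \<open>The side condition on delays survives, because \<open>bind_prog r g\<close> can be a
  \<open>Return\<close> only if \<open>r\<close> is one.\<close>

lemma wp_bind: "wp q G r (\<lambda>x. wp q G (g x) Q) t n \<Longrightarrow> wp q G (bind_prog r g) Q t n"
  by (induction r arbitrary: t n) (auto simp: bind_Return_iff)

lemma wp_mono:
  "wp q G r Q t n \<Longrightarrow> (\<And>u n l. G u n l \<Longrightarrow> G' u n l) \<Longrightarrow> (\<And>x t n. Q x t n \<Longrightarrow> Q' x t n) \<Longrightarrow>
    wp q G' r Q' t n"
  by (induction r arbitrary: t n) auto

lemma wp_conj:
  "wp q G r Q t n \<Longrightarrow> wp q G' r Q' t n \<Longrightarrow>
    wp q (\<lambda>u n l. G u n l \<and> G' u n l) r (\<lambda>x t n. Q x t n \<and> Q' x t n) t n"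
  by (induction r arbitrary: t n) auto

definition trail :: "proc \<Rightarrow> (nat \<Rightarrow> nat \<Rightarrow> label \<Rightarrow> bool) \<Rightarrow> nat \<Rightarrow> nat \<Rightarrow> bool" where
  "trail q G t t' \<longleftrightarrow> t \<le> t' \<and> (\<forall>u l. t \<le> u \<and> u < t' \<and> \<sigma> u = (q, l) \<longrightarrow> (\<exists>j. G u j l))"

lemma trail_step: "nextstep q t u l \<Longrightarrow> G u n l \<Longrightarrow> trail q G (Suc u) t' \<Longrightarrow> trail q G t t'"
  unfolding trail_def nextstep_def
  by (metis (no_types, lifting) Suc_le_eq le_trans linorder_cases not_less_eq_eq order_less_imp_le
      prod.inject step_at_sched)

lemma wp_trail_step:
  assumes "nextstep q t u l" "G u n l"
    and "wp q G r (\<lambda>x t' n'. Q x t' n' \<and> trail q G (Suc u) t' \<and> Suc n \<le> n') (Suc u) (Suc n)"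
  shows "wp q G r (\<lambda>x t' n'. Q x t' n' \<and> trail q G t t' \<and> n \<le> n') (Suc u) (Suc n)"
  by (rule wp_mono[OF assms(3)]) (use trail_step[of q t u l G n, OF assms(1,2)] in auto)

text \<open>Turns the guarantee on single steps into a fact about the whole interval, available in
  the postcondition. The frame rules rest on it.\<close>

lemma wp_trail:
  "wp q G r Q t n \<Longrightarrow> wp q G r (\<lambda>x t' n'. Q x t' n' \<and> trail q G t t' \<and> n \<le> n') t n"
proof (induction r arbitrary: t n)
  case (Return a)
  then show ?case by (auto simp: trail_def)
next
  case (DelayUntil k r)
  show ?case
    unfolding wp.simps
  proof (intro conjI allI impI; (elim conjE)?)
    fix t' assume t': "t \<le> t'" "n < k \<or> t' = t"
       "\<forall>u. t \<le> u \<and> u < t' \<and> sched S u = q \<longrightarrow> \<sigma> u = (q, Idling)"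
    have tr: "trail q G t t'"
      unfolding trail_def
    proof (intro conjI allI impI t'(1); elim conjE)
      fix u l assume u: "t \<le> u" "u < t'" "\<sigma> u = (q, l)"
      with t' have "\<sigma> u = (q, Idling)" using step_at_sched by blast
      with u t'(2) DelayUntil.prems show "\<exists>j. G u j l" by auto
    qed
    from DelayUntil.prems t' have "wp q G r Q t' (max n k)" by simp
    from DelayUntil.IH[OF this]
    show "wp q G r (\<lambda>x t' n'. Q x t' n' \<and> trail q G t t' \<and> n \<le> n') t' (max n k)"
      by (rule wp_mono) (use tr in \<open>fastforce simp: trail_def not_less\<close>)+
  qed (use DelayUntil.prems in auto)
qed (auto intro!: wp_trail_step)

lemma nextstep_wait: "nextstep q (Suc t) u l \<Longrightarrow> sched S t \<noteq> q \<Longrightarrow> nextstep q t u l"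
  unfolding nextstep_def by (auto simp: Suc_le_eq) (metis le_neq_implies_less)

text \<open>Steps of other processes do no harm, since \<open>wp\<close> speaks of the next step of
  \<open>q\<close> at whatever time it comes. \<open>Return\<close> is excluded because its
  postcondition may depend on the time.\<close>

lemma wp_wait:
  "wp q G r Q t n \<Longrightarrow> sched S t \<noteq> q \<Longrightarrow> (\<And>a. r \<noteq> Return a) \<Longrightarrow> wp q G r Q (Suc t) n"
proof (induction r arbitrary: n)
  case (DelayUntil k r)
  show ?case
    unfolding wp.simps
  proof (intro conjI allI impI; (elim conjE)?)
    fix t' assume t': "Suc t \<le> t'" "n < k \<or> t' = Suc t"
       "\<forall>u. Suc t \<le> u \<and> u < t' \<and> sched S u = q \<longrightarrow> \<sigma> u = (q, Idling)"
    show "wp q G r Q t' (max n k)"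
    proof (cases "n < k")
      case True
      from t'(3) DelayUntil.prems(2)
      have "\<forall>u. t \<le> u \<and> u < t' \<and> sched S u = q \<longrightarrow> \<sigma> u = (q, Idling)"
        by (metis Suc_leI le_neq_implies_less)
      with True t' DelayUntil.prems show ?thesis by simp
    next
      case False
      with DelayUntil.prems have "wp q G r Q t n" by (auto simp: max_def split: if_splits)
      with DelayUntil False t' show ?thesis by (auto simp: max_def)
    qed
  qed (use DelayUntil.prems in auto)
qed (auto dest: nextstep_wait)

text \<open>The induction is for expired delays: these execute the first step of their continuation,
  and there \<open>max n k = n\<close>.\<close>

lemma wp_step:
  "wp q G r Q t n \<Longrightarrow> (\<And>a. r \<noteq> Return a) \<Longrightarrow> prog_step (\<omega> t) n (mem t) r = (l, m', r') \<Longrightarrow>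
    \<sigma> t = (q, l) \<Longrightarrow> G t n l \<and> wp q G r' Q (Suc t) (Suc n)"
proof (induction r arbitrary: n)
  case (DelayUntil k r)
  show ?case
  proof (cases "n < k")
    case True
    with DelayUntil.prems have l: "l = Idling" "r' = DelayUntil k r" by auto
    have "wp q G r' Q (Suc t) (Suc n)"
      unfolding l wp.simps
    proof (intro conjI allI impI; (elim conjE)?)
      fix t' assume t': "Suc t \<le> t'" "Suc n < k \<or> t' = Suc t"
         "\<forall>u. Suc t \<le> u \<and> u < t' \<and> sched S u = q \<longrightarrow> \<sigma> u = (q, Idling)"
      from t'(3) DelayUntil.prems(4) l
      have "\<forall>u. t \<le> u \<and> u < t' \<and> sched S u = q \<longrightarrow> \<sigma> u = (q, Idling)"
        by (metis Suc_leI le_neq_implies_less)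
      with True t' DelayUntil.prems(1) have "wp q G r Q t' (max n k)" by simp
      with True show "wp q G r Q t' (max (Suc n) k)" by (simp add: max_def)
    qed (use DelayUntil.prems in auto)
    with l DelayUntil.prems True show ?thesis by auto
  next
    case False
    then have "max n k = n" by simp
    with DelayUntil.prems(1) have "wp q G r Q t n" by auto
    with DelayUntil False show ?thesis by auto
  qed
qed (auto simp: nextstep_def Let_def)

text \<open>The invariant of an attempt in progress. That the counter in \<open>Busy\<close> equals
  \<open>taken\<close> ties the step numbers in \<open>wp\<close> to the schedule.\<close>

definition running ::
  "(desc \<Rightarrow> nat \<Rightarrow> nat \<Rightarrow> label \<Rightarrow> bool) \<Rightarrow> (desc \<Rightarrow> nat \<Rightarrow> nat \<Rightarrow> bool) \<Rightarrow> desc \<Rightarrow> nat \<Rightarrow> bool" where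
  "running G Q x t \<longleftrightarrow> started x \<and> ident x < t \<and> (\<exists>r. lcl t (owner x) = Busy r (taken x t) \<and>
     (\<forall>a. r \<noteq> Return a) \<and> wp (owner x) (G x) r (\<lambda>_. Q x) t (taken x t))"

lemma running_step:
  assumes "running G Q x t"
  shows "sched S t = owner x \<longrightarrow> (\<exists>l. \<sigma> t = (owner x, l) \<and> G x t (taken x t) l)"
    and "running G Q x (Suc t) \<or> (lcl (Suc t) (owner x) = Idle \<and> Q x (Suc t) (taken x (Suc t)))"
proof -
  from assms obtain r where r: "started x" "ident x < t" "lcl t (owner x) = Busy r (taken x t)"
     "\<And>a. r \<noteq> Return a" "wp (owner x) (G x) r (\<lambda>_. Q x) t (taken x t)"
    by (auto simp: running_def)
  have "(sched S t = owner x \<longrightarrow> (\<exists>l. \<sigma> t = (owner x, l) \<and> G x t (taken x t) l)) \<and>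
    (running G Q x (Suc t) \<or> (lcl (Suc t) (owner x) = Idle \<and> Q x (Suc t) (taken x (Suc t))))"
  proof (cases "sched S t = owner x")
    case True
    obtain l m r' where s: "prog_step (\<omega> t) (taken x t) (mem t) r = (l, m, r')" "\<sigma> t = (owner x, l)"
      "lcl (Suc t) = (lcl t)(owner x := if r' = Return () then Idle else Busy r' (Suc (taken x t)))"
      using busy_step[OF r(3) True] by metis
    from wp_step[OF r(5,4) s(1,2)]
    have w: "G x t (taken x t) l" "wp (owner x) (G x) r' (\<lambda>_. Q x) (Suc t) (taken x (Suc t))"
      using True r(2) by (auto simp: taken_Suc)
    show ?thesis
      using w s r True by (cases "r' = Return ()") (auto simp: running_def taken_Suc)
  next
    case False
    with r have "running G Q x (Suc t)"
      using wp_wait[OF r(5) False r(4)] lcl_other[OF False] by (auto simp: running_def taken_Suc)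
    with False show ?thesis by simp
  qed
  then show "sched S t = owner x \<longrightarrow> (\<exists>l. \<sigma> t = (owner x, l) \<and> G x t (taken x t) l)"
    and "running G Q x (Suc t) \<or> (lcl (Suc t) (owner x) = Idle \<and> Q x (Suc t) (taken x (Suc t)))"
    by auto
qed

section \<open>From verified attempts to all steps of the execution\<close>

context
  fixes G :: "desc \<Rightarrow> nat \<Rightarrow> nat \<Rightarrow> label \<Rightarrow> bool" and Q :: "desc \<Rightarrow> nat \<Rightarrow> nat \<Rightarrow> bool"
  assumes attempt: "\<And>x. started x \<Longrightarrow> wp (owner x) (G x) (tryLocks S x) (\<lambda>_. Q x) (Suc (ident x)) 1"
begin

lemma running_start:
  assumes "started x"
  shows "running G Q x (Suc (ident x))"
proof -
  have "lcl (ident x) (owner x) = Idle" "sched S (ident x) = owner x"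
    using assms by (auto simp: started_def owner_def)
  then have "lcl (Suc (ident x)) (owner x) = Busy (tryLocks S x) 1"
  proof (rule idle_step)
    assume "player S (hist S \<omega> (ident x)) (owner x) = None"
    with assms show ?thesis by (simp add: started_def)
  next
    fix y assume y: "ident y = ident x" "owner y = owner x" "started y"
      "lcl (Suc (ident x)) = (lcl (ident x))(owner x := Busy (tryLocks S y) 1)"
    with assms have "y = x" by (blast intro: started_inj)
    with y show ?thesis by simp
  qed
  with assms attempt[OF assms] tryLocks_not_Return show ?thesis
    by (auto simp: running_def taken_start)
qed

lemma idle_or_running: "lcl t q = Idle \<or> (\<exists>x. owner x = q \<and> running G Q x t)"
proof (induction t)
  case 0
  then show ?case by (simp add: lcl_0)
next
  case (Suc t)
  then show ?case
  proof (elim disjE exE conjE)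
    assume idle: "lcl t q = Idle"
    show ?thesis
    proof (cases "sched S t = q")
      case True
      from idle_step[OF idle True] show ?thesis
        by (metis running_start idle)
    qed (use idle lcl_other in auto)
  next
    fix x assume "owner x = q" "running G Q x t"
    with running_step(2)[OF this(2)] show ?thesis by auto
  qed
qed

text \<open>The interface through which a verified property of \<open>tryLocks\<close> becomes a
  property of every label in the execution.\<close>

lemma label_cases:
  assumes "\<sigma> t = (q, l)"
  obtains "l = Idling"
  | x where "l = Ev (TryInv x)" "started x" "ident x = t" "owner x = q"
  | x where "started x" "ident x < t" "owner x = q" "G x t (taken x t) l"
proof -
  have sq: "sched S t = q" using assms by (rule step_at_sched)
  from idle_or_running[of t q] show ?thesis
  proof (elim disjE exE conjE)
    assume "lcl t q = Idle"
    from this sq show ?thesis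
    proof (rule idle_step)
      assume "\<sigma> t = (q, Idling)"
      with assms that(1) show ?thesis by simp
    next
      fix x assume "ident x = t" "owner x = q" "started x" "\<sigma> t = (q, Ev (TryInv x))"
      with assms that(2)[of x] show ?thesis by simp
    qed
  next
    fix x assume "owner x = q" "running G Q x t"
    with running_step(1)[OF this(2)] sq assms that(3)[of x] show ?thesis
      by (auto simp: running_def)
  qed
qed

lemma running_or_ended:
  assumes "started x" "ident x < t"
  shows "running G Q x t \<or> (\<exists>e. ident x < e \<and> e \<le> t \<and> lcl e (owner x) = Idle \<and> Q x e (taken x e))"
  using assms(2)
proof (induction t)
  case (Suc t)
  show ?case
  proof (cases "ident x = t")
    case True
    then show ?thesis using running_start[OF assms(1)] by simp
  next
    case False
    with Suc have "running G Q x t \<or> (\<exists>e. ident x < e \<and> e \<le> t \<and> lcl e (owner x) = Idle \<and> Q x e (taken x e))"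
      by simp
    then show ?thesis
    proof
      assume "running G Q x t"
      from running_step(2)[OF this] Suc.prems show ?thesis by blast
    qed (use le_SucI in blast)
  qed
qed simp

end

lemma started_TryInv:
  assumes "started x"
  shows "\<sigma> (ident x) = (owner x, Ev (TryInv x))"
proof -
  have "lcl (ident x) (owner x) = Idle" "sched S (ident x) = owner x"
    using assms by (auto simp: started_def owner_def)
  then show ?thesis
  proof (rule idle_step)
    assume "player S (hist S \<omega> (ident x)) (owner x) = None"
    with assms show ?thesis by (simp add: started_def)
  next
    fix y assume y: "ident y = ident x" "owner y = owner x" "started y"
      "\<sigma> (ident x) = (owner x, Ev (TryInv y))"
    with assms have "y = x" by (blast intro: started_inj)
    with y show ?thesis by simp
  qed
qed

text \<open>
  The flag \<open>c\<close> switches the counting of steps on.  The ownership facts are needed to bound the lists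
  returned by \<open>getSet\<close>, so they have to be derived without counting.
\<close>

definition hoare :: "proc \<Rightarrow> bool \<Rightarrow> (nat \<Rightarrow> label \<Rightarrow> bool) \<Rightarrow> nat \<Rightarrow> (nat \<Rightarrow> bool) \<Rightarrow> 'a prog \<Rightarrow>
    ('a \<Rightarrow> nat \<Rightarrow> bool) \<Rightarrow> bool" where
  "hoare q c G B P r R \<longleftrightarrow> (\<forall>N t n. P t \<and> (c \<longrightarrow> n + B \<le> N) \<longrightarrow>
     wp q (\<lambda>u j l. (c \<longrightarrow> j < N) \<and> G u l) r (\<lambda>x t' n'. R x t' \<and> (c \<longrightarrow> n' \<le> n + B)) t n)"

lemma hoare_wp:
  assumes "hoare q c G B P r R" "P t" "c \<Longrightarrow> n + B \<le> N"
    and "\<And>u j l. G u l \<Longrightarrow> (c \<Longrightarrow> j < N) \<Longrightarrow> G' u j l"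
    and "\<And>x t' n'. R x t' \<Longrightarrow> (c \<Longrightarrow> n' \<le> n + B) \<Longrightarrow> n \<le> n' \<Longrightarrow> t \<le> t' \<Longrightarrow> Q x t' n'"
  shows "wp q G' r Q t n"
proof -
  have "wp q (\<lambda>u j l. (c \<longrightarrow> j < N) \<and> G u l) r (\<lambda>x t' n'. R x t' \<and> (c \<longrightarrow> n' \<le> n + B)) t n"
    using assms(1-3) by (auto simp: hoare_def)
  from wp_trail[OF this] show ?thesis
    by (rule wp_mono) (use assms(4,5) in \<open>auto simp: trail_def\<close>)
qed

lemma hoare_Return: "(\<And>t. P t \<Longrightarrow> R a t) \<Longrightarrow> hoare q c G B P (Return a) R"
  by (auto simp: hoare_def)

lemma hoare_bind:
  assumes "hoare q c G B1 P r R1" "\<And>x. hoare q c G B2 (R1 x) (g x) R"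
  shows "hoare q c G (B1 + B2) P (bind_prog r g) R"
  unfolding hoare_def
proof (intro allI impI wp_bind)
  fix N t n assume P: "P t \<and> (c \<longrightarrow> n + (B1 + B2) \<le> N)"
  show "wp q (\<lambda>u j l. (c \<longrightarrow> j < N) \<and> G u l) r
     (\<lambda>x. wp q (\<lambda>u j l. (c \<longrightarrow> j < N) \<and> G u l) (g x) (\<lambda>x t' n'. R x t' \<and> (c \<longrightarrow> n' \<le> n + (B1 + B2)))) t n"
    by (rule hoare_wp[OF assms(1), where N=N])
      (use P in \<open>auto intro!: hoare_wp[OF assms(2), where N=N]\<close>)
qed

lemma hoare_conseq:
  assumes "hoare q c G B P r R" "\<And>t. P' t \<Longrightarrow> P t" "\<And>x t. R x t \<Longrightarrow> R' x t" "\<And>u l. G u l \<Longrightarrow> G' u l"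
    "c \<Longrightarrow> B \<le> B'"
  shows "hoare q c G' B' P' r R'"
  unfolding hoare_def
  by (intro allI impI, elim conjE, rule hoare_wp[OF assms(1)])
    (use assms(2-5) in \<open>fastforce\<close>)+

text \<open>\<open>F\<close> has to survive arbitrary steps of other processes, but only those own
  steps that satisfy \<open>G\<close>. If \<open>G\<close> excludes the protocol steps of a
  descriptor, facts about that descriptor persist while its owner helps others.\<close>

lemma hoare_frame:
  assumes "hoare q c G B P r R"
    and "\<And>t t'. F t \<Longrightarrow> t \<le> t' \<Longrightarrow> (\<And>u l. t \<le> u \<Longrightarrow> u < t' \<Longrightarrow> \<sigma> u = (q, l) \<Longrightarrow> G u l) \<Longrightarrow> F t'"
  shows "hoare q c G B (\<lambda>t. P t \<and> F t) r (\<lambda>x t. R x t \<and> F t)"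
  unfolding hoare_def
proof (intro allI impI)
  fix N t n assume P: "(P t \<and> F t) \<and> (c \<longrightarrow> n + B \<le> N)"
  then have "wp q (\<lambda>u j l. (c \<longrightarrow> j < N) \<and> G u l) r (\<lambda>x t' n'. R x t' \<and> (c \<longrightarrow> n' \<le> n + B)) t n"
    using assms(1) by (auto simp: hoare_def)
  from wp_trail[OF this]
  show "wp q (\<lambda>u j l. (c \<longrightarrow> j < N) \<and> G u l) r (\<lambda>x t' n'. (R x t' \<and> F t') \<and> (c \<longrightarrow> n' \<le> n + B)) t n"
    by (rule wp_mono) (use P assms(2)[of t] in \<open>auto simp: trail_def\<close>)
qed

lemma hoare_ctx: "(\<And>t0. P t0 \<Longrightarrow> hoare q c G B (\<lambda>t. t = t0) r R) \<Longrightarrow> hoare q c G B P r R"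
  by (auto simp: hoare_def)

text \<open>Indexing the invariant by the set of elements handled so far suits loops that establish
  one fact per lock or per descriptor.\<close>

lemma hoare_for_each:
  assumes "\<And>x A. x \<in> set xs \<Longrightarrow> hoare q c G B (I A) (f x) (\<lambda>_. I (insert x A))"
    and "c \<Longrightarrow> length xs * B \<le> B'"
  shows "hoare q c G B' (I A) (for_each xs f) (\<lambda>_. I (A \<union> set xs))"
proof -
  have "hoare q c G (length xs * B) (I A) (for_each xs f) (\<lambda>_. I (A \<union> set xs))"
    using assms(1)
  proof (induction xs arbitrary: A)
    case (Cons x xs)
    then have "hoare q c G (B + length xs * B) (I A) (bind_prog (f x) (\<lambda>_. for_each xs f))
       (\<lambda>_. I (insert x A \<union> set xs))"
      by (intro hoare_bind) (auto simp del: Un_insert_left)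
    then show ?case by simp
  qed (auto intro: hoare_Return)
  then show ?thesis by (rule hoare_conseq) (use assms in auto)
qed

text \<open>In \<open>wp\<close> the values read from words are arbitrary, so the step bound of the
  code is all that enters. Thunks and active set code are treated alike.\<close>

lemma wp_exec_code:
  assumes "max_steps d k" "\<And>u j l. word_label l \<Longrightarrow> n \<le> j \<Longrightarrow> j < n + k \<Longrightarrow> G u j l"
    "\<And>x t' n'. trail q (\<lambda>u j l. word_label l) t t' \<Longrightarrow> n \<le> n' \<Longrightarrow> n' \<le> n + k \<Longrightarrow> Q x t' n'"
  shows "wp q G (exec_code R d) Q t n"
  using assms
proof (induction d arbitrary: t n k)
  case (Done a)
  have "trail q (\<lambda>u j l. word_label l) t t" by (auto simp: trail_def)
  with Done show ?case by auto
next
  case (ReadWord x f)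
  from ReadWord.prems(1) obtain m where m: "k = Suc m" "\<And>v. max_steps (f v) m" by auto
  show ?case unfolding exec_code.simps wp.simps
  proof (intro allI impI conjI)
    fix u v assume a: "nextstep q t u (WordRead R x v)"
    show "wp q G (exec_code R (f v)) Q (Suc u) (Suc n)"
      by (rule ReadWord.IH[OF rangeI m(2)])
        (use m ReadWord.prems(2,3) trail_step[OF a] in \<open>auto\<close>)
  qed (use ReadWord.prems(2) m in auto)
next
  case (WriteWord x v p)
  from WriteWord.prems(1) obtain m where m: "k = Suc m" "max_steps p m" by auto
  show ?case unfolding exec_code.simps wp.simps
  proof (intro allI impI conjI)
    fix u assume a: "nextstep q t u (WordWrite R x v)"
    show "wp q G (exec_code R p) Q (Suc u) (Suc n)"
      by (rule WriteWord.IH[OF m(2)])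
        (use m WriteWord.prems(2,3) trail_step[OF a] in \<open>auto\<close>)
  qed (use WriteWord.prems(2) m in auto)
next
  case (CasWord x v w f)
  from CasWord.prems(1) obtain m where m: "k = Suc m" "\<And>v. max_steps (f v) m" by auto
  show ?case unfolding exec_code.simps wp.simps
  proof (intro allI impI conjI)
    fix u d assume a: "nextstep q t u (WordCas R x v w d)"
    show "wp q G (exec_code R (f d)) Q (Suc u) (Suc n)"
      by (rule CasWord.IH[OF rangeI m(2)])
        (use m CasWord.prems(2,3) trail_step[OF a] in \<open>auto\<close>)
  qed (use CasWord.prems(2) m in auto)
qed

end

section \<open>Ownership of steps\<close>

text \<open>The labels that a process may produce on behalf of any descriptor. Excluded are the
  steps reserved to the owner (priority writes, insertions, removals, attempt events) and every
  status CAS that does not lead away from \<open>Active\<close>.\<close>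

definition quiet :: "label \<Rightarrow> bool" where
  "quiet l \<longleftrightarrow> (case l of
       StatusCas x y z d \<Rightarrow> y = Active \<and> z \<noteq> Active
     | PriorityWrite x v \<Rightarrow> False
     | Ev e \<Rightarrow> (case e of TryInv x \<Rightarrow> False | TryResp x d \<Rightarrow> False
         | ASInv lk opr \<Rightarrow> opr = GetSet | _ \<Rightarrow> True)
     | _ \<Rightarrow> True)"

lemma quiet_word: "word_label l \<Longrightarrow> quiet l"
  by (auto simp: quiet_def word_label_def split: label.splits)

context execution
begin

text \<open>Process, time and step number are universally quantified: a check of the code alone,
  without knowledge of the state.\<close>

definition emits :: "(nat \<Rightarrow> label \<Rightarrow> bool) \<Rightarrow> 'a prog \<Rightarrow> bool" where
  "emits P r \<longleftrightarrow> (\<forall>q t n. wp q (\<lambda>u n l. P u l) r (\<lambda>_ _ _. True) t n)"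

lemma emits_intros:
  "emits P (Return a)"
  "\<lbrakk>\<And>u v. P u (PriorityRead p v); \<And>v. emits P (f v)\<rbrakk> \<Longrightarrow> emits P (ReadPriority p f)"
  "\<lbrakk>\<And>u. P u (PriorityWrite p v); emits P r\<rbrakk> \<Longrightarrow> emits P (WritePriority p v r)"
  "\<lbrakk>\<And>u. P u (PriorityWrite p (\<omega> u)); emits P r\<rbrakk> \<Longrightarrow> emits P (RandomPriority p r)"
  "\<lbrakk>\<And>u v. P u (StatusRead p v); \<And>v. emits P (g v)\<rbrakk> \<Longrightarrow> emits P (ReadStatus p g)"
  "\<lbrakk>\<And>u d. P u (StatusCas p x y d); \<And>d. emits P (h d)\<rbrakk> \<Longrightarrow> emits P (CasStatus p x y h)"
  "\<lbrakk>\<And>u. P u (Ev e); emits P r\<rbrakk> \<Longrightarrow> emits P (Event e r)"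
  "\<lbrakk>\<And>u. P u Idling; emits P r; \<And>a. r \<noteq> Return a\<rbrakk> \<Longrightarrow> emits P (DelayUntil k r)"
  by (auto simp: emits_def)

lemma emits_bind: "emits P r \<Longrightarrow> (\<And>x. emits P (g x)) \<Longrightarrow> emits P (bind_prog r g)"
  unfolding emits_def
  by (intro allI wp_bind) (rule wp_mono[where Q="\<lambda>_ _ _. True"], auto)

lemma emits_for_each: "(\<And>x. x \<in> set xs \<Longrightarrow> emits P (f x)) \<Longrightarrow> emits P (for_each xs f)"
  by (induction xs) (auto intro: emits_intros emits_bind)

lemma emits_exec_code: "(\<And>u l. word_label l \<Longrightarrow> P u l) \<Longrightarrow> emits P (exec_code R d)"
  by (induction d) (auto simp: emits_def)

lemma emits_flagged: "(\<And>u x v. P u (PriorityRead x v)) \<Longrightarrow> emits P (flagged xs)"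
  by (induction xs) (auto simp: getFlag_def intro!: emits_intros emits_bind)

lemmas emits_rules = emits_intros emits_bind emits_for_each emits_exec_code emits_flagged

lemma emits_hoare: "emits P r \<Longrightarrow> hoare q False P B (\<lambda>_. True) r (\<lambda>_ _. True)"
  by (auto simp: emits_def hoare_def)

lemma emits_getSet: "(\<And>u l. quiet l \<Longrightarrow> (\<And>y. l \<noteq> Ev (ThunkInv y)) \<Longrightarrow> P u l) \<Longrightarrow> emits P (getSet S lk)"
  unfolding getSet_def raw_getSet_def
  by (intro emits_rules) (auto simp: quiet_def word_label_def split: label.splits)

lemma emits_compete: "(\<And>u l. quiet l \<Longrightarrow> (\<And>y. l \<noteq> Ev (ThunkInv y)) \<Longrightarrow> P u l) \<Longrightarrow> emits P (compete p p')"
  unfolding compete_def eliminate_def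
  by (auto intro!: emits_rules simp: quiet_def)

lemma emits_celebrate: "(\<And>u l. quiet l \<Longrightarrow> P u l) \<Longrightarrow> emits P (celebrateIfWon S p)"
  unfolding celebrateIfWon_def run_thunk_def
  by (auto intro!: emits_rules simp: quiet_def word_label_def split: label.splits)

lemma emits_run: "(\<And>u l. quiet l \<Longrightarrow> P u l) \<Longrightarrow> emits P (run S p)"
  unfolding run_def decide_def
  by (auto intro!: emits_rules emits_getSet emits_compete emits_celebrate) (auto simp: quiet_def)

text \<open>What the code alone shows about the labels of an attempt. It already yields that only
  the owner inserts or removes a descriptor or writes its priority.\<close>

definition allowed_label :: "desc \<Rightarrow> nat \<Rightarrow> label \<Rightarrow> bool" where
  "allowed_label x u l \<longleftrightarrow> quiet l \<or> l = PriorityWrite x (-1) \<or> l = PriorityWrite x (\<omega> u) \<or>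
     (\<exists>d. l = Ev (TryResp x d)) \<or>
     (\<exists>lk\<in>set (lockList x). l = Ev (ASInv lk (Insert x)) \<or> l = Ev (ASInv lk (Remove x)))"

lemma emits_tryLocks: "emits (allowed_label x) (tryLocks S x)"
  unfolding tryLocks_def multiInsert_def multiRemove_def lock_insert_def lock_remove_def
    clearFlag_def setFlag_def
  by (auto intro!: emits_rules emits_getSet emits_run)
    (auto simp: allowed_label_def quiet_word, auto simp: quiet_def)

lemma labels:
  assumes "\<sigma> t = (q, l)"
  obtains "l = Idling"
  | x where "l = Ev (TryInv x)" "started x" "ident x = t" "owner x = q"
  | x where "started x" "ident x < t" "owner x = q" "allowed_label x t l"
  by (rule label_cases[where G="\<lambda>x u n l. allowed_label x u l" and Q="\<lambda>_ _ _. True", OF _ assms])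
    (use emits_tryLocks in \<open>auto simp: emits_def\<close>)

lemma TryInvD: "\<sigma> t = (q, Ev (TryInv x)) \<Longrightarrow> started x \<and> ident x = t \<and> owner x = q"
  by (erule labels) (auto simp: allowed_label_def quiet_def)

lemma TryRespD: "\<sigma> t = (q, Ev (TryResp x d)) \<Longrightarrow> started x \<and> ident x < t \<and> owner x = q"
  by (erule labels) (auto simp: allowed_label_def quiet_def)

lemma InsertD:
  "\<sigma> t = (q, Ev (ASInv lk (Insert x))) \<Longrightarrow>
     started x \<and> ident x < t \<and> owner x = q \<and> lk \<in> set (lockList x)"
  by (erule labels) (auto simp: allowed_label_def quiet_def)

lemma PriorityWriteD:
  "\<sigma> t = (q, PriorityWrite x v) \<Longrightarrow>
     started x \<and> ident x < t \<and> owner x = q \<and> (v = -1 \<or> v = \<omega> t)"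
  by (erule labels) (auto simp: allowed_label_def quiet_def)

lemma StatusCasD: "\<sigma> t = (q, StatusCas x y z d) \<Longrightarrow> y = Active \<and> z \<noteq> Active"
  by (erule labels) (auto simp: allowed_label_def quiet_def)

text \<open>Every CAS on a status expects \<open>Active\<close>, so the first successful one is
  final.\<close>

lemma stat_decided: "t \<le> t' \<Longrightarrow> stt t x \<noteq> Active \<Longrightarrow> stt t' x = stt t x"
proof (induction t' rule: dec_induct)
  case (step n)
  have "stt (Suc n) x = stt n x"
  proof (cases "snd (\<sigma> n)")
    case (StatusCas y v w d)
    with StatusCasD[of n "sched S n" y v w d] cas_result[of n "sched S n" y v w d] step show ?thesis
      by (cases "\<sigma> n") (auto simp: stat_Suc simp flip: fst_step_at)
  qed (auto simp: stat_Suc)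
  with step show ?case by simp
qed simp

lemma stat_active: "t \<le> t' \<Longrightarrow> stt t' x = Active \<Longrightarrow> stt t x = Active"
  using stat_decided by metis

definition occurs :: "event \<Rightarrow> nat \<Rightarrow> bool" where
  "occurs e t \<longleftrightarrow> (\<exists>u<t. \<exists>q. \<sigma> u = (q, Ev e))"

text \<open>What helping achieves: the outcome is final and, after a win, some run of the thunk is
  complete. The property is monotone in time, so it passes through frames.\<close>

definition finished :: "desc \<Rightarrow> nat \<Rightarrow> bool" where
  "finished x t \<longleftrightarrow> stt t x \<noteq> Active \<and> (stt t x = Won \<longrightarrow> occurs (ThunkResp x) t)"

definition reveal :: "desc \<Rightarrow> nat \<Rightarrow> bool" where
  "reveal x u \<longleftrightarrow> (\<exists>q. \<sigma> u = (q, PriorityWrite x (\<omega> u)))"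

definition revealed :: "desc \<Rightarrow> nat \<Rightarrow> bool" where
  "revealed x t \<longleftrightarrow> (\<exists>u<t. reveal x u)"

definition answered :: "lock \<Rightarrow> nat \<Rightarrow> nat \<Rightarrow> bool" where
  "answered lk i t \<longleftrightarrow> (\<exists>j<t. \<exists>xs. as_returns \<sigma> lk i j xs)"

definition completed :: "as_op \<Rightarrow> lock \<Rightarrow> nat \<Rightarrow> bool" where
  "completed opr lk t \<longleftrightarrow> (\<exists>i q. \<sigma> i = (q, Ev (ASInv lk opr)) \<and> answered lk i t)"

text \<open>Linearizability orders a removal after an insertion only if the insertion has responded
  before the removal is invoked; this supplies that fact.\<close>

definition settled :: "desc \<Rightarrow> nat \<Rightarrow> bool" where
  "settled x t \<longleftrightarrow> (\<forall>i<t. \<forall>q lk. \<sigma> i = (q, Ev (ASInv lk (Insert x))) \<longrightarrow> answered lk i t)"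

lemma occurs_mono: "occurs e t \<Longrightarrow> t \<le> t' \<Longrightarrow> occurs e t'"
  unfolding occurs_def by (meson less_le_trans)

lemma finished_mono: "finished x t \<Longrightarrow> t \<le> t' \<Longrightarrow> finished x t'"
  unfolding finished_def using stat_decided occurs_mono by metis

lemma revealed_mono: "revealed x t \<Longrightarrow> t \<le> t' \<Longrightarrow> revealed x t'"
  unfolding revealed_def by (meson less_le_trans)

lemma answered_mono: "answered lk i t \<Longrightarrow> t \<le> t' \<Longrightarrow> answered lk i t'"
  unfolding answered_def by (meson less_le_trans)

lemma completed_mono: "completed opr lk t \<Longrightarrow> t \<le> t' \<Longrightarrow> completed opr lk t'"
  unfolding completed_def using answered_mono by blast

lemma revealD: "reveal x u \<Longrightarrow> started x \<and> ident x < u \<and> \<sigma> u = (owner x, PriorityWrite x (\<omega> u))"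
  unfolding reveal_def using PriorityWriteD by blast

lemma not_revealed_ext:
  assumes "\<not> revealed x t" "\<And>u. t \<le> u \<Longrightarrow> u < t' \<Longrightarrow> \<sigma> u \<noteq> (owner x, PriorityWrite x (\<omega> u))"
  shows "\<not> revealed x t'"
  using assms revealD unfolding revealed_def by (meson not_le)

lemma settled_ext:
  assumes "settled x t" "t \<le> t'"
    "\<And>u lk. t \<le> u \<Longrightarrow> u < t' \<Longrightarrow> \<sigma> u = (owner x, Ev (ASInv lk (Insert x))) \<Longrightarrow> answered lk u t'"
  shows "settled x t'"
  unfolding settled_def
proof (intro allI impI)
  fix i q lk assume i: "i < t'" "\<sigma> i = (q, Ev (ASInv lk (Insert x)))"
  show "answered lk i t'"
  proof (cases "i < t")
    case True
    with assms i show ?thesis unfolding settled_def using answered_mono by blast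
  next
    case False
    with i assms(3) InsertD[OF i(2)] show ?thesis by auto
  qed
qed

lemma nextstep_no_label: "nextstep q t u l \<Longrightarrow> t \<le> v \<Longrightarrow> v < u \<Longrightarrow> \<sigma> v \<noteq> (q, l')"
  unfolding nextstep_def using step_at_sched by blast

lemma nextstep_le: "nextstep q t u l \<Longrightarrow> t \<le> u"
  and nextstep_label: "nextstep q t u l \<Longrightarrow> \<sigma> u = (q, l)"
  by (auto simp: nextstep_def)

definition helping :: "nat \<Rightarrow> label \<Rightarrow> bool" where
  "helping u l \<longleftrightarrow> quiet l \<and> (\<forall>y. l = Ev (ThunkInv y) \<longrightarrow> stt u y = Won)"

text \<open>The order kept by the owner: insertions, reveal, decision, clearing and removals,
  response. Clearing is also permitted before the reveal, since \<open>multiInsert\<close> starts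
  with it.\<close>

definition own_step :: "desc \<Rightarrow> nat \<Rightarrow> label \<Rightarrow> bool" where
  "own_step x u l \<longleftrightarrow>
     (l = PriorityWrite x (-1) \<longrightarrow> \<not> revealed x u \<or> finished x u) \<and>
     (l = PriorityWrite x (\<omega> u) \<longrightarrow> \<not> revealed x u \<and> (\<forall>lk\<in>set (lockList x). completed (Insert x) lk u)) \<and>
     (\<forall>lk. l = Ev (ASInv lk (Insert x)) \<longrightarrow> \<not> revealed x u) \<and>
     (\<forall>lk. l = Ev (ASInv lk (Remove x)) \<longrightarrow> revealed x u \<and> finished x u \<and> settled x u) \<and>
     (\<forall>d. l = Ev (TryResp x d) \<longrightarrow> finished x u \<and> d = (stt u x = Won) \<and>
        (\<forall>lk\<in>set (lockList x). completed (Remove x) lk u)) \<and>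
     (\<forall>y. l = Ev (ThunkInv y) \<longrightarrow> stt u y = Won)"

lemma helping_own_step: "helping u l \<Longrightarrow> own_step x u l"
  by (auto simp: helping_def own_step_def quiet_def)

lemma helping_word: "word_label l \<Longrightarrow> helping u l"
  by (auto simp: helping_def quiet_word)

text \<open>One rule for all three operations: \<open>f\<close> is constantly \<open>[]\<close> for
  updates and the identity for \<open>getSet\<close>; the extra 2 steps are invocation and response.
  The last premise may use that all other own steps in between are quiet, which preserves protocol
  facts about the own descriptor.\<close>

lemma hoare_op:
  assumes d: "max_steps d m"
    and word: "\<And>u l. word_label l \<Longrightarrow> G u l"
    and inv: "\<And>t i. P t \<Longrightarrow> nextstep q t i (Ev (ASInv lk opr)) \<Longrightarrow> G i (Ev (ASInv lk opr))"
    and resp: "\<And>u ys. G u (Ev (ASResp lk ys))"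
    and R: "\<And>t i j x. \<lbrakk>P t; nextstep q t i (Ev (ASInv lk opr)); i < j; as_returns \<sigma> lk i j (f x);
        \<And>u l. t \<le> u \<Longrightarrow> u \<le> j \<Longrightarrow> u \<noteq> i \<Longrightarrow> \<sigma> u = (q, l) \<Longrightarrow> quiet l\<rbrakk> \<Longrightarrow> R x (Suc j)"
  shows "hoare q c G (m + 2) P
    (Event (ASInv lk opr) (bind_prog (exec_code Rg d) (\<lambda>x. Event (ASResp lk (f x)) (Return x)))) R"
  unfolding hoare_def wp.simps
proof (intro allI impI conjI)
  fix N t n i assume P: "P t \<and> (c \<longrightarrow> n + (m + 2) \<le> N)"
    and i: "nextstep q t i (Ev (ASInv lk opr))"
  show "G i (Ev (ASInv lk opr))" "c \<Longrightarrow> n < N" using P inv i by auto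
  show "wp q (\<lambda>u j l. (c \<longrightarrow> j < N) \<and> G u l)
     (bind_prog (exec_code Rg d) (\<lambda>x. Event (ASResp lk (f x)) (Return x)))
     (\<lambda>x t' n'. R x t' \<and> (c \<longrightarrow> n' \<le> n + (m + 2))) (Suc i) (Suc n)"
  proof (intro wp_bind wp_exec_code[OF d])
    fix x t' n'
    assume t': "trail q (\<lambda>u j l. word_label l) (Suc i) t'" "Suc n \<le> n'" "n' \<le> Suc n + m"
    have "R x (Suc j)" if j: "nextstep q t' j (Ev (ASResp lk (f x)))" for j
    proof (rule R[OF conjunct1[OF P] i])
      have ij: "i < j" using j t' by (auto simp: trail_def nextstep_def)
      then show "i < j" .
      have lab: "word_label l" if "i < u" "u < j" "\<sigma> u = (q, l)" for u l
      proof (cases "u < t'")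
        case True
        with t'(1) that show ?thesis by (auto simp: trail_def Suc_le_eq)
      next
        case False
        with j that show ?thesis using nextstep_no_label by (metis not_less)
      qed
      show "as_returns \<sigma> lk i j (f x)"
        unfolding as_returns_def using ij i j lab by (fastforce simp: nextstep_def)
      fix u l assume u: "t \<le> u" "u \<le> j" "u \<noteq> i" "\<sigma> u = (q, l)"
      then consider "u < i" | "i < u" "u < j" | "u = j" by linarith
      then show "quiet l"
      proof cases
        case 1
        with u i show ?thesis using nextstep_no_label by blast
      next
        case 2
        with u lab show ?thesis by (auto intro: quiet_word)
      next
        case 3
        with u j show ?thesis by (auto simp: nextstep_def quiet_def)
      qed
    qed
    then show "wp q (\<lambda>u j l. (c \<longrightarrow> j < N) \<and> G u l) (Event (ASResp lk (f x)) (Return x))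
      (\<lambda>x t' n'. R x t' \<and> (c \<longrightarrow> n' \<le> n + (m + 2))) t' n'"
      using P t' resp by auto
  qed (use P word in auto)
qed

lemma hoare_run_thunk:
  assumes "max_steps (thunk_code S (thunk y)) T"
    and "\<And>u l. helping u l \<Longrightarrow> (\<And>x y z d. l \<noteq> StatusCas x y z d) \<Longrightarrow> G u l"
  shows "hoare q c G (T + 2) (\<lambda>t. stt t y = Won) (run_thunk S y) (\<lambda>_ t. finished y t)"
  unfolding hoare_def run_thunk_def
proof (intro allI impI, simp only: bind_prog.simps wp.simps, intro allI impI conjI)
  fix N t n i assume P: "stt t y = Won \<and> (c \<longrightarrow> n + (T + 2) \<le> N)"
    and i: "nextstep q t i (Ev (ThunkInv y))"
  have won: "stt i y = Won" using P stat_decided[OF nextstep_le[OF i], of y] by auto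
  then show "c \<Longrightarrow> n < N" "G i (Ev (ThunkInv y))"
    using P assms(2) by (auto simp: helping_def quiet_def)
  show "wp q (\<lambda>u j l. (c \<longrightarrow> j < N) \<and> G u l)
     (bind_prog (exec_code ThunkMem (thunk_code S (thunk y))) (\<lambda>_. event (ThunkResp y)))
     (\<lambda>_ t' n'. finished y t' \<and> (c \<longrightarrow> n' \<le> n + (T + 2))) (Suc i) (Suc n)"
  proof (intro wp_bind wp_exec_code[OF assms(1)])
    fix x t' n'
    assume t': "trail q (\<lambda>u j l. word_label l) (Suc i) t'" "Suc n \<le> n'" "n' \<le> Suc n + T"
    have "finished y (Suc j)" if j: "nextstep q t' j (Ev (ThunkResp y))" for j
      using won stat_decided[of i "Suc j" y] t' j
      by (auto simp: finished_def occurs_def trail_def nextstep_def)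
    then show "wp q (\<lambda>u j l. (c \<longrightarrow> j < N) \<and> G u l) (event (ThunkResp y))
      (\<lambda>_ t' n'. finished y t' \<and> (c \<longrightarrow> n' \<le> n + (T + 2))) t' n'"
      using P t' assms(2) by (auto simp: helping_def quiet_def)
  qed (use P in \<open>auto intro!: assms(2) helping_word\<close>)
qed

text \<open>\<open>D\<close> switches the postcondition: a call on a descriptor that may be
  undecided promises nothing about it, a call on a decided one finishes it. No status CAS occurs,
  which later allows \<open>informed\<close> in place of \<open>G\<close>.\<close>

lemma hoare_celebrate:
  assumes "max_steps (thunk_code S (thunk y)) T"
    and "\<And>u l. helping u l \<Longrightarrow> (\<And>x y z d. l \<noteq> StatusCas x y z d) \<Longrightarrow> G u l"
  shows "hoare q c G (T + 3) (\<lambda>t. D \<longrightarrow> stt t y \<noteq> Active) (celebrateIfWon S y) (\<lambda>_ t. D \<longrightarrow> finished y t)"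
  unfolding hoare_def celebrateIfWon_def
proof (intro allI impI, simp only: wp.simps, intro allI impI conjI)
  fix N t n i assume P: "(D \<longrightarrow> stt t y \<noteq> Active) \<and> (c \<longrightarrow> n + (T + 3) \<le> N)"
    and i: "nextstep q t i (StatusRead y (stt i y))"
  show "c \<Longrightarrow> n < N" "G i (StatusRead y (stt i y))"
    using P assms(2) by (auto simp: helping_def quiet_def)
  show "wp q (\<lambda>u j l. (c \<longrightarrow> j < N) \<and> G u l) (if stt i y = Won then run_thunk S y else skip)
     (\<lambda>_ t' n'. (D \<longrightarrow> finished y t') \<and> (c \<longrightarrow> n' \<le> n + (T + 3))) (Suc i) (Suc n)"
  proof (cases "stt i y = Won")
    case True
    then have won: "stt (Suc i) y = Won" using stat_decided[of i "Suc i" y] by simp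
    have "wp q (\<lambda>u j l. (c \<longrightarrow> j < N) \<and> G u l) (run_thunk S y)
     (\<lambda>_ t' n'. (D \<longrightarrow> finished y t') \<and> (c \<longrightarrow> n' \<le> n + (T + 3))) (Suc i) (Suc n)"
      by (rule hoare_wp[OF hoare_run_thunk[OF assms], where c=c and N=N]) (use P won in auto)
    with True show ?thesis by simp
  next
    case False
    then have "D \<longrightarrow> finished y (Suc i)"
      using P stat_decided[of t i y] stat_decided[of t "Suc i" y] nextstep_le[OF i]
      by (auto simp: finished_def)
    with False show ?thesis by auto
  qed
qed

lemma hoare_decide:
  assumes "\<And>u t. P t \<Longrightarrow> nextstep q t u (StatusCas x Active Won (stt u x = Active)) \<Longrightarrow>
     G u (StatusCas x Active Won (stt u x = Active))"
  shows "hoare q c G 1 P (decide x) (\<lambda>_ t. stt t x \<noteq> Active)"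
  unfolding hoare_def decide_def
proof (intro allI impI, simp only: wp.simps, intro allI impI conjI)
  fix N t n i :: nat assume P: "P t \<and> (c \<longrightarrow> n + 1 \<le> N)"
    and i: "nextstep q t i (StatusCas x Active Won (stt i x = Active))"
  show "n < N" if c using P that by linarith
  show "G i (StatusCas x Active Won (stt i x = Active))"
    using P assms i by auto
  show "stt (Suc i) x \<noteq> Active" using nextstep_label[OF i] by (auto simp: stat_Suc)
qed auto

end

context execution
begin

lemma hoare_ReadStatus:
  assumes "\<And>t u. P t \<Longrightarrow> nextstep q t u (StatusRead y (stt u y)) \<Longrightarrow> P' (stt u y) (Suc u)"
    and "\<And>u. G u (StatusRead y (stt u y))" "\<And>s. hoare q c G B (P' s) (f s) R"
  shows "hoare q c G (Suc B) P (ReadStatus y f) R"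
  unfolding hoare_def
proof (intro allI impI, simp only: wp.simps, intro allI impI conjI)
  fix N t n u assume P: "P t \<and> (c \<longrightarrow> n + Suc B \<le> N)"
    and u: "nextstep q t u (StatusRead y (stt u y))"
  show "wp q (\<lambda>u j l. (c \<longrightarrow> j < N) \<and> G u l) (f (stt u y)) (\<lambda>x t' n'. R x t' \<and> (c \<longrightarrow> n' \<le> n + Suc B)) (Suc u) (Suc n)"
    by (rule hoare_wp[OF assms(3), where N=N]) (use P u assms(1) in auto)
qed (use assms(2) in auto)

lemma hoare_ReadPriority:
  assumes "\<And>t u. P t \<Longrightarrow> nextstep q t u (PriorityRead y (priority (mem u) y)) \<Longrightarrow> P' (priority (mem u) y) (Suc u)"
    and "\<And>u. G u (PriorityRead y (priority (mem u) y))" "\<And>s. hoare q c G B (P' s) (f s) R"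
  shows "hoare q c G (Suc B) P (ReadPriority y f) R"
  unfolding hoare_def
proof (intro allI impI, simp only: wp.simps, intro allI impI conjI)
  fix N t n u assume P: "P t \<and> (c \<longrightarrow> n + Suc B \<le> N)"
    and u: "nextstep q t u (PriorityRead y (priority (mem u) y))"
  show "wp q (\<lambda>u j l. (c \<longrightarrow> j < N) \<and> G u l) (f (priority (mem u) y)) (\<lambda>x t' n'. R x t' \<and> (c \<longrightarrow> n' \<le> n + Suc B)) (Suc u) (Suc n)"
    by (rule hoare_wp[OF assms(3), where N=N]) (use P u assms(1) in auto)
qed (use assms(2) in auto)

lemma hoare_WritePriority:
  assumes "\<And>t u. P t \<Longrightarrow> nextstep q t u (PriorityWrite y v) \<Longrightarrow> G u (PriorityWrite y v) \<and> R () (Suc u)"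
  shows "hoare q c G 1 P (WritePriority y v skip) R"
  unfolding hoare_def using assms by (auto simp: Suc_le_eq)

lemma hoare_steps: "hoare q False G B P r R \<Longrightarrow> hoare q False G B' P r R"
  by (auto simp: hoare_def)

end

section \<open>The owner's protocol in an execution that respects the bounds\<close>

locale lock_execution = execution +
  fixes b \<kappa> L T :: nat and k :: "lock \<Rightarrow> nat"
  assumes pos: "0 < \<omega> t"
    and insert_steps: "max_steps (as_insert (actset S) x) (b * \<kappa>)"
    and remove_steps: "max_steps (as_remove (actset S) x) (b * \<kappa>)"
    and getSet_steps: "max_steps (as_getSet (actset S)) b"
    and lin: "linearizable \<sigma> lk"
    and contention: "card (live S \<omega> lk t) \<le> k lk" and contention_le: "k lk \<le> \<kappa>"
    and lock_count: "\<sigma> t = (q, Ev (TryInv x)) \<Longrightarrow> length (lockList x) \<le> L"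
    and thunk_steps: "max_steps (thunk_code S th) T"
begin

text \<open>\<open>decide\<close> leaves \<open>y\<close> decided whatever happened in the loop, and
  the final \<open>celebrateIfWon\<close> completes the thunk after a win. Nothing about the lists
  from \<open>getSet\<close> is needed, which breaks the circularity with step counts. As counting
  is off, the bound 0 is void.\<close>

lemma run_finishes: "hoare q False helping 0 (\<lambda>_. True) (run S y) (\<lambda>_ t. finished y t)"
proof -
  have c: "hoare q False helping 0 (\<lambda>_. True) (celebrateIfWon S z) (\<lambda>_ _. True)" for z
    by (rule hoare_steps[OF hoare_conseq[OF hoare_celebrate[OF thunk_steps, where D=False]]]) auto
  have "hoare q False helping (0 + (1 + (T + 3))) (\<lambda>_. True) (run S y) (\<lambda>_ t. finished y t)"
    unfolding run_def
  proof (intro hoare_bind)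
    let ?f = "\<lambda>l. bind_prog (getSet S l) (\<lambda>xs. ReadStatus y (\<lambda>s. if s = Active
         then for_each xs (\<lambda>p'. bind_prog (compete y p') (\<lambda>_. celebrateIfWon S p')) else skip))"
    have f: "hoare q False helping (0 + Suc 0) (\<lambda>_. True) (?f lk) (\<lambda>_ _. True)" for lk
    proof (intro hoare_bind)
      show "hoare q False helping 0 (\<lambda>_. True) (getSet S lk) (\<lambda>_ _. True)"
        by (intro emits_hoare emits_getSet) (auto simp: helping_def)
      fix xs
      have "hoare q False helping (0 + 0) (\<lambda>_. True)
        (bind_prog (compete y p') (\<lambda>_. celebrateIfWon S p')) (\<lambda>_ _. True)" for p'
        by (intro hoare_bind[OF emits_hoare c] emits_compete) (auto simp: helping_def)
      then have "hoare q False helping 0 (\<lambda>_. True)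
        (for_each xs (\<lambda>p'. bind_prog (compete y p') (\<lambda>_. celebrateIfWon S p'))) (\<lambda>_ _. True)"
        by (intro hoare_for_each[where I="\<lambda>_ _. True"]) auto
      then show "hoare q False helping (Suc 0) (\<lambda>_. True) (ReadStatus y (\<lambda>s. if s = Active
         then for_each xs (\<lambda>p'. bind_prog (compete y p') (\<lambda>_. celebrateIfWon S p')) else skip)) (\<lambda>_ _. True)"
        by (intro hoare_ReadStatus[where P'="\<lambda>_ _. True"])
          (auto intro: hoare_Return simp: helping_def quiet_def)
    qed
    show "hoare q False helping 0 (\<lambda>_. True) (for_each (lockList y) ?f) (\<lambda>_ _. True)"
      by (intro hoare_for_each[where I="\<lambda>_ _. True"] hoare_steps[OF f]) auto
    show "hoare q False helping 1 (\<lambda>_. True) (decide y) (\<lambda>_ t. stt t y \<noteq> Active)"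
      by (rule hoare_decide) (auto simp: helping_def quiet_def)
    show "hoare q False helping (T + 3) (\<lambda>t. stt t y \<noteq> Active) (celebrateIfWon S y) (\<lambda>_ t. finished y t)"
      by (rule hoare_conseq[OF hoare_celebrate[OF thunk_steps, where D=True]]) auto
  qed
  then show ?thesis by (rule hoare_steps)
qed

text \<open>The phase before the own insertions begin; \<open>settled\<close> holds vacuously in
  it.\<close>

definition fresh :: "desc \<Rightarrow> nat \<Rightarrow> bool" where
  "fresh x t \<longleftrightarrow> \<not> revealed x t \<and> (\<forall>i<t. \<forall>q lk. \<sigma> i \<noteq> (q, Ev (ASInv lk (Insert x))))"

lemma fresh_ext:
  assumes "fresh x t" "\<And>u l. t \<le> u \<Longrightarrow> u < t' \<Longrightarrow> \<sigma> u = (owner x, l) \<Longrightarrow>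
    l \<noteq> PriorityWrite x (\<omega> u) \<and> (\<forall>lk. l \<noteq> Ev (ASInv lk (Insert x)))"
  shows "fresh x t'"
proof -
  have "\<not> revealed x t'"
    by (rule not_revealed_ext[of x t]) (use assms in \<open>auto simp: fresh_def\<close>)
  moreover have "\<sigma> i \<noteq> (q, Ev (ASInv lk (Insert x)))" if "i < t'" for i q lk
  proof
    assume i: "\<sigma> i = (q, Ev (ASInv lk (Insert x)))"
    with assms(1) have "t \<le> i" by (auto simp: fresh_def not_less[symmetric])
    from assms(2)[OF this that] i InsertD[OF i] show False by blast
  qed
  ultimately show ?thesis by (simp add: fresh_def)
qed

lemma not_helping [simp]:
  "\<not> helping u (PriorityWrite x v)" "\<not> helping u (Ev (ASInv lk (Insert x)))"
  "\<not> helping u (Ev (ASInv lk (Remove x)))"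
  by (simp_all add: helping_def quiet_def)

lemma fresh_start: "fresh x (Suc (ident x))"
  using revealD InsertD by (fastforce simp: fresh_def revealed_def)

lemma not_revealed_wait: "\<not> revealed x t \<Longrightarrow> nextstep (owner x) t u l \<Longrightarrow> \<not> revealed x u"
  by (erule not_revealed_ext) (metis nextstep_no_label)

lemma settled_wait: "settled x t \<Longrightarrow> nextstep (owner x) t u l \<Longrightarrow> settled x u"
  by (erule settled_ext) (auto simp: nextstep_le dest: nextstep_no_label)

lemma own_insert:
  fixes x
  defines "I \<equiv> \<lambda>A t. \<not> revealed x t \<and> settled x t \<and> (\<forall>lk\<in>A. completed (Insert x) lk t)"
  shows "hoare (owner x) False (own_step x) 0 (I A) (lock_insert S lk x) (\<lambda>_. I (insert lk A))"
proof -
  have "hoare (owner x) False (own_step x) (b * \<kappa> + 2) (I A)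
     (Event (ASInv lk (Insert x)) (bind_prog (exec_code (ActiveSetMem lk) (as_insert (actset S) x))
       (\<lambda>y. Event (ASResp lk ((\<lambda>_. []) y)) (Return y)))) (\<lambda>_. I (insert lk A))"
  proof (rule hoare_op[OF insert_steps])
    show "own_step x u l" if "word_label l" for u l
      using that by (simp add: helping_word helping_own_step)
    show "own_step x i (Ev (ASInv lk (Insert x)))"
      if "I A t" "nextstep (owner x) t i (Ev (ASInv lk (Insert x)))" for t i
      using that not_revealed_wait unfolding I_def own_step_def by blast
    fix t i j y
    assume I: "I A t" and i: "nextstep (owner x) t i (Ev (ASInv lk (Insert x)))" "i < j"
      and ret: "as_returns \<sigma> lk i j []"
      and q: "\<And>u l. t \<le> u \<Longrightarrow> u \<le> j \<Longrightarrow> u \<noteq> i \<Longrightarrow> \<sigma> u = (owner x, l) \<Longrightarrow> quiet l"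
    have ans: "answered lk i (Suc j)" using ret by (auto simp: answered_def)
    have "\<not> revealed x (Suc j)"
    proof (rule not_revealed_ext[of x t])
      fix u assume u: "t \<le> u" "u < Suc j"
      show "\<sigma> u \<noteq> (owner x, PriorityWrite x (\<omega> u))"
      proof (cases "u = i")
        case False
        then show ?thesis using u q[of u "PriorityWrite x (\<omega> u)"] by (auto simp: quiet_def)
      qed (use nextstep_label[OF i(1)] in auto)
    qed (use I in \<open>simp add: I_def\<close>)
    moreover have "settled x (Suc j)"
    proof (rule settled_ext[of x t])
      fix u lk' assume u: "t \<le> u" "u < Suc j" "\<sigma> u = (owner x, Ev (ASInv lk' (Insert x)))"
      then have "u = i" using q[of u "Ev (ASInv lk' (Insert x))"] by (auto simp: quiet_def)
      with u nextstep_label[OF i(1)] ans show "answered lk' u (Suc j)" by auto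
    qed (use I i nextstep_le[OF i(1)] in \<open>auto simp: I_def\<close>)
    moreover have "completed (Insert x) lk (Suc j)"
      using ans nextstep_label[OF i(1)] by (auto simp: completed_def)
    moreover have "completed (Insert x) lk' (Suc j)" if "lk' \<in> A" for lk'
      using I that completed_mono[of "Insert x" lk' t "Suc j"] i(2) nextstep_le[OF i(1)]
      by (auto simp: I_def)
    ultimately show "I (insert lk A) (Suc j)" by (auto simp: I_def)
  qed (simp add: own_step_def)
  then show ?thesis unfolding lock_insert_def by (simp add: hoare_steps)
qed

lemma own_remove:
  fixes x
  defines "I \<equiv> \<lambda>A t. revealed x t \<and> settled x t \<and> finished x t \<and> (\<forall>lk\<in>A. completed (Remove x) lk t)"
  shows "hoare (owner x) False (own_step x) 0 (I A) (lock_remove S lk x) (\<lambda>_. I (insert lk A))"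
proof -
  have "hoare (owner x) False (own_step x) (b * \<kappa> + 2) (I A)
     (Event (ASInv lk (Remove x)) (bind_prog (exec_code (ActiveSetMem lk) (as_remove (actset S) x))
       (\<lambda>y. Event (ASResp lk ((\<lambda>_. []) y)) (Return y)))) (\<lambda>_. I (insert lk A))"
  proof (rule hoare_op[OF remove_steps])
    show "own_step x u l" if "word_label l" for u l
      using that by (simp add: helping_word helping_own_step)
    show "own_step x i (Ev (ASInv lk (Remove x)))"
      if "I A t" "nextstep (owner x) t i (Ev (ASInv lk (Remove x)))" for t i
      using that settled_wait revealed_mono finished_mono nextstep_le
      unfolding I_def own_step_def by blast
    fix t i j y
    assume I: "I A t" and i: "nextstep (owner x) t i (Ev (ASInv lk (Remove x)))" "i < j"
      and ret: "as_returns \<sigma> lk i j []"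
      and q: "\<And>u l. t \<le> u \<Longrightarrow> u \<le> j \<Longrightarrow> u \<noteq> i \<Longrightarrow> \<sigma> u = (owner x, l) \<Longrightarrow> quiet l"
    have ans: "answered lk i (Suc j)" using ret by (auto simp: answered_def)
    have tj: "t \<le> Suc j" using i nextstep_le[OF i(1)] by simp
    have "settled x (Suc j)"
    proof (rule settled_ext[of x t])
      fix u lk' assume u: "t \<le> u" "u < Suc j" "\<sigma> u = (owner x, Ev (ASInv lk' (Insert x)))"
      then have "u = i" using q[of u "Ev (ASInv lk' (Insert x))"] by (auto simp: quiet_def)
      with u nextstep_label[OF i(1)] ans show "answered lk' u (Suc j)" by auto
    qed (use I tj in \<open>auto simp: I_def\<close>)
    moreover have "completed (Remove x) lk (Suc j)"
      using ans nextstep_label[OF i(1)] by (auto simp: completed_def)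
    moreover have "completed (Remove x) lk' (Suc j)" if "lk' \<in> A" for lk'
      using I that completed_mono[of "Remove x" lk' t "Suc j"] tj by (auto simp: I_def)
    ultimately show "I (insert lk A) (Suc j)"
      using I revealed_mono[OF _ tj] finished_mono[OF _ tj] by (auto simp: I_def)
  qed (simp add: own_step_def)
  then show ?thesis unfolding lock_remove_def by (simp add: hoare_steps)
qed

lemma own_reveal:
  fixes x
  defines "I \<equiv> \<lambda>A t. \<not> revealed x t \<and> settled x t \<and> (\<forall>lk\<in>A. completed (Insert x) lk t)"
  shows "hoare (owner x) False (own_step x) 0 (I (set (lockList x))) (setFlag S x)
     (\<lambda>_ t. revealed x t \<and> settled x t)"
  unfolding hoare_def setFlag_def
proof (simp, intro allI impI conjI)
  fix t n t' u
  assume I: "I (set (lockList x)) t"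
    and t': "t \<le> t'" "(n < T0 S \<or> t' = t) \<and> (\<forall>u. t \<le> u \<and> u < t' \<and> sched S u = owner x \<longrightarrow> \<sigma> u = (owner x, Idling))"
    and u: "nextstep (owner x) t' u (PriorityWrite x (\<omega> u))"
  \<comment> \<open>Only idle steps precede the reveal, so no protocol fact changes during the
    delay.\<close>
  have lab: "l = Idling" if "t \<le> v" "v < u" "\<sigma> v = (owner x, l)" for v l
  proof (cases "v < t'")
    case True
    with t' that step_at_sched[OF that(3)] show ?thesis by auto
  qed (use that nextstep_no_label[OF u] in \<open>auto simp: not_less\<close>)
  have tu: "t \<le> u" using t' nextstep_le[OF u] by simp
  have 1: "\<not> revealed x u"
    by (rule not_revealed_ext[of x t]) (use I lab in \<open>auto simp: I_def\<close>)
  have 2: "completed (Insert x) lk u" if "lk \<in> set (lockList x)" for lk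
    using I that completed_mono[OF _ tu] by (auto simp: I_def)
  show "own_step x u (PriorityWrite x (\<omega> u))"
    using 1 2 pos[of u] by (auto simp: own_step_def)
  show "revealed x (Suc u)"
    using nextstep_label[OF u] by (auto simp: revealed_def reveal_def)
  show "settled x (Suc u)"
  proof (rule settled_ext[of x t])
    fix v lk' assume v: "t \<le> v" "v < Suc u" "\<sigma> v = (owner x, Ev (ASInv lk' (Insert x)))"
    then show "answered lk' v (Suc u)"
      using lab[OF v(1) _ v(3)] nextstep_label[OF u] by (cases "v = u") auto
  qed (use I tu in \<open>auto simp: I_def\<close>)
qed (auto simp: own_step_def)

lemma own_finish:
  "hoare (owner x) False (own_step x) 0
     (\<lambda>t. revealed x t \<and> settled x t \<and> finished x t \<and> (\<forall>lk\<in>set (lockList x). completed (Remove x) lk t))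
     (ReadStatus x (\<lambda>s. DelayUntil (T0 S + T1 S) (event (TryResp x (s = Won))))) (\<lambda>_ _. True)"
  unfolding hoare_def
proof (simp, intro allI impI conjI; (elim conjE)?)
  fix t n u t' v
  assume P: "finished x t" "\<forall>lk\<in>set (lockList x). completed (Remove x) lk t"
    and u: "nextstep (owner x) t u (StatusRead x (stt u x))"
    and t': "Suc u \<le> t'"
    and v: "nextstep (owner x) t' v (Ev (TryResp x (stt u x = Won)))"
  have tv: "t \<le> v" "u \<le> v" "t \<le> u" using t' nextstep_le[OF u] nextstep_le[OF v] by auto
  have "stt u x \<noteq> Active" using finished_mono[OF P(1) tv(3)] by (simp add: finished_def)
  then have "stt v x = stt u x" using stat_decided tv by blast
  then show "own_step x v (Ev (TryResp x (stt u x = Won)))"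
    using P finished_mono[OF P(1) tv(1)] completed_mono[OF _ tv(1)] by (auto simp: own_step_def)
qed (auto simp: own_step_def)

text \<open>The phases of \<open>tryLocks\<close> are chained through the states of the protocol:
  \<open>fresh\<close>, then \<open>?I\<close> while inserting, then revealed and settled, then
  \<open>?J\<close> while removing.\<close>

lemma own_attempt:
  assumes "started x"
  shows "wp (owner x) (\<lambda>u n l. own_step x u l) (tryLocks S x) (\<lambda>_ _ _. True) (Suc (ident x)) 1"
proof -
  define H where "H = (\<lambda>r::unit prog. \<lambda>P R. hoare (owner x) False (own_step x) 0 P r (\<lambda>_. R))"
  have seq: "H (bind_prog r (\<lambda>_. r')) P R" if "H r P P'" "H r' P' R" for r r' P P' R
    using hoare_bind[of _ _ _ 0 P r "\<lambda>_. P'" 0 "\<lambda>_. r'"] that by (simp add: H_def)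
  \<comment> \<open>Helping consists of steps that do not touch the protocol of \<open>x\<close>, so
    its state can be framed.\<close>
  have lift: "H r (\<lambda>t. True \<and> F t) (\<lambda>t. R t \<and> F t)" if "hoare (owner x) False helping 0 (\<lambda>_. True) r (\<lambda>_. R)"
    "\<And>t t'. F t \<Longrightarrow> t \<le> t' \<Longrightarrow> (\<And>u l. t \<le> u \<Longrightarrow> u < t' \<Longrightarrow> \<sigma> u = (owner x, l) \<Longrightarrow> helping u l) \<Longrightarrow> F t'"
    for r R F
    unfolding H_def
    by (rule hoare_conseq[OF hoare_frame[OF that]]) (auto intro: helping_own_step)
  let ?I = "\<lambda>A t. \<not> revealed x t \<and> settled x t \<and> (\<forall>lk\<in>A. completed (Insert x) lk t)"
  let ?J = "\<lambda>A t. revealed x t \<and> settled x t \<and> finished x t \<and> (\<forall>lk\<in>A. completed (Remove x) lk t)"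
  have hlp: "H (for_each (lockList x) (\<lambda>l. bind_prog (getSet S l) (\<lambda>xs. for_each xs (run S))))
     (\<lambda>t. True \<and> fresh x t) (\<lambda>t. True \<and> fresh x t)"
  proof (rule lift)
    have r: "hoare (owner x) False helping 0 (\<lambda>_. True) (run S y) (\<lambda>_ _. True)" for y
      by (rule hoare_conseq[OF run_finishes]) auto
    have "hoare (owner x) False helping (0 + 0) (\<lambda>_. True)
        (bind_prog (getSet S l) (\<lambda>xs. for_each xs (run S))) (\<lambda>_ _. True)" for l
    proof (rule hoare_bind)
      show "hoare (owner x) False helping 0 (\<lambda>_. True) (getSet S l) (\<lambda>_ _. True)"
        by (intro emits_hoare emits_getSet) (auto simp: helping_def)
      show "hoare (owner x) False helping 0 (\<lambda>_. True) (for_each xs (run S)) (\<lambda>_ _. True)" for xs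
        by (rule hoare_for_each[where I="\<lambda>_ _. True", OF r]) auto
    qed
    then show "hoare (owner x) False helping 0 (\<lambda>_. True)
       (for_each (lockList x) (\<lambda>l. bind_prog (getSet S l) (\<lambda>xs. for_each xs (run S)))) (\<lambda>_ _. True)"
      by (intro hoare_for_each[where I="\<lambda>_ _. True"]) auto
    fix t t' assume "fresh x t" "t \<le> t'"
      "\<And>u l. t \<le> u \<Longrightarrow> u < t' \<Longrightarrow> \<sigma> u = (owner x, l) \<Longrightarrow> helping u l"
    then show "fresh x t'" using not_helping by (intro fresh_ext[of x t t']) blast+
  qed
  have clear: "H (clearFlag x) (fresh x) (?I {})"
    unfolding H_def clearFlag_def
  proof (rule hoare_steps[OF hoare_WritePriority])
    fix t u assume t: "fresh x t" and u: "nextstep (owner x) t u (PriorityWrite x (- 1))"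
    have "\<not> revealed x u" using t not_revealed_wait[OF _ u] by (auto simp: fresh_def)
    moreover have "fresh x (Suc u)"
    proof (rule fresh_ext[OF t])
      fix v l assume "t \<le> v" "v < Suc u" "\<sigma> v = (owner x, l)"
      then have "l = PriorityWrite x (-1)"
        using nextstep_no_label[OF u] nextstep_label[OF u] by (cases "v = u") auto
      \<comment> \<open>The write of -1 is not a reveal, because drawn values are positive.\<close>
      then show "l \<noteq> PriorityWrite x (\<omega> v) \<and> (\<forall>lk. l \<noteq> Ev (ASInv lk (Insert x)))"
        using pos[of v] by auto
    qed
    ultimately show "own_step x u (PriorityWrite x (- 1)) \<and>
       \<not> revealed x (Suc u) \<and> settled x (Suc u) \<and> (\<forall>lk\<in>{}. completed (Insert x) lk (Suc u))"
      using pos[of u] by (auto simp: own_step_def fresh_def settled_def)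
  qed
  have ins: "H (for_each (lockList x) (\<lambda>l. lock_insert S l x)) (?I {}) (?I (set (lockList x)))"
    unfolding H_def
    using hoare_for_each[where I="?I" and A="{}" and xs="lockList x", OF own_insert]
    by (simp add: hoare_steps)
  have rev: "H (setFlag S x) (?I (set (lockList x))) (\<lambda>t. True \<and> (revealed x t \<and> settled x t))"
    unfolding H_def by (rule hoare_conseq[OF own_reveal]) auto
  have run: "H (run S x) (\<lambda>t. True \<and> (revealed x t \<and> settled x t))
     (\<lambda>t. finished x t \<and> (revealed x t \<and> settled x t))"
  proof (rule lift[OF run_finishes])
    fix t t' assume "revealed x t \<and> settled x t" "t \<le> t'"
      "\<And>u l. t \<le> u \<Longrightarrow> u < t' \<Longrightarrow> \<sigma> u = (owner x, l) \<Longrightarrow> helping u l"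
    then show "revealed x t' \<and> settled x t'"
      using revealed_mono not_helping by (blast intro: settled_ext[of x t t'])
  qed
  have clear': "H (clearFlag x) (\<lambda>t. finished x t \<and> (revealed x t \<and> settled x t)) (?J {})"
    unfolding H_def clearFlag_def
  proof (rule hoare_steps[OF hoare_WritePriority])
    fix t u assume t: "finished x t \<and> (revealed x t \<and> settled x t)"
      and u: "nextstep (owner x) t u (PriorityWrite x (- 1))"
    have tu: "t \<le> u" "t \<le> Suc u" using nextstep_le[OF u] by auto
    have "settled x (Suc u)"
      by (rule settled_ext[of x t]) (use t tu nextstep_no_label[OF u] nextstep_label[OF u] in
        \<open>auto simp: less_Suc_eq\<close>)
    then show "own_step x u (PriorityWrite x (- 1)) \<and> ?J {} (Suc u)"
      using pos[of u] t tu finished_mono revealed_mono by (auto simp: own_step_def)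
  qed
  have rem: "H (for_each (lockList x) (\<lambda>l. lock_remove S l x)) (?J {}) (?J (set (lockList x)))"
    unfolding H_def
    using hoare_for_each[where I="?J" and A="{}" and xs="lockList x", OF own_remove]
    by (simp add: hoare_steps)
  have fin: "H (ReadStatus x (\<lambda>s. DelayUntil (T0 S + T1 S) (event (TryResp x (s = Won)))))
     (?J (set (lockList x))) (\<lambda>_. True)"
    unfolding H_def by (rule own_finish)
  have "H (tryLocks S x) (\<lambda>t. True \<and> fresh x t) (\<lambda>_. True)"
    unfolding tryLocks_def multiInsert_def multiRemove_def
    using seq[OF hlp seq[OF seq[OF _ seq[OF ins rev]] seq[OF run seq[OF seq[OF clear' rem] fin]]]] clear
    by simp
  then show ?thesis
    unfolding H_def by (rule hoare_wp) (auto simp: fresh_start)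
qed

lemma own_label:
  assumes "\<sigma> t = (q, l)" "l \<noteq> Idling" "\<And>x. l \<noteq> Ev (TryInv x)"
  obtains x where "started x" "ident x < t" "owner x = q" "own_step x t l" "allowed_label x t l"
proof -
  have "wp (owner x) (\<lambda>u n l. own_step x u l \<and> allowed_label x u l) (tryLocks S x) (\<lambda>_ _ _. True)
    (Suc (ident x)) 1" if "started x" for x
    using wp_conj[OF own_attempt[OF that]] emits_tryLocks[of x] by (fastforce simp: emits_def)
  then show ?thesis
    by (rule label_cases[where G="\<lambda>x u n l. own_step x u l \<and> allowed_label x u l" and Q="\<lambda>_ _ _. True", OF _ assms(1)])
      (use that assms(2,3) in auto)
qed

lemma clearD: "\<sigma> u = (q, PriorityWrite x (-1)) \<Longrightarrow> \<not> revealed x u \<or> finished x u"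
  by (erule own_label) (auto simp: own_step_def allowed_label_def quiet_def)

lemma reveal_completed:
  "reveal x u \<Longrightarrow> \<not> revealed x u \<and> (\<forall>lk\<in>set (lockList x). completed (Insert x) lk u)"
  unfolding reveal_def
  by (erule exE, erule own_label)
    (use pos[of u] in \<open>auto simp: own_step_def allowed_label_def quiet_def\<close>)

lemma insert_not_revealed: "\<sigma> u = (q, Ev (ASInv lk (Insert x))) \<Longrightarrow> \<not> revealed x u"
  by (erule own_label) (auto simp: own_step_def allowed_label_def quiet_def)

lemma remove_finished:
  "\<sigma> u = (q, Ev (ASInv lk (Remove x))) \<Longrightarrow> revealed x u \<and> finished x u \<and> settled x u"
  by (erule own_label) (auto simp: own_step_def allowed_label_def quiet_def)

lemma response_finished:
  "\<sigma> u = (q, Ev (TryResp x d)) \<Longrightarrow> finished x u \<and> d = (stt u x = Won) \<and>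
     (\<forall>lk\<in>set (lockList x). completed (Remove x) lk u)"
  by (erule own_label) (auto simp: own_step_def allowed_label_def quiet_def)

lemma thunk_won: "\<sigma> u = (q, Ev (ThunkInv x)) \<Longrightarrow> stt u x = Won"
  by (erule own_label) (auto simp: own_step_def)

lemma reveal_unique: "reveal x u \<Longrightarrow> reveal x u' \<Longrightarrow> u = u'"
  using reveal_completed unfolding revealed_def by (meson linorder_neqE_nat)

text \<open>The initial value and all clearing writes are negative, so only a reveal can produce a
  positive priority.\<close>

lemma priority_revealed:
  "priority (mem t) x > 0 \<Longrightarrow> \<exists>u<t. reveal x u \<and> priority (mem t) x = \<omega> u"
proof (induction t)
  case 0
  then show ?case by (simp add: priority_0)
next
  case (Suc t)
  show ?case
  proof (cases "\<exists>v. snd (\<sigma> t) = PriorityWrite x v")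
    case True
    then obtain v where v: "\<sigma> t = (sched S t, PriorityWrite x v)" by (cases "\<sigma> t") (auto simp flip: fst_step_at)
    then have p: "priority (mem (Suc t)) x = v" by (simp add: priority_Suc)
    with PriorityWriteD[OF v] Suc.prems have "v = \<omega> t" by auto
    with v p show ?thesis by (auto simp: reveal_def)
  next
    case False
    then have "priority (mem (Suc t)) x = priority (mem t) x"
      by (auto simp: priority_Suc split: label.split)
    with Suc show ?thesis by (metis less_SucI)
  qed
qed

text \<open>After the reveal the priority can be overwritten only by the clearing write, which
  \<open>clearD\<close> places after the attempt is finished.\<close>

lemma revealed_priority:
  "revealed x t \<Longrightarrow> finished x t \<or> (\<exists>u<t. reveal x u \<and> priority (mem t) x = \<omega> u)"
proof (induction t)
  case 0
  then show ?case by (simp add: revealed_def)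
next
  case (Suc t)
  show ?case
  proof (cases "\<exists>v. snd (\<sigma> t) = PriorityWrite x v")
    case True
    then obtain v where v: "\<sigma> t = (sched S t, PriorityWrite x v)" by (cases "\<sigma> t") (auto simp flip: fst_step_at)
    show ?thesis
    proof (cases "v = \<omega> t")
      case True
      with v show ?thesis by (auto simp: priority_Suc reveal_def)
    next
      case False
      with PriorityWriteD[OF v] have "v = -1" by simp
      moreover have "revealed x t"
        using Suc.prems v False unfolding revealed_def reveal_def by (auto simp: less_Suc_eq)
      ultimately have "finished x t" using clearD v by blast
      then show ?thesis using finished_mono by (metis le_Suc_eq order_refl)
    qed
  next
    case False
    then have p: "priority (mem (Suc t)) x = priority (mem t) x"
      by (auto simp: priority_Suc split: label.split)
    have "revealed x t"
      using Suc.prems False unfolding revealed_def reveal_def by (auto simp: less_Suc_eq)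
    with Suc.IH p show ?thesis using finished_mono by (metis le_Suc_eq less_SucI order_refl)
  qed
qed

end

section \<open>Decisions and step counts\<close>

context execution
begin

definition conflict :: "desc \<Rightarrow> desc \<Rightarrow> bool" where
  "conflict x y \<longleftrightarrow> set (lockList x) \<inter> set (lockList y) \<noteq> {}"

lemma conflict_sym: "conflict x y \<Longrightarrow> conflict y x"
  by (auto simp: conflict_def)

text \<open>
  If \<open>x\<close> wins at time \<open>u\<close>, then the deciding run started at some time \<open>t0\<close> after the reveal of \<open>x\<close> and
  has dealt with each conflicting attempt that was revealed by then.
\<close>

definition win_info :: "desc \<Rightarrow> nat \<Rightarrow> bool" where
  "win_info x u \<longleftrightarrow> (\<exists>t0\<le>u. revealed x t0 \<and>
     (\<forall>y. y \<noteq> x \<and> conflict x y \<and> revealed y t0 \<longrightarrow> finished y u))"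

text \<open>The time \<open>t1\<close>, after the reveal of \<open>x\<close> and with
  \<open>y\<close> undecided, is what later makes \<open>y\<close> a rival: it excludes that
  \<open>y\<close> was helped to the end or had responded by the reveal of \<open>x\<close>. The
  inequality is weak because \<open>compete\<close> resolves a tie against the attempt whose run it
  belongs to.\<close>

definition loss_info :: "desc \<Rightarrow> nat \<Rightarrow> bool" where
  "loss_info x u \<longleftrightarrow> (\<exists>y ux uy t1. y \<noteq> x \<and> conflict x y \<and> reveal x ux \<and> reveal y uy \<and>
     \<omega> ux \<le> \<omega> uy \<and> ux < t1 \<and> t1 \<le> u \<and> uy < u \<and> stt t1 y = Active)"

definition informed :: "nat \<Rightarrow> label \<Rightarrow> bool" where
  "informed u l \<longleftrightarrow> helping u l \<and> (\<forall>x. l = StatusCas x Active Won True \<longrightarrow> win_info x u) \<and>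
     (\<forall>x. l = StatusCas x Active Lost True \<longrightarrow> loss_info x u)"

lemma informed_helping: "helping u l \<Longrightarrow> (\<And>x y z d. l \<noteq> StatusCas x y z d) \<Longrightarrow> informed u l"
  by (auto simp: informed_def)

lemma informed_word: "word_label l \<Longrightarrow> informed u l"
  by (auto intro!: informed_helping helping_word)

lemma informed_simps [simp]:
  "informed u (PriorityRead x v)" "informed u (StatusRead x s)"
  "informed u (Ev (ASInv lk GetSet))" "informed u (Ev (ASResp lk xs))"
  by (auto simp: informed_def helping_def quiet_def)

lemma hoare_seq:
  "hoare q c G B1 P r (\<lambda>_. P') \<Longrightarrow> hoare q c G B2 P' r' R \<Longrightarrow>
     hoare q c G (B1 + B2) P (bind_prog r (\<lambda>_. r')) R"
  by (rule hoare_bind)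

lemma hoare_pure: "(K \<Longrightarrow> hoare q c G B P r R) \<Longrightarrow> hoare q c G B (\<lambda>t. K \<and> P t) r R"
  by (auto simp: hoare_def)

lemma hoare_frame_mono:
  "hoare q c G B P r R \<Longrightarrow> (\<And>t t'. F t \<Longrightarrow> t \<le> t' \<Longrightarrow> F t') \<Longrightarrow>
     hoare q c G B (\<lambda>t. P t \<and> F t) r (\<lambda>x t. R x t \<and> F t)"
  by (rule hoare_frame) auto

end

text \<open>Contention bounds a \<open>card\<close>, which says nothing about infinite sets.\<close>

lemma finite_live: "finite (live S \<omega> lk t)"
proof (rule finite_subset)
  let ?f = "\<lambda>i. case snd (step_at S \<omega> i) of Ev (TryInv p) \<Rightarrow> p"
  show "live S \<omega> lk t \<subseteq> ?f ` {..t}"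
  proof
    fix p assume "p \<in> live S \<omega> lk t"
    then obtain i q where "i \<le> t" "step_at S \<omega> i = (q, Ev (TryInv p))" by (auto simp: live_def)
    then show "p \<in> ?f ` {..t}" by (intro image_eqI[of _ _ i]) simp_all
  qed
qed simp

section \<open>Answers of active sets, competition, runs and helping, with step counts\<close>

context lock_execution
begin

text \<open>Listed items are live at the linearization point: their insertion was invoked before it,
  and a response by then would follow a completed removal that took effect after the insertion and
  before that point. So contention bounds the length. Conversely, a revealed item has a completed
  insertion and is removed only once it is finished.\<close>

lemma getSet_answer:
  assumes i: "\<sigma> i = (q, Ev (ASInv lk GetSet))" and ret: "as_returns \<sigma> lk i j xs"
  shows getSet_length: "length xs \<le> \<kappa>"
    and getSet_member: "y \<in> set xs \<Longrightarrow> lk \<in> set (lockList y)"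
    and getSet_complete: "lk \<in> set (lockList y) \<Longrightarrow> revealed y i \<Longrightarrow> y \<in> set xs \<or> finished y j"
proof -
  from lin[of lk] obtain \<tau> :: "nat \<Rightarrow> ereal" where \<tau>:
    "\<forall>i q opr. \<sigma> i = (q, Ev (ASInv lk opr)) \<longrightarrow> ereal (real i) < \<tau> i"
    "\<forall>i j xs. as_returns \<sigma> lk i j xs \<longrightarrow> \<tau> i < ereal (real j)"
    "\<forall>i q j xs. \<sigma> i = (q, Ev (ASInv lk GetSet)) \<and> as_returns \<sigma> lk i j xs \<longrightarrow>
        distinct xs \<and> set xs = as_contents \<sigma> lk \<tau> (\<tau> i)"
    unfolding linearizable_def by (elim exE conjE) (rule that)
  have inv: "ereal (real i) < \<tau> i" if "\<sigma> i = (q, Ev (ASInv lk opr))" for i q opr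
    using \<tau>(1) that by blast
  have resp: "\<tau> i < ereal (real j)" if "as_returns \<sigma> lk i j xs" for i j xs
    using \<tau>(2) that by blast
  have get: "distinct xs \<and> set xs = as_contents \<sigma> lk \<tau> (\<tau> i)"
    if "\<sigma> i = (q, Ev (ASInv lk GetSet))" "as_returns \<sigma> lk i j xs" for i q j xs
    using \<tau>(3) that by blast
  have bounds: "ereal (real i) < \<tau> i" "\<tau> i < ereal (real j)" using inv[OF i] resp[OF ret] by auto
  \<comment> \<open>The response bounds the linearization point, so it is a real number and not
    \<infinity>.\<close>
  then obtain z where z: "\<tau> i = ereal z" "real i < z" "z < real j" by (cases "\<tau> i") auto
  have xs: "distinct xs" "set xs = as_contents \<sigma> lk \<tau> (ereal z)" using get[OF i ret] z by auto
  \<comment> \<open>Linearization points are real, while \<open>live\<close> is indexed by step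
    times; \<open>m\<close> is the last step time not after \<open>z\<close>.\<close>
  define m where "m = nat \<lfloor>z\<rfloor>"
  have m: "real m \<le> z" "z < real m + 1" using z(2) by (auto simp: m_def)
  have le_m: "u \<le> m" if "real u < z" for u using that m by linarith
  show member: "lk \<in> set (lockList y)" if "y \<in> set xs" for y
    using that InsertD unfolding xs as_contents_def by blast
  have "set xs \<subseteq> live S \<omega> lk m"
  proof
    fix y assume y: "y \<in> set xs"
    then obtain i1 q1 where i1: "\<sigma> i1 = (q1, Ev (ASInv lk (Insert y)))" "\<tau> i1 < ereal z"
      and norem: "\<And>j q. \<sigma> j = (q, Ev (ASInv lk (Remove y))) \<Longrightarrow> \<tau> i1 < \<tau> j \<Longrightarrow> \<not> \<tau> j < ereal z"
      unfolding xs as_contents_def by blast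
    have "ereal (real i1) < ereal z" using inv[OF i1(1)] i1(2) by (rule less_trans)
    then have "i1 \<le> m" by (intro le_m) simp
    with InsertD[OF i1(1)] have st: "ident y \<le> m" "\<sigma> (ident y) = (owner y, Ev (TryInv y))"
      using started_TryInv by auto
    have "\<sigma> j' \<noteq> (q', Ev (TryResp y d))" if "j' \<le> m" for j' q' d
    proof
      assume r: "\<sigma> j' = (q', Ev (TryResp y d))"
      obtain i2 q2 where i2: "\<sigma> i2 = (q2, Ev (ASInv lk (Remove y)))" "answered lk i2 j'"
        using response_finished[OF r] member[OF y] by (auto simp: completed_def)
      then obtain j2 ys where j2: "j2 < j'" "as_returns \<sigma> lk i2 j2 ys" by (auto simp: answered_def)
      have "\<tau> i2 < ereal (real j2)" using resp[OF j2(2)] .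
      also have "\<dots> < ereal z" using j2(1) that m by simp
      finally have i2z: "\<tau> i2 < ereal z" .
      \<comment> \<open>The protocol orders the two: no insertion is invoked after the reveal, and
        removals are invoked only after it.\<close>
      have "i1 < i2"
      proof (rule ccontr)
        assume "\<not> i1 < i2"
        then have "revealed y i1" using remove_finished[OF i2(1)] revealed_mono by auto
        with insert_not_revealed[OF i1(1)] show False by blast
      qed
      then obtain j1 ys1 where j1: "j1 < i2" "as_returns \<sigma> lk i1 j1 ys1"
        using remove_finished[OF i2(1)] i1(1) unfolding settled_def answered_def by blast
      have "\<tau> i1 < ereal (real j1)" using resp[OF j1(2)] .
      also have "\<dots> < ereal (real i2)" using j1 by simp
      also have "\<dots> < \<tau> i2" using inv[OF i2(1)] .
      finally have "\<tau> i1 < \<tau> i2" .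
      with i2z show False using norem[OF i2(1)] by blast
    qed
    with st member[OF y] show "y \<in> live S \<omega> lk m" by (auto simp: live_def)
  qed
  then have "card (set xs) \<le> card (live S \<omega> lk m)" by (intro card_mono finite_live)
  with contention[of lk m] contention_le[of lk] xs(1) show "length xs \<le> \<kappa>"
    by (simp add: distinct_card)
  show "y \<in> set xs \<or> finished y j" if y: "lk \<in> set (lockList y)" "revealed y i" for y
  proof (rule disjCI)
    assume nf: "\<not> finished y j"
    obtain u where u: "u < i" "reveal y u" using y(2) by (auto simp: revealed_def)
    obtain i1 q1 j1 ys1 where i1: "\<sigma> i1 = (q1, Ev (ASInv lk (Insert y)))" "j1 < u" "as_returns \<sigma> lk i1 j1 ys1"
      using reveal_completed[OF u(2)] y(1) by (auto simp: completed_def answered_def)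
    have "\<tau> i1 < ereal (real j1)" using resp[OF i1(3)] .
    also have "\<dots> < ereal z" using i1 u z by simp
    finally have i1z: "\<tau> i1 < ereal z" .
    have "\<not> \<tau> i2 < ereal z" if i2: "\<sigma> i2 = (q2, Ev (ASInv lk (Remove y)))" for i2 q2
    proof
      assume "\<tau> i2 < ereal z"
      with inv[OF i2] have "ereal (real i2) < ereal z" by (rule less_trans)
      then have "i2 \<le> j" using z by simp
      with remove_finished[OF i2] finished_mono nf show False by blast
    qed
    with i1 i1z show "y \<in> set xs" unfolding xs as_contents_def by blast
  qed
qed

text \<open>If the flag of an item revealed before \<open>t0\<close> is read as false, the priority
  has been cleared again, and clearing comes after the decision: an omitted item is
  finished.\<close>

lemma flagged_spec:
  "hoare q True informed (length xs) (\<lambda>t. t0 \<le> t) (flagged xs)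
     (\<lambda>ys t. t0 \<le> t \<and> set ys \<subseteq> set xs \<and> length ys \<le> length xs \<and> (\<forall>y\<in>set ys. revealed y t) \<and>
        (\<forall>y\<in>set xs. revealed y t0 \<longrightarrow> y \<in> set ys \<or> finished y t))"
proof (induction xs)
  case Nil
  then show ?case by (auto intro: hoare_Return)
next
  case (Cons x xs)
  let ?F = "\<lambda>d t. (d \<longrightarrow> revealed x t) \<and> (\<not> d \<and> revealed x t0 \<longrightarrow> finished x t)"
  have flag: "hoare q True informed 1 (\<lambda>t. t0 \<le> t) (getFlag x) (\<lambda>d t. t0 \<le> t \<and> ?F d t)"
    unfolding getFlag_def One_nat_def
  proof (rule hoare_ReadPriority)
    fix t u
    assume t: "t0 \<le> t" and n: "nextstep q t u (PriorityRead x (priority (mem u) x))"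
    have u: "t0 \<le> Suc u" "t0 \<le> u" using t nextstep_le[OF n] by auto
    have "revealed x (Suc u)" if "0 < priority (mem u) x"
      using priority_revealed[OF that] by (auto simp: revealed_def less_Suc_eq)
    moreover have "finished x (Suc u)" if "\<not> 0 < priority (mem u) x" "revealed x t0"
      using revealed_priority[of x u] revealed_mono[OF that(2) u(2)] that(1) pos
        finished_mono[of x u "Suc u"] by force
    ultimately show "t0 \<le> Suc u \<and> ?F (0 < priority (mem u) x) (Suc u)"
      using u by simp
  qed (auto intro: hoare_Return)
  have "hoare q True informed (1 + (length xs + 0)) (\<lambda>t. t0 \<le> t) (flagged (x # xs))
     (\<lambda>ys t. t0 \<le> t \<and> set ys \<subseteq> set (x # xs) \<and> length ys \<le> length (x # xs) \<and> (\<forall>y\<in>set ys. revealed y t) \<and>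
        (\<forall>y\<in>set (x # xs). revealed y t0 \<longrightarrow> y \<in> set ys \<or> finished y t))"
    unfolding flagged.simps
  proof (rule hoare_bind[OF flag], rule hoare_bind)
    show "hoare q True informed (length xs) (\<lambda>t. t0 \<le> t \<and> ?F d t) (flagged xs)
      (\<lambda>ys t. (t0 \<le> t \<and> set ys \<subseteq> set xs \<and> length ys \<le> length xs \<and> (\<forall>y\<in>set ys. revealed y t) \<and>
        (\<forall>y\<in>set xs. revealed y t0 \<longrightarrow> y \<in> set ys \<or> finished y t)) \<and> ?F d t)" for d
      by (rule hoare_frame_mono[OF Cons]) (use revealed_mono finished_mono in blast)
  qed (auto intro!: hoare_Return)
  then show ?case by simp
qed

definition getSet_post :: "lock \<Rightarrow> nat \<Rightarrow> desc list \<Rightarrow> nat \<Rightarrow> bool" where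
  "getSet_post lk t0 ys t \<longleftrightarrow> (\<forall>y\<in>set ys. lk \<in> set (lockList y) \<and> revealed y t) \<and>
     (\<forall>y. lk \<in> set (lockList y) \<and> revealed y t0 \<longrightarrow> y \<in> set ys \<or> finished y t)"

lemma getSet_post_mono: "getSet_post lk t0 ys t \<Longrightarrow> t \<le> t' \<Longrightarrow> getSet_post lk t0 ys t'"
  unfolding getSet_post_def using revealed_mono finished_mono by blast

text \<open>Of the step bound, \<open>b\<close> is for the code, 2 for invocation and response, and
  \<kappa> for one flag read per listed item.\<close>

lemma getSet_spec:
  "hoare q True informed (b + 2 + \<kappa>) (\<lambda>t. t0 \<le> t) (getSet S lk)
     (\<lambda>ys t. length ys \<le> \<kappa> \<and> t0 \<le> t \<and> getSet_post lk t0 ys t)"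
  unfolding getSet_def
proof (rule hoare_bind)
  let ?F = "\<lambda>xs t. \<forall>y. lk \<in> set (lockList y) \<and> revealed y t0 \<longrightarrow> y \<in> set xs \<or> finished y t"
  have "hoare q True informed (b + 2) (\<lambda>t. t0 \<le> t)
    (Event (ASInv lk GetSet) (bind_prog (exec_code (ActiveSetMem lk) (as_getSet (actset S)))
       (\<lambda>x. Event (ASResp lk ((\<lambda>x. x) x)) (Return x))))
    (\<lambda>xs t. (length xs \<le> \<kappa> \<and> (\<forall>y\<in>set xs. lk \<in> set (lockList y))) \<and> t0 \<le> t \<and> ?F xs t)"
  proof (rule hoare_op[OF getSet_steps])
    fix t i j xs
    assume t: "t0 \<le> t" and i: "nextstep q t i (Ev (ASInv lk GetSet))" "i < j"
      and ret: "as_returns \<sigma> lk i j xs"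
    note s = nextstep_label[OF i(1)]
    have "y \<in> set xs \<or> finished y (Suc j)" if "lk \<in> set (lockList y)" "revealed y t0" for y
      using getSet_complete[OF s ret that(1)] revealed_mono[OF that(2), of i] t nextstep_le[OF i(1)]
        finished_mono[of y j "Suc j"] by auto
    then show "(length xs \<le> \<kappa> \<and> (\<forall>y\<in>set xs. lk \<in> set (lockList y))) \<and> t0 \<le> Suc j \<and> ?F xs (Suc j)"
      using getSet_length[OF s ret] getSet_member[OF s ret] t i nextstep_le[OF i(1)] by auto
  qed (auto intro: informed_word)
  then show "hoare q True informed (b + 2) (\<lambda>t. t0 \<le> t) (raw_getSet S lk)
    (\<lambda>xs t. (length xs \<le> \<kappa> \<and> (\<forall>y\<in>set xs. lk \<in> set (lockList y))) \<and> t0 \<le> t \<and> ?F xs t)"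
    by (simp add: raw_getSet_def)
  fix xs
  show "hoare q True informed \<kappa>
    (\<lambda>t. (length xs \<le> \<kappa> \<and> (\<forall>y\<in>set xs. lk \<in> set (lockList y))) \<and> t0 \<le> t \<and> ?F xs t) (flagged xs)
    (\<lambda>ys t. length ys \<le> \<kappa> \<and> t0 \<le> t \<and> getSet_post lk t0 ys t)"
  proof (rule hoare_pure)
    assume xs: "length xs \<le> \<kappa> \<and> (\<forall>y\<in>set xs. lk \<in> set (lockList y))"
    have "hoare q True informed (length xs) (\<lambda>t. t0 \<le> t \<and> ?F xs t) (flagged xs)
     (\<lambda>ys t. (t0 \<le> t \<and> set ys \<subseteq> set xs \<and> length ys \<le> length xs \<and> (\<forall>y\<in>set ys. revealed y t) \<and>
        (\<forall>y\<in>set xs. revealed y t0 \<longrightarrow> y \<in> set ys \<or> finished y t)) \<and> ?F xs t)"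
      by (rule hoare_frame_mono[OF flagged_spec]) (use finished_mono in blast)
    then show "hoare q True informed \<kappa> (\<lambda>t. t0 \<le> t \<and> ?F xs t) (flagged xs)
      (\<lambda>ys t. length ys \<le> \<kappa> \<and> t0 \<le> t \<and> getSet_post lk t0 ys t)"
      by (rule hoare_conseq) (use xs in \<open>auto simp: getSet_post_def subset_iff\<close>)
  qed
qed

lemma active_priority:
  assumes "revealed x t" "t \<le> u" "stt u x = Active"
  obtains v where "v < t" "reveal x v" "priority (mem u) x = \<omega> v"
proof -
  have "\<not> finished x u" using assms by (simp add: finished_def)
  then obtain v where v: "reveal x v" "priority (mem u) x = \<omega> v"
    using revealed_priority revealed_mono[OF assms(1,2)] by blast
  moreover have "v < t" using assms(1) v(1) reveal_unique unfolding revealed_def by blast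
  ultimately show ?thesis using that by blast
qed

text \<open>The precondition shows why \<open>run\<close> reads the status of \<open>x\<close> after
  \<open>getSet\<close>: \<open>x\<close> is then seen undecided at a time \<open>t1\<close> when
  \<open>y\<close> is already revealed, the evidence for \<open>loss_info y\<close>. For a loss of
  \<open>x\<close>, the evidence is the first step, which reads \<open>y\<close> as active. The 4
  steps are three reads and a CAS.\<close>

lemma compete_spec:
  assumes "conflict x y"
  shows "hoare q True informed 4
     (\<lambda>t. revealed x t \<and> (\<exists>t1\<le>t. stt t1 x = Active \<and> revealed y t1)) (compete x y)
     (\<lambda>_ t. y \<noteq> x \<longrightarrow> stt t y \<noteq> Active \<or> stt t x \<noteq> Active)"
  unfolding hoare_def compete_def
proof (intro allI impI, simp only: wp.simps, intro allI impI conjI)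
  fix N t n :: nat and u1
  assume P: "(revealed x t \<and> (\<exists>t1\<le>t. stt t1 x = Active \<and> revealed y t1)) \<and> (True \<longrightarrow> n + 4 \<le> N)"
    and u1: "nextstep q t u1 (StatusRead y (stt u1 y))"
  then obtain t1 where t1: "t1 \<le> t" "stt t1 x = Active" "revealed y t1" by blast
  let ?G = "\<lambda>u j l. (True \<longrightarrow> j < N) \<and> informed u l"
  let ?Q = "\<lambda>_ t' n'. (y \<noteq> x \<longrightarrow> stt t' y \<noteq> Active \<or> stt t' x \<noteq> Active) \<and> (True \<longrightarrow> n' \<le> n + 4)"
  have tu1: "t \<le> u1" using nextstep_le[OF u1] .
  show "n < N" using P by auto
  show "wp q ?G (if stt u1 y = Active then ReadPriority x (\<lambda>v. ReadPriority y (\<lambda>w.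
        if w < v then eliminate y else if x \<noteq> y then eliminate x else skip)) else skip) ?Q (Suc u1) (Suc n)"
  proof (cases "stt u1 y = Active")
    case False
    then show ?thesis using stat_decided[of u1 "Suc u1" y] by auto
  next
    case True
    have loss_y: "loss_info y u4" if u: "u1 < u2" "u2 < u3" "u3 < u4"
      and act: "stt u4 y = Active" and less: "priority (mem u3) y < priority (mem u2) x" for u2 u3 u4
    proof -
      obtain uy where uy: "uy < t1" "reveal y uy" "priority (mem u3) y = \<omega> uy"
        using active_priority[OF t1(3), of u3] stat_active[OF _ act] u tu1 t1 by auto
      \<comment> \<open>\<open>x\<close> may be decided and cleared by now, but a value above the
        positive priority of \<open>y\<close> is a genuine draw.\<close>
      obtain ux where ux: "ux < u2" "reveal x ux" "priority (mem u2) x = \<omega> ux"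
        using priority_revealed[of u2 x] less uy pos[of uy] by auto
      have "x \<noteq> y" using less uy ux reveal_unique by auto
      then show ?thesis
        unfolding loss_info_def using uy ux less t1 u tu1 conflict_sym[OF assms]
        by (intro exI[of _ x] exI[of _ uy] exI[of _ ux] exI[of _ t1]) auto
    qed
    have loss_x: "loss_info x u4" if u: "u1 < u2" "u2 < u3" "u3 < u4" "x \<noteq> y"
      and act: "stt u4 x = Active" and less: "\<not> priority (mem u3) y < priority (mem u2) x" for u2 u3 u4
    proof -
      obtain ux where ux: "ux < t" "reveal x ux" "priority (mem u2) x = \<omega> ux"
        using active_priority[of x t u2] stat_active[OF _ act] u tu1 P by auto
      obtain uy where uy: "uy < u3" "reveal y uy" "priority (mem u3) y = \<omega> uy"
        using priority_revealed[of u3 y] less ux pos[of ux] by auto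
      show ?thesis
        unfolding loss_info_def using uy ux less u tu1 assms True
        by (intro exI[of _ y] exI[of _ ux] exI[of _ uy] exI[of _ u1]) auto
    qed
    have elim: "wp q ?G (eliminate z) ?Q (Suc u3) (Suc (Suc (Suc n)))"
      if "z \<in> {x, y}" "\<And>u4. u3 < u4 \<Longrightarrow> stt u4 z = Active \<Longrightarrow> loss_info z u4" for z u3
      unfolding eliminate_def wp.simps
    proof (intro allI impI conjI)
      fix u4 assume u4: "nextstep q (Suc u3) u4 (StatusCas z Active Lost (stt u4 z = Active))"
      have "stt (Suc u4) z \<noteq> Active" using nextstep_label[OF u4] by (auto simp: stat_Suc)
      then show "stt (Suc u4) y \<noteq> Active \<or> stt (Suc u4) x \<noteq> Active"
        using that(1) by auto
      show "informed u4 (StatusCas z Active Lost (stt u4 z = Active))"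
        using that(2)[of u4] nextstep_le[OF u4] by (auto simp: informed_def helping_def quiet_def)
    qed (use P in auto)
    have "wp q ?G (ReadPriority x (\<lambda>v. ReadPriority y (\<lambda>w.
        if w < v then eliminate y else if x \<noteq> y then eliminate x else skip))) ?Q (Suc u1) (Suc n)"
      unfolding wp.simps
    proof (intro allI impI conjI)
      fix u2 u3 assume n2: "nextstep q (Suc u1) u2 (PriorityRead x (priority (mem u2) x))"
        and n3: "nextstep q (Suc u2) u3 (PriorityRead y (priority (mem u3) y))"
      have u: "u1 < u2" "u2 < u3" using nextstep_le[OF n2] nextstep_le[OF n3] by auto
      show "wp q ?G (if priority (mem u3) y < priority (mem u2) x then eliminate y
          else if x \<noteq> y then eliminate x else skip) ?Q (Suc u3) (Suc (Suc (Suc n)))"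
        using elim[of y u3] elim[of x u3] loss_y[OF u] loss_x[OF u] by auto
    qed (use P in auto)
    with True show ?thesis by simp
  qed
qed simp

text \<open>Per lock: one \<open>getSet\<close>, one status read, and for each listed item 4 steps
  of \<open>compete\<close> and T + 3 of \<open>celebrateIfWon\<close>. At the end come
  \<open>decide\<close> and a last \<open>celebrateIfWon\<close>.\<close>

definition run_cost :: nat where
  "run_cost = L * (b + 2 + \<kappa> + Suc (\<kappa> * (4 + (T + 3)))) + (1 + (T + 3))"

text \<open>The start \<open>t0\<close> of the run is the witness in \<open>win_info\<close>. The
  invariant \<open>I\<close> admits the alternative that \<open>x\<close> is already decided: then
  the final CAS fails and there is nothing to show.\<close>

lemma run_spec: "hoare q True informed run_cost (\<lambda>t. revealed x t) (run S x) (\<lambda>_ t. finished x t)"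
proof (rule hoare_ctx)
  fix t0 assume x: "revealed x t0"
  define I where "I = (\<lambda>A t. t0 \<le> t \<and>
     (\<forall>lk\<in>A. \<forall>y. y \<noteq> x \<and> lk \<in> set (lockList y) \<and> revealed y t0 \<longrightarrow> finished y t \<or> stt t x \<noteq> Active))"
  have I_mono: "I A t'" if "I A t" "t \<le> t'" for A t t'
    using that finished_mono stat_active unfolding I_def by (meson le_trans)
  have lx: "length (lockList x) \<le> L"
    using x started_TryInv lock_count revealD unfolding revealed_def by blast
  let ?body = "\<lambda>y. bind_prog (compete x y) (\<lambda>_. celebrateIfWon S y)"
  let ?f = "\<lambda>l. bind_prog (getSet S l) (\<lambda>xs. ReadStatus x (\<lambda>s. if s = Active
         then for_each xs ?body else skip))"
  have round: "hoare q True informed (b + 2 + \<kappa> + Suc (\<kappa> * (4 + (T + 3)))) (I A) (?f lk) (\<lambda>_. I (insert lk A))"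
    if lk: "lk \<in> set (lockList x)" for lk A
  proof (rule hoare_bind)
    show "hoare q True informed (b + 2 + \<kappa>) (I A) (getSet S lk)
      (\<lambda>ys t. length ys \<le> \<kappa> \<and> getSet_post lk t0 ys t \<and> I A t)"
      by (rule hoare_conseq[OF hoare_frame_mono[OF getSet_spec[of q t0 lk] I_mono]]) (auto simp: I_def)
    fix ys
    show "hoare q True informed (Suc (\<kappa> * (4 + (T + 3))))
        (\<lambda>t. length ys \<le> \<kappa> \<and> getSet_post lk t0 ys t \<and> I A t)
        (ReadStatus x (\<lambda>s. if s = Active then for_each ys ?body else skip)) (\<lambda>_. I (insert lk A))"
    proof (intro hoare_pure hoare_ReadStatus)
      fix t u assume t: "getSet_post lk t0 ys t \<and> I A t" and n: "nextstep q t u (StatusRead x (stt u x))"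
      have "t \<le> Suc u" "t \<le> u" using nextstep_le[OF n] by auto
      \<comment> \<open>The read at time \<open>u\<close> provides the witness \<open>t1\<close>
        that \<open>compete_spec\<close> asks for.\<close>
      then show "(stt u x \<noteq> Active \<longrightarrow> stt (Suc u) x \<noteq> Active) \<and>
         (stt u x = Active \<longrightarrow> (\<exists>t1\<le>Suc u. stt t1 x = Active \<and> (\<forall>y\<in>set ys. revealed y t1))) \<and>
         getSet_post lk t0 ys (Suc u) \<and> I A (Suc u)"
        using t getSet_post_mono I_mono stat_active[of u "Suc u" x] getSet_post_mono[of lk t0 ys t u]
        by (auto intro!: exI[of _ u] simp: getSet_post_def[of _ _ _ u])
    next
      fix s assume ys: "length ys \<le> \<kappa>"
      let ?P = "\<lambda>t. (s \<noteq> Active \<longrightarrow> stt t x \<noteq> Active) \<and>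
         (s = Active \<longrightarrow> (\<exists>t1\<le>t. stt t1 x = Active \<and> (\<forall>y\<in>set ys. revealed y t1))) \<and>
         getSet_post lk t0 ys t \<and> I A t"
      show "hoare q True informed (\<kappa> * (4 + (T + 3))) ?P (if s = Active then for_each ys ?body else skip)
         (\<lambda>_. I (insert lk A))"
      proof (cases "s = Active")
        case False
        then show ?thesis by (auto intro!: hoare_Return simp: I_def)
      next
        case True
        define J where "J = (\<lambda>D t. ?P t \<and> (\<forall>y\<in>D. y \<noteq> x \<longrightarrow> finished y t \<or> stt t x \<noteq> Active))"
        have J_mono: "J D t'" if "J D t" "t \<le> t'" for D t t'
          using that getSet_post_mono[of lk t0 ys t t'] I_mono[of A t t'] stat_active[of t t' x]
            finished_mono[of _ t t'] unfolding J_def by (meson le_trans)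
        have step: "hoare q True informed (4 + (T + 3)) (J D) (?body y) (\<lambda>_. J (insert y D))"
          if y: "y \<in> set ys" for D y
        proof (rule hoare_bind)
          have "hoare q True informed 4 (J D) (compete x y)
             (\<lambda>_ t. (y \<noteq> x \<longrightarrow> stt t y \<noteq> Active \<or> stt t x \<noteq> Active) \<and> J D t)"
            if c: "conflict x y"
            by (rule hoare_conseq[OF hoare_frame_mono[OF compete_spec[OF c] J_mono[of D]]])
              (use x y True in \<open>auto simp: J_def I_def intro: revealed_mono\<close>)
          moreover have "conflict x y" if "J D t" for t
            using that y lk by (auto simp: J_def getSet_post_def conflict_def)
          ultimately show "hoare q True informed 4 (J D) (compete x y)
             (\<lambda>_ t. (y \<noteq> x \<longrightarrow> stt t y \<noteq> Active \<or> stt t x \<noteq> Active) \<and> J D t)"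
            unfolding hoare_def by blast
          show "hoare q True informed (T + 3)
             (\<lambda>t. (y \<noteq> x \<longrightarrow> stt t y \<noteq> Active \<or> stt t x \<noteq> Active) \<and> J D t) (celebrateIfWon S y) (\<lambda>_. J (insert y D))"
          \<comment> \<open>Fixing the time tells beforehand whether \<open>y\<close> is decided,
            and this is the switch \<open>D\<close> of \<open>hoare_celebrate\<close>. If it is not,
            then \<open>y\<close> is \<open>x\<close> or \<open>x\<close> is decided, and
            \<open>J\<close> demands nothing of \<open>y\<close>.\<close>
          proof (rule hoare_ctx)
            fix t1 assume t1: "(y \<noteq> x \<longrightarrow> stt t1 y \<noteq> Active \<or> stt t1 x \<noteq> Active) \<and> J D t1"
            have "hoare q True informed (T + 3)
              (\<lambda>t. (stt t1 y \<noteq> Active \<longrightarrow> stt t y \<noteq> Active) \<and> (t1 \<le> t \<and> J D t)) (celebrateIfWon S y)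
              (\<lambda>_ t. (stt t1 y \<noteq> Active \<longrightarrow> finished y t) \<and> (t1 \<le> t \<and> J D t))"
              by (rule hoare_frame_mono[OF hoare_celebrate[OF thunk_steps informed_helping]])
                (use J_mono in auto)
            then show "hoare q True informed (T + 3) (\<lambda>t. t = t1) (celebrateIfWon S y) (\<lambda>_. J (insert y D))"
              by (rule hoare_conseq) (use t1 stat_active in \<open>auto simp: J_def\<close>)
          qed
        qed
        have "hoare q True informed (\<kappa> * (4 + (T + 3))) (J {}) (for_each ys ?body) (\<lambda>_. J ({} \<union> set ys))"
          by (rule hoare_for_each[OF step]) (use ys in auto)
        then have "hoare q True informed (\<kappa> * (4 + (T + 3))) ?P (for_each ys ?body) (\<lambda>_. I (insert lk A))"
        proof (rule hoare_conseq)
          fix t assume "J ({} \<union> set ys) t"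
          then have "I A t" "t0 \<le> t" "\<And>y. y \<noteq> x \<Longrightarrow> lk \<in> set (lockList y) \<Longrightarrow> revealed y t0 \<Longrightarrow>
             finished y t \<or> stt t x \<noteq> Active"
            by (auto simp: J_def getSet_post_def I_def)
          then show "I (insert lk A) t" by (auto simp: I_def)
        qed (auto simp: J_def)
        with True show ?thesis by simp
      qed
    qed simp_all
  qed
  have "hoare q True informed run_cost (\<lambda>t. t = t0) (run S x) (\<lambda>_ t. finished x t)"
    unfolding run_def run_cost_def
  proof (intro hoare_bind)
    have "hoare q True informed (L * (b + 2 + \<kappa> + Suc (\<kappa> * (4 + (T + 3))))) (I {}) (for_each (lockList x) ?f)
      (\<lambda>_. I ({} \<union> set (lockList x)))"
      by (rule hoare_for_each[OF round mult_le_mono1[OF lx]])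
    then show "hoare q True informed (L * (b + 2 + \<kappa> + Suc (\<kappa> * (4 + (T + 3))))) (\<lambda>t. t = t0)
       (for_each (lockList x) ?f) (\<lambda>_. I (set (lockList x)))"
      by (rule hoare_conseq) (auto simp: I_def)
    show "hoare q True informed 1 (I (set (lockList x))) (decide x) (\<lambda>_ t. stt t x \<noteq> Active)"
    proof (rule hoare_decide)
      fix u t assume t: "I (set (lockList x)) t"
        and n: "nextstep q t u (StatusCas x Active Won (stt u x = Active))"
      have "win_info x u" if "stt u x = Active"
      proof -
        have "finished y u" if "y \<noteq> x" "conflict x y" "revealed y t0" for y
        proof -
          from that(2) obtain lk where "lk \<in> set (lockList x)" "lk \<in> set (lockList y)"
            by (auto simp: conflict_def)
          with that t \<open>stt u x = Active\<close> show ?thesis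
            using stat_active[OF nextstep_le[OF n]] finished_mono[OF _ nextstep_le[OF n]]
            by (auto simp: I_def)
        qed
        moreover have "t0 \<le> u" using t nextstep_le[OF n] by (simp add: I_def)
        ultimately show ?thesis using x unfolding win_info_def by blast
      qed
      then show "informed u (StatusCas x Active Won (stt u x = Active))"
        by (auto simp: informed_def helping_def quiet_def)
    qed
    show "hoare q True informed (T + 3) (\<lambda>t. stt t x \<noteq> Active) (celebrateIfWon S x) (\<lambda>_ t. finished x t)"
      by (rule hoare_conseq[OF hoare_celebrate[OF thunk_steps informed_helping, where D=True]]) auto
  qed
  then show "hoare q True informed run_cost (\<lambda>t. t = t0) (run S x) (\<lambda>_ t. finished x t)" .
qed

definition help_cost :: nat where
  "help_cost = L * (b + 2 + \<kappa> + \<kappa> * run_cost)"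

definition update_cost :: nat where
  "update_cost = L * (b * \<kappa> + 2)"

text \<open>Every item that is found gets finished by its run; a conflicting attempt revealed before
  \<open>t0\<close> that is not found is finished already.\<close>

lemma help_spec:
  assumes "length (lockList x) \<le> L"
  shows "hoare q True informed help_cost (\<lambda>t. t0 \<le> t)
     (for_each (lockList x) (\<lambda>l. bind_prog (getSet S l) (\<lambda>xs. for_each xs (run S))))
     (\<lambda>_ t. \<forall>y. conflict x y \<and> revealed y t0 \<longrightarrow> finished y t)"
proof -
  define I where "I = (\<lambda>A t. t0 \<le> t \<and>
     (\<forall>lk\<in>A. \<forall>y. lk \<in> set (lockList y) \<and> revealed y t0 \<longrightarrow> finished y t))"
  have I_mono: "I A t'" if "I A t" "t \<le> t'" for A t t'
    using that finished_mono unfolding I_def by (meson le_trans)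
  have round: "hoare q True informed (b + 2 + \<kappa> + \<kappa> * run_cost) (I A)
     (bind_prog (getSet S lk) (\<lambda>xs. for_each xs (run S))) (\<lambda>_. I (insert lk A))" for A lk
  proof (rule hoare_bind)
    show "hoare q True informed (b + 2 + \<kappa>) (I A) (getSet S lk)
      (\<lambda>ys t. length ys \<le> \<kappa> \<and> getSet_post lk t0 ys t \<and> I A t)"
      by (rule hoare_conseq[OF hoare_frame_mono[OF getSet_spec[of q t0 lk] I_mono]]) (auto simp: I_def)
    fix ys
    show "hoare q True informed (\<kappa> * run_cost) (\<lambda>t. length ys \<le> \<kappa> \<and> getSet_post lk t0 ys t \<and> I A t)
      (for_each ys (run S)) (\<lambda>_. I (insert lk A))"
    proof (rule hoare_pure)
      assume ys: "length ys \<le> \<kappa>"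
      define J where "J = (\<lambda>D t. getSet_post lk t0 ys t \<and> I A t \<and> (\<forall>y\<in>D. finished y t))"
      have J_mono: "J D t'" if "J D t" "t \<le> t'" for D t t'
        using that getSet_post_mono I_mono finished_mono unfolding J_def by blast
      have "hoare q True informed run_cost (J D) (run S y) (\<lambda>_. J (insert y D))" if "y \<in> set ys" for D y
        by (rule hoare_conseq[OF hoare_frame_mono[OF run_spec J_mono[of D]]])
          (use that in \<open>auto simp: J_def getSet_post_def\<close>)
      then have "hoare q True informed (\<kappa> * run_cost) (J {}) (for_each ys (run S)) (\<lambda>_. J ({} \<union> set ys))"
        by (rule hoare_for_each) (use ys in \<open>auto intro: mult_le_mono1\<close>)
      then show "hoare q True informed (\<kappa> * run_cost) (\<lambda>t. getSet_post lk t0 ys t \<and> I A t)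
        (for_each ys (run S)) (\<lambda>_. I (insert lk A))"
        by (rule hoare_conseq) (auto simp: J_def I_def getSet_post_def)
    qed
  qed
  have "hoare q True informed help_cost (I {})
     (for_each (lockList x) (\<lambda>l. bind_prog (getSet S l) (\<lambda>xs. for_each xs (run S))))
     (\<lambda>_. I ({} \<union> set (lockList x)))"
    unfolding help_cost_def by (rule hoare_for_each[OF round mult_le_mono1[OF assms]])
  then show ?thesis
    by (rule hoare_conseq) (auto simp: I_def conflict_def)
qed

end

text \<open>\<open>T0\<close> covers the invocation, helping, clearing and the insertions, so
  exactly \<open>T0\<close> steps precede the reveal. \<open>T1\<close> covers the run, clearing and
  the removals; the additional 2 pay for the reveal and the last status read.\<close>

locale lock_algorithm = lock_execution +
  assumes T0: "1 + (help_cost + (1 + update_cost)) \<le> T0 S"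
    and T1: "run_cost + (1 + update_cost) + 2 \<le> T1 S"
begin

definition attempt_step :: "desc \<Rightarrow> nat \<Rightarrow> nat \<Rightarrow> label \<Rightarrow> bool" where
  "attempt_step x u n l \<longleftrightarrow> (n < T0 S + T1 S \<or> n = T0 S + T1 S \<and> (\<exists>d. l = Ev (TryResp x d))) \<and>
     (\<forall>y. l = StatusCas y Active Won True \<longrightarrow> win_info y u) \<and>
     (\<forall>y. l = StatusCas y Active Lost True \<longrightarrow> loss_info y u) \<and>
     (l = PriorityWrite x (\<omega> u) \<longrightarrow> n = T0 S \<and>
        (\<forall>y. conflict x y \<and> revealed y (ident x) \<longrightarrow> finished y u)) \<and>
     (\<forall>d. l = Ev (TryResp x d) \<longrightarrow> n = T0 S + T1 S)"

definition attempt_post :: "desc \<Rightarrow> nat \<Rightarrow> nat \<Rightarrow> bool" where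
  "attempt_post x t n \<longleftrightarrow> n = Suc (T0 S + T1 S) \<and> revealed x t \<and> (\<exists>d. occurs (TryResp x d) t)"

definition plain :: "desc \<Rightarrow> nat \<Rightarrow> label \<Rightarrow> bool" where
  "plain x u l \<longleftrightarrow> (\<forall>y. l = StatusCas y Active Won True \<longrightarrow> win_info y u) \<and>
     (\<forall>y. l = StatusCas y Active Lost True \<longrightarrow> loss_info y u) \<and>
     l \<noteq> PriorityWrite x (\<omega> u) \<and> (\<forall>d. l \<noteq> Ev (TryResp x d))"

lemma informed_plain: "informed u l \<Longrightarrow> plain x u l"
  by (auto simp: informed_def plain_def helping_def quiet_def)

lemma plain_attempt_step: "plain x u l \<Longrightarrow> n < T0 S + T1 S \<Longrightarrow> attempt_step x u n l"
  by (auto simp: plain_def attempt_step_def)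

lemma plain_clear:
  assumes "\<And>t t'. F t \<Longrightarrow> t \<le> t' \<Longrightarrow> F t'"
  shows "hoare q True (plain x) 1 F (clearFlag x) (\<lambda>_. F)"
  unfolding clearFlag_def
proof (rule hoare_WritePriority)
  fix t u assume "F t" and u: "nextstep q t u (PriorityWrite x (- 1))"
  then show "plain x u (PriorityWrite x (- 1)) \<and> F (Suc u)"
    using assms[of t "Suc u"] nextstep_le[OF u] pos[of u] by (auto simp: plain_def)
qed

lemma plain_update:
  assumes "\<And>t t'. F t \<Longrightarrow> t \<le> t' \<Longrightarrow> F t'" "length (lockList x) \<le> L"
  shows "hoare q True (plain x) update_cost F (for_each (lockList x) (\<lambda>l. lock_insert S l x)) (\<lambda>_. F)"
    and "hoare q True (plain x) update_cost F (for_each (lockList x) (\<lambda>l. lock_remove S l x)) (\<lambda>_. F)"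
proof -
  have op: "hoare q True (plain x) (b * \<kappa> + 2) F
     (Event (ASInv lk opr) (bind_prog (exec_code (ActiveSetMem lk) d)
       (\<lambda>y. Event (ASResp lk ((\<lambda>_. []) y)) (Return y)))) (\<lambda>_. F)"
    if "max_steps d (b * \<kappa>)" for lk opr and d :: "unit code"
    by (rule hoare_op[OF that])
      (use assms(1) in \<open>auto simp: plain_def word_label_def dest!: nextstep_le\<close>)
  have "hoare q True (plain x) (b * \<kappa> + 2) F (lock_insert S lk x) (\<lambda>_. F)"
    and "hoare q True (plain x) (b * \<kappa> + 2) F (lock_remove S lk x) (\<lambda>_. F)" for lk
    using op[OF insert_steps] op[OF remove_steps] by (simp_all add: lock_insert_def lock_remove_def)
  moreover have "length (lockList x) * (b * \<kappa> + 2) \<le> update_cost"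
    unfolding update_cost_def using assms(2) by (rule mult_le_mono1)
  ultimately show "hoare q True (plain x) update_cost F (for_each (lockList x) (\<lambda>l. lock_insert S l x)) (\<lambda>_. F)"
    and "hoare q True (plain x) update_cost F (for_each (lockList x) (\<lambda>l. lock_remove S l x)) (\<lambda>_. F)"
    by (blast intro: hoare_for_each[where I="\<lambda>_. F"])+
qed

text \<open>Within a phase only upper bounds on the step number are known. The two delays turn them
  into the exact values \<open>T0 S\<close> and \<open>T0 S + T1 S\<close>, because the bounds never
  exceed these.\<close>

lemma attempt:
  assumes st: "started x"
  shows "wp (owner x) (attempt_step x) (tryLocks S x) (\<lambda>_. attempt_post x) (Suc (ident x)) 1"
proof -
  let ?q = "owner x"
  have lx: "length (lockList x) \<le> L" using lock_count started_TryInv[OF st] by blast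
  let ?H = "\<lambda>t. \<forall>y. conflict x y \<and> revealed y (ident x) \<longrightarrow> finished y t"
  have H_mono: "?H t'" if "?H t" "t \<le> t'" for t t' using that finished_mono by blast
  let ?last = "ReadStatus x (\<lambda>s. DelayUntil (T0 S + T1 S) (event (TryResp x (s = Won))))"
  have last: "wp ?q (attempt_step x) ?last (\<lambda>_. attempt_post x) t n"
    if "revealed x t" "n < T0 S + T1 S" for t n
    unfolding wp.simps
  proof (intro allI impI conjI; (elim conjE)?)
    fix u t' v
    assume u: "nextstep ?q t u (StatusRead x (stt u x))" and t': "Suc u \<le> t'"
      and v: "nextstep ?q t' v (Ev (TryResp x (stt u x = Won)))"
    have eq: "max (Suc n) (T0 S + T1 S) = T0 S + T1 S" using that by simp
    show "attempt_step x v (max (Suc n) (T0 S + T1 S)) (Ev (TryResp x (stt u x = Won)))"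
      unfolding eq by (auto simp: attempt_step_def)
    have "revealed x (Suc v)"
      using that(1) by (rule revealed_mono) (use nextstep_le[OF u] nextstep_le[OF v] t' in simp)
    moreover have "occurs (TryResp x (stt u x = Won)) (Suc v)"
      using nextstep_label[OF v] by (auto simp: occurs_def)
    ultimately show "attempt_post x (Suc v) (Suc (max (Suc n) (T0 S + T1 S)))"
      unfolding eq by (auto simp: attempt_post_def)
  qed (use that in \<open>auto simp: attempt_step_def\<close>)
  let ?mid = "bind_prog (run S x) (\<lambda>_. bind_prog (clearFlag x) (\<lambda>_. for_each (lockList x) (\<lambda>l. lock_remove S l x)))"
  have "hoare ?q True (plain x) run_cost (revealed x) (run S x) (\<lambda>_. revealed x)"
    by (rule hoare_conseq[OF hoare_frame_mono[OF run_spec revealed_mono]])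
      (auto intro: informed_plain)
  from hoare_seq[OF this hoare_seq[OF plain_clear plain_update(2)[OF _ lx]]]
  have mid_spec: "hoare ?q True (plain x) (run_cost + (1 + update_cost)) (revealed x) ?mid (\<lambda>_. revealed x)"
    using revealed_mono by blast
  have mid: "wp ?q (attempt_step x) (bind_prog ?mid (\<lambda>_. ?last)) (\<lambda>_. attempt_post x) t (Suc (T0 S))"
    if "revealed x t" for t
    by (rule wp_bind, rule hoare_wp[OF mid_spec, where N="T0 S + T1 S"])
      (use that T1 in \<open>auto intro!: last plain_attempt_step simp del: wp.simps\<close>)
  have flag: "wp ?q (attempt_step x) (bind_prog (setFlag S x) (\<lambda>_. bind_prog ?mid (\<lambda>_. ?last))) (\<lambda>_. attempt_post x) t n"
    if "?H t" "n \<le> T0 S" for t n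
    unfolding setFlag_def
  proof (rule wp_bind, unfold wp.simps, intro allI impI conjI; (elim conjE)?)
    fix t' u assume t': "t \<le> t'" and u: "nextstep ?q t' u (PriorityWrite x (\<omega> u))"
    have eq: "max n (T0 S) = T0 S" using that by simp
    have "?H u" using that(1) by (rule H_mono) (use t' nextstep_le[OF u] in simp)
    then show "attempt_step x u (max n (T0 S)) (PriorityWrite x (\<omega> u))"
      unfolding eq using T1 by (auto simp: attempt_step_def)
    have "revealed x (Suc u)"
      using nextstep_label[OF u] by (auto simp: revealed_def reveal_def)
    then show "wp ?q (attempt_step x) (bind_prog ?mid (\<lambda>_. ?last)) (\<lambda>_. attempt_post x) (Suc u) (Suc (max n (T0 S)))"
      unfolding eq by (rule mid)
  qed (use that in \<open>auto simp: attempt_step_def\<close>)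
  let ?help = "for_each (lockList x) (\<lambda>l. bind_prog (getSet S l) (\<lambda>xs. for_each xs (run S)))"
  let ?ins = "bind_prog (clearFlag x) (\<lambda>_. for_each (lockList x) (\<lambda>l. lock_insert S l x))"
  have "hoare ?q True (plain x) help_cost (\<lambda>t. Suc (ident x) \<le> t) ?help (\<lambda>_. ?H)"
    by (rule hoare_conseq[OF help_spec[OF lx]])
      (auto intro: informed_plain revealed_mono)
  from hoare_seq[OF this hoare_seq[OF plain_clear plain_update(1)[OF _ lx]]]
  have help_spec': "hoare ?q True (plain x) (help_cost + (1 + update_cost)) (\<lambda>t. Suc (ident x) \<le> t)
     (bind_prog ?help (\<lambda>_. ?ins)) (\<lambda>_. ?H)"
    using H_mono by blast
  have all: "wp ?q (attempt_step x)
     (bind_prog (bind_prog ?help (\<lambda>_. ?ins)) (\<lambda>_. bind_prog (setFlag S x) (\<lambda>_. bind_prog ?mid (\<lambda>_. ?last))))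
     (\<lambda>_. attempt_post x) (Suc (ident x)) 1"
    by (rule wp_bind, rule hoare_wp[OF help_spec', where N="T0 S"])
      (use T0 in \<open>auto intro!: flag plain_attempt_step simp del: wp.simps\<close>)
  \<comment> \<open>Regroups \<open>tryLocks\<close> around the reveal: the work before it, the
    delayed reveal, the work up to the final status read, and the end.\<close>
  have assoc: "bind_prog (bind_prog r f) g = bind_prog r (\<lambda>x. bind_prog (f x) g)"
    for r :: "unit prog" and f :: "unit \<Rightarrow> unit prog" and g :: "unit \<Rightarrow> unit prog"
    by (induction r) auto
  from all show ?thesis
    by (simp add: tryLocks_def multiInsert_def multiRemove_def assoc)
qed

end

section \<open>Safety and rivals\<close>

context execution
begin

text \<open>The count grows by one with each step of the owner, so it passes through every smaller
  value.\<close>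

lemma taken_attained:
  "n < taken x t \<Longrightarrow> \<exists>u<t. ident x \<le> u \<and> sched S u = owner x \<and> taken x u = n"
proof (induction t)
  case 0
  then show ?case by (simp add: taken_def)
next
  case (Suc t)
  show ?case
  proof (cases "ident x \<le> t \<and> sched S t = owner x \<and> n = taken x t")
    case False
    then have "n < taken x t"
    proof (cases "ident x \<le> t")
      case True
      with False Suc.prems show ?thesis by (auto simp: taken_Suc split: if_splits)
    next
      case False
      then have "{i. ident x \<le> i \<and> i < Suc t \<and> sched S i = owner x} = {}" by auto
      with Suc.prems show ?thesis by (simp add: taken_def)
    qed
    with Suc.IH show ?thesis using less_SucI by blast
  qed auto
qed

lemma stat_changed: "stt t x \<noteq> Active \<Longrightarrow> \<exists>w<t. \<exists>q. \<sigma> w = (q, StatusCas x Active (stt t x) True)"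
proof (induction t)
  case 0
  then show ?case by (simp add: stat_0)
next
  case (Suc t)
  show ?case
  proof (cases "stt t x = Active")
    case True
    with Suc.prems obtain y v w d where l: "snd (\<sigma> t) = StatusCas y v w d" "d" "y = x" "w = stt (Suc t) x"
      by (auto simp: stat_Suc split: label.splits if_splits)
    then have "\<sigma> t = (sched S t, StatusCas x v (stt (Suc t) x) True)"
      by (cases "\<sigma> t") (auto simp flip: fst_step_at)
    with StatusCasD[OF this] show ?thesis by blast
  next
    case False
    with Suc.IH stat_decided[of t "Suc t" x] show ?thesis by (auto intro: less_SucI)
  qed
qed

text \<open>
  Only the starts of attempts before \<open>r\<close> and \<open>t\<close>, and the schedule, enter the definition: the player
  selects a rival before its priority is drawn and without knowledge of the priority of \<open>x\<close>.
\<close>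

definition rival :: "desc \<Rightarrow> nat \<Rightarrow> nat \<Rightarrow> bool" where
  "rival x r t \<longleftrightarrow> t \<noteq> r \<and> ident x < t \<and> (\<exists>y. started y \<and> conflict x y \<and> ident y < r \<and> ident y < t \<and>
     sched S t = owner y \<and> taken y t = T0 S \<and>
     \<not> (\<exists>j\<le>r. ident y < j \<and> sched S j = owner y \<and> taken y j = T0 S + T1 S))"

end

context lock_algorithm
begin

lemma attempt_label:
  assumes "\<sigma> t = (q, l)" "l \<noteq> Idling" "\<And>x. l \<noteq> Ev (TryInv x)"
  obtains x where "started x" "ident x < t" "owner x = q" "attempt_step x t (taken x t) l" "allowed_label x t l"
proof -
  have "wp (owner x) (\<lambda>u n l. attempt_step x u n l \<and> allowed_label x u l) (tryLocks S x) (\<lambda>_ _ _. True)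
    (Suc (ident x)) 1" if "started x" for x
    using wp_conj[OF attempt[OF that]] emits_tryLocks[of x] by (fastforce simp: emits_def elim!: wp_mono)
  then show ?thesis
    by (rule label_cases[where G="\<lambda>x u n l. attempt_step x u n l \<and> allowed_label x u l" and Q="\<lambda>_ _ _. True", OF _ assms(1)])
      (use that assms(2,3) in auto)
qed

lemma winD: "\<sigma> u = (q, StatusCas x Active Won True) \<Longrightarrow> win_info x u"
  by (erule attempt_label) (auto simp: attempt_step_def)

lemma lossD: "\<sigma> u = (q, StatusCas x Active Lost True) \<Longrightarrow> loss_info x u"
  by (erule attempt_label) (auto simp: attempt_step_def)

lemma reveal_time:
  assumes "reveal x u"
  shows "taken x u = T0 S" and "conflict x y \<Longrightarrow> revealed y (ident x) \<Longrightarrow> finished y u"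
  using revealD[OF assms] pos[of u]
  by (auto elim!: attempt_label simp: attempt_step_def allowed_label_def quiet_def)

lemma response_time: "\<sigma> u = (q, Ev (TryResp x d)) \<Longrightarrow> taken x u = T0 S + T1 S"
  by (erule attempt_label) (auto simp: attempt_step_def allowed_label_def quiet_def)

text \<open>The attempt cannot have ended, since its end has a higher count, and the step with this
  number can only be the response. Together with \<open>response_time\<close>, the schedule alone
  tells when attempts end.\<close>

lemma response_step:
  assumes x: "started x" "ident x < t" "sched S t = owner x" "taken x t = T0 S + T1 S"
  obtains d where "\<sigma> t = (owner x, Ev (TryResp x d))"
proof -
  from running_or_ended[OF attempt x(1,2)] x(4) taken_mono[of _ t x]
  have "running attempt_step attempt_post x t" by (fastforce simp: attempt_post_def)
  from running_step(1)[OF this] x that show ?thesis by (auto simp: attempt_step_def)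
qed

text \<open>The attempt has ended at some time \<open>e\<close>, and the owner takes no step from
  \<open>e\<close> to \<open>t\<close>, for the count at \<open>e\<close> already equals that at
  \<open>t\<close>.\<close>

lemma idle_after:
  assumes x: "started x" "ident x < t" "sched S t = owner x" "taken x t = Suc (T0 S + T1 S)"
  shows "lcl t (owner x) = Idle" and "\<exists>r<t. reveal x r"
proof -
  have "\<not> running attempt_step attempt_post x t"
    using running_step(1)[of attempt_step attempt_post x t] x by (auto simp: attempt_step_def)
  with running_or_ended[OF attempt x(1,2)] obtain e
    where e: "ident x < e" "e \<le> t" "lcl e (owner x) = Idle" "attempt_post x e (taken x e)" by blast
  have "lcl u (owner x) = Idle" if "e \<le> u" "u \<le> t" for u
    using that
  proof (induction u rule: dec_induct)
    case (step u)
    have "sched S u \<noteq> owner x"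
    proof
      assume "sched S u = owner x"
      then have "taken x u < taken x t" using e step by (intro taken_strict) auto
      moreover have "taken x e \<le> taken x u" using step by (intro taken_mono)
      ultimately show False using e(4) x(4) by (simp add: attempt_post_def)
    qed
    with step lcl_other show ?case by simp
  qed (rule e)
  with e(2) show "lcl t (owner x) = Idle" by blast
  from e show "\<exists>r<t. reveal x r"
    unfolding attempt_post_def revealed_def using less_le_trans by blast
qed

lemma responds:
  assumes "started x" "T0 S + T1 S < taken x t"
  obtains e d r where "\<sigma> e = (owner x, Ev (TryResp x d))" "ident x < e" "e < t" "reveal x r" "r < e"
    "taken x e = T0 S + T1 S"
proof -
  obtain e where e: "e < t" "ident x \<le> e" "sched S e = owner x" "taken x e = T0 S + T1 S"
    using taken_attained[OF assms(2)] by blast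
  have "{i. ident x \<le> i \<and> i < ident x \<and> sched S i = owner x} = {}" by auto
  then have "taken x (ident x) = 0" unfolding taken_def by (simp only: card.empty)
  then have "ident x \<noteq> e" using e(4) T1 by auto
  with e have lt: "ident x < e" by simp
  obtain d where d: "\<sigma> e = (owner x, Ev (TryResp x d))"
    using response_step[OF assms(1) lt e(3,4)] by blast
  have Se: "ident x < Suc e" "taken x (Suc e) = Suc (T0 S + T1 S)" using lt e by (auto simp: taken_Suc)
  have "revealed x e"
  proof -
    from running_or_ended[OF attempt assms(1) lt] taken_mono[of _ e x] e(4)
    have r: "running attempt_step attempt_post x e" by (fastforce simp: attempt_post_def)
    \<comment> \<open>The reveal is recovered from the decision: \<open>win_info\<close> and
      \<open>loss_info\<close> both contain it.\<close>
    have "finished x e" using response_finished[OF d] by blast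
    then obtain w q where w: "w < e" "\<sigma> w = (q, StatusCas x Active (stt e x) True)"
      using stat_changed[of e x] by (auto simp: finished_def)
    have "stt e x = Won \<or> stt e x = Lost" using \<open>finished x e\<close> by (cases "stt e x") (auto simp: finished_def)
    then show ?thesis
    proof
      assume "stt e x = Won"
      with w winD[of w q x] have "\<exists>t0\<le>w. revealed x t0" by (auto simp: win_info_def)
      with w show ?thesis using revealed_mono less_imp_le le_trans by metis
    next
      assume "stt e x = Lost"
      with w lossD[of w q x] have "revealed x w"
        unfolding loss_info_def revealed_def by (metis less_le_trans)
      with w show ?thesis using revealed_mono less_imp_le by metis
    qed
  qed
  then obtain r where "r < e" "reveal x r" by (auto simp: revealed_def)
  with d e lt that show ?thesis by blast
qed

text \<open>The later winner \<open>y\<close> is decided by a run started at \<open>t0\<close>. If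
  \<open>x\<close> was revealed by then, \<open>x\<close> is finished before the CAS of that run.
  Otherwise the deciding run of \<open>x\<close> started no earlier than \<open>t0\<close>, when
  \<open>y\<close> was already revealed, so \<open>y\<close> was decided before its own winning CAS,
  which is absurd.\<close>

lemma intervals_ordered:
  assumes "x \<noteq> y" "conflict x y" and w: "\<sigma> wx = (qx, StatusCas x Active Won True)"
    "\<sigma> wy = (qy, StatusCas y Active Won True)" "wx < wy"
  shows "occurs (ThunkResp x) wy"
proof -
  obtain t0 where t0: "t0 \<le> wy" "revealed y t0"
    "\<And>z. z \<noteq> y \<Longrightarrow> conflict y z \<Longrightarrow> revealed z t0 \<Longrightarrow> finished z wy"
    using winD[OF w(2)] by (auto simp: win_info_def)
  have wonx: "stt wy x = Won"
    using stat_decided[of "Suc wx" wy x] w by (auto simp: stat_Suc)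
  show ?thesis
  proof (cases "revealed x t0")
    case True
    with t0(3)[of x] assms wonx conflict_sym show ?thesis by (auto simp: finished_def)
  next
    case False
    obtain t0' where t0': "t0' \<le> wx" "revealed x t0'"
      "\<And>z. z \<noteq> x \<Longrightarrow> conflict x z \<Longrightarrow> revealed z t0' \<Longrightarrow> finished z wx"
      using winD[OF w(1)] by (auto simp: win_info_def)
    have "t0 \<le> t0'" using False t0'(2) revealed_mono by (metis nat_le_linear)
    then have "finished y wx" using t0'(3)[of y] assms(1,2) t0(2) revealed_mono by blast
    then have "stt wy y \<noteq> Active" using stat_decided[of wx wy y] w(3) by (auto simp: finished_def)
    with cas_result[OF w(2)] show ?thesis by simp
  qed
qed

text \<open>Thunks start only after the winning CAS, and by then the earlier of two conflicting
  winners has a completed run.\<close>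

lemma intervals_disjoint:
  assumes "x \<noteq> y" "conflict x y"
  shows "thunk_interval S \<omega> x \<inter> thunk_interval S \<omega> y = {}"
proof (rule ccontr)
  assume "thunk_interval S \<omega> x \<inter> thunk_interval S \<omega> y \<noteq> {}"
  then obtain t i j qi qj where t: "i \<le> t" "\<sigma> i = (qi, Ev (ThunkInv x))" "j \<le> t" "\<sigma> j = (qj, Ev (ThunkInv y))"
    and no: "\<not> occurs (ThunkResp x) t" "\<not> occurs (ThunkResp y) t"
    by (auto simp: thunk_interval_def occurs_def)
  obtain wx qx where wx: "wx < i" "\<sigma> wx = (qx, StatusCas x Active Won True)"
    using stat_changed[of i x] thunk_won[OF t(2)] by auto
  obtain wy qy where wy: "wy < j" "\<sigma> wy = (qy, StatusCas y Active Won True)"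
    using stat_changed[of j y] thunk_won[OF t(4)] by auto
  have "wx \<noteq> wy" using wx wy assms by auto
  then consider "wx < wy" | "wy < wx" by linarith
  then show False
  proof cases
    case 1
    then have "occurs (ThunkResp x) wy" using intervals_ordered[OF assms wx(2) wy(2)] by blast
    with no(1) wy t show False using occurs_mono by (metis le_trans less_imp_le)
  next
    case 2
    then have "occurs (ThunkResp y) wx"
      using intervals_ordered[OF _ _ wy(2) wx(2)] assms conflict_sym by blast
    with no(2) wx t show False using occurs_mono by (metis le_trans less_imp_le)
  qed
qed

lemma failed_no_run:
  assumes "\<sigma> t = (q, Ev (TryResp x False))"
  shows "\<sigma> i \<noteq> (q', Ev (ThunkInv x))"
proof
  assume "\<sigma> i = (q', Ev (ThunkInv x))"
  then have won: "stt i x = Won" by (rule thunk_won)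
  have lost: "stt t x \<noteq> Won" "stt t x \<noteq> Active"
    using response_finished[OF assms] by (auto simp: finished_def)
  have "stt t x = stt i x"
  proof (cases "i \<le> t")
    case True
    then show ?thesis by (rule stat_decided) (simp add: won)
  next
    case False
    then have "t \<le> i" by simp
    from stat_decided[OF this lost(2)] show ?thesis ..
  qed
  with won lost show False by simp
qed

text \<open>The \<open>y\<close> from \<open>loss_info\<close> is undecided at a time after the
  reveal of \<open>x\<close>, and \<open>x\<close> is undecided until its loss. If a timing
  condition of \<open>rival\<close> failed, one of the two would have been finished too
  early.\<close>

lemma failure_rival:
  assumes r: "reveal x r" and e: "\<sigma> e = (q, Ev (TryResp x False))"
  shows "\<exists>t. rival x r t \<and> \<omega> r \<le> \<omega> t"
proof -
  have "stt e x \<noteq> Won" "stt e x \<noteq> Active" using response_finished[OF e] by (auto simp: finished_def)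
  then have "stt e x = Lost" by (cases "stt e x") auto
  then obtain w qw where w: "w < e" "\<sigma> w = (qw, StatusCas x Active Lost True)"
    using stat_changed[of e x] by auto
  obtain y uy t1 where y: "y \<noteq> x" "conflict x y" "reveal y uy" "\<omega> r \<le> \<omega> uy" "r < t1" "t1 \<le> w" "uy < w"
    "stt t1 y = Active"
    using lossD[OF w(2)] r reveal_unique unfolding loss_info_def by blast
  have act: "stt w x = Active" using cas_result[OF w(2)] by simp
  have nf: "\<not> finished y u" if "u \<le> t1" for u
    using y(8) that stat_active by (auto simp: finished_def)
  have sx: "started x" "ident x < r" "\<sigma> r = (owner x, PriorityWrite x (\<omega> r))" using revealD[OF r] by auto
  have sy: "started y" "ident y < uy" "\<sigma> uy = (owner y, PriorityWrite y (\<omega> uy))" using revealD[OF y(3)] by auto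
  have 1: "uy \<noteq> r" using sx sy y(1) by auto
  \<comment> \<open>Otherwise \<open>x\<close> would have helped \<open>y\<close> to finish before
    its own reveal.\<close>
  have 2: "ident x < uy"
  proof (rule ccontr)
    assume "\<not> ident x < uy"
    moreover have "uy \<noteq> ident x" using sy started_TryInv[OF sx(1)] by auto
    ultimately have "uy < ident x" by simp
    with y(3) have "revealed y (ident x)" by (auto simp: revealed_def)
    with reveal_time(2)[OF r y(2)] nf[of r] y(5) show False by simp
  qed
  \<comment> \<open>Otherwise \<open>y\<close> would have helped \<open>x\<close> to finish by time
    \<open>uy\<close>, but \<open>x\<close> is undecided at \<open>w\<close>.\<close>
  have 3: "ident y < r"
  proof (rule ccontr)
    assume "\<not> ident y < r"
    moreover have "ident y \<noteq> r" using sx started_TryInv[OF sy(1)] by auto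
    ultimately have "r < ident y" by simp
    with r have "revealed x (ident y)" by (auto simp: revealed_def)
    with reveal_time(2)[OF y(3) conflict_sym[OF y(2)]] have "finished x uy" by blast
    then have "stt w x \<noteq> Active" using stat_decided[of uy w x] y(7) by (auto simp: finished_def)
    with act show False by simp
  qed
  \<comment> \<open>An attempt that has responded is decided, but \<open>y\<close> is not decided at
    \<open>t1\<close>.\<close>
  have 4: "\<not> (\<exists>j\<le>r. ident y < j \<and> sched S j = owner y \<and> taken y j = T0 S + T1 S)"
  proof
    assume "\<exists>j\<le>r. ident y < j \<and> sched S j = owner y \<and> taken y j = T0 S + T1 S"
    then obtain j d where j: "j \<le> r" "\<sigma> j = (owner y, Ev (TryResp y d))"
      using response_step[OF sy(1)] by metis
    then have "finished y j" using response_finished by blast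
    with nf[of j] j(1) y(5) show False by simp
  qed
  have "rival x r uy"
    unfolding rival_def using 1 2 3 4 sy y(2) reveal_time(1)[OF y(3)] step_at_sched[OF sy(3)] by blast
  with y(4) show ?thesis by blast
qed

text \<open>Rival times map injectively to descriptors, since a descriptor takes a step at count
  \<open>T0 S\<close> only once, and these descriptors are live at \<open>r\<close> on a lock of
  \<open>x\<close>. So is \<open>x\<close> itself, which is not among them; hence the
  \<open>Suc\<close>.\<close>

lemma rival_card:
  assumes r: "reveal x r"
  shows "finite {t. rival x r t}"
    and "lockList x \<noteq> [] \<Longrightarrow> Suc (card {t. rival x r t}) \<le> (\<Sum>l\<in>set (lockList x). k l)"
    and "lockList x = [] \<Longrightarrow> {t. rival x r t} = {}"
proof -
  have sx: "started x" "ident x < r" "\<sigma> r = (owner x, PriorityWrite x (\<omega> r))" using revealD[OF r] by auto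
  let ?U = "\<Union>l\<in>set (lockList x). live S \<omega> l r"
  define P where "P = (\<lambda>t y. started y \<and> conflict x y \<and> ident y < r \<and> ident y < t \<and>
     sched S t = owner y \<and> taken y t = T0 S \<and>
     \<not> (\<exists>j\<le>r. ident y < j \<and> sched S j = owner y \<and> taken y j = T0 S + T1 S))"
  define f where "f = (\<lambda>t. SOME y. P t y)"
  have f: "P t (f t)" if "rival x r t" for t
  proof -
    have "\<exists>y. P t y" using that unfolding rival_def P_def by blast
    then show ?thesis unfolding f_def by (rule someI_ex)
  qed
  have inj: "inj_on f {t. rival x r t}"
  proof (rule inj_onI)
    fix t t' assume t: "t \<in> {t. rival x r t}" "t' \<in> {t. rival x r t}" "f t = f t'"
    then have "P t (f t)" "P t' (f t)" using f[of t] f[of t'] by simp_all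
    then show "t = t'" using taken_strict[of "f t" t t'] taken_strict[of "f t" t' t]
      by (auto simp: P_def) (metis less_irrefl linorder_neqE_nat nat_less_le)
  qed
  have img: "f ` {t. rival x r t} \<subseteq> ?U - {x}"
  proof
    fix y assume "y \<in> f ` {t. rival x r t}"
    then obtain t where t: "rival x r t" "P t y" using f by auto
    have "y \<noteq> x"
    proof
      assume "y = x"
      with t(2) reveal_time(1)[OF r] step_at_sched[OF sx(3)] sx(2) have "t = r"
        using taken_strict[of x t r] taken_strict[of x r t]
        by (auto simp: P_def) (metis less_irrefl linorder_neqE_nat nat_less_le)
      with t(1) show False by (simp add: rival_def)
    qed
    moreover obtain l where l: "l \<in> set (lockList x)" "l \<in> set (lockList y)"
      using t(2) by (auto simp: P_def conflict_def)
    have "y \<in> live S \<omega> l r"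
    proof -
      have "\<sigma> j \<noteq> (q, Ev (TryResp y d))" if "j \<le> r" for j q d
        using TryRespD[of j q y d] response_time[of j q y d] step_at_sched[of j q] t(2) that
        by (auto simp: P_def)
      moreover have "\<sigma> (ident y) = (owner y, Ev (TryInv y))" "ident y \<le> r"
        using started_TryInv t(2) by (auto simp: P_def)
      ultimately show ?thesis using l(2) unfolding live_def by blast
    qed
    ultimately show "y \<in> ?U - {x}" using l(1) by blast
  qed
  have finU: "finite ?U" by (simp add: finite_live)
  from finite_subset[OF img] finU have fin: "finite (f ` {t. rival x r t})" by simp
  with inj show "finite {t. rival x r t}" by (simp add: finite_image_iff)
  have xU: "x \<in> ?U" if ne: "lockList x \<noteq> []"
  proof -
    obtain l where l: "l \<in> set (lockList x)" using ne by (cases "lockList x") auto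
    have "\<sigma> j \<noteq> (q, Ev (TryResp x d))" if "j \<le> r" for j q d
      using response_time[of j q x d] reveal_time(1)[OF r] taken_mono[OF that, of x] T1 by auto
    moreover have "\<sigma> (ident x) = (owner x, Ev (TryInv x))" "ident x \<le> r"
      using started_TryInv sx by auto
    ultimately have "x \<in> live S \<omega> l r" using l unfolding live_def by blast
    with l show ?thesis by blast
  qed
  show "Suc (card {t. rival x r t}) \<le> (\<Sum>l\<in>set (lockList x). k l)" if "lockList x \<noteq> []"
  proof -
    have "card {t. rival x r t} = card (f ` {t. rival x r t})" by (rule card_image[OF inj, symmetric])
    also have "\<dots> \<le> card (?U - {x})" by (rule card_mono) (use finU img in auto)
    also have "Suc \<dots> = card ?U" by (rule card_Suc_Diff1[OF finU xU[OF that]])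
    also have "\<dots> \<le> (\<Sum>l\<in>set (lockList x). card (live S \<omega> l r))" by (rule card_UN_le) simp
    also have "\<dots> \<le> (\<Sum>l\<in>set (lockList x). k l)" by (rule sum_mono) (rule contention)
    finally show ?thesis by simp
  qed
  show "{t. rival x r t} = {}" if "lockList x = []"
    using that by (auto simp: rival_def conflict_def)
qed

end

section \<open>Measurability\<close>

lemma exec_cong: "(\<And>i. i < t \<Longrightarrow> \<omega> i = \<omega>' i) \<Longrightarrow> exec S \<omega> t = exec S \<omega>' t"
proof (induction t)
  case (Suc t)
  then have "exec S \<omega> t = exec S \<omega>' t" "\<omega> t = \<omega>' t" by auto
  then show ?case by simp
qed simp

lemma started_cong:
  assumes "\<And>i. i < ident x \<Longrightarrow> \<omega> i = \<omega>' i"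
  shows "execution.started S \<omega> x = execution.started S \<omega>' x"
  using exec_cong[of "ident x" \<omega> \<omega>' S] assms
  by (simp add: execution.started_def config_at_def hist_def)

lemma rival_cong:
  assumes "\<And>i. i < r \<Longrightarrow> i < t \<Longrightarrow> \<omega> i = \<omega>' i"
  shows "execution.rival S \<omega> x r t = execution.rival S \<omega>' x r t"
proof -
  have "execution.started S \<omega> y = execution.started S \<omega>' y" if "ident y < r" "ident y < t" for y
    by (rule started_cong) (use that assms in auto)
  then show ?thesis unfolding execution.rival_def by blast
qed

text \<open>
  Programs use priorities only by comparing them with each other and with 0.  Hence an order
  isomorphism \<open>V\<close> between the priorities of two executions preserves everything but their values.
\<close>

inductive similar :: "(real \<Rightarrow> real \<Rightarrow> bool) \<Rightarrow> 'a prog \<Rightarrow> 'a prog \<Rightarrow> bool"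
  for V :: "real \<Rightarrow> real \<Rightarrow> bool" where
  "similar V (Return a) (Return a)"
| "(\<And>v w. V v w \<Longrightarrow> similar V (f v) (g w)) \<Longrightarrow> similar V (ReadPriority p f) (ReadPriority p g)"
| "V v w \<Longrightarrow> similar V r r' \<Longrightarrow> similar V (WritePriority p v r) (WritePriority p w r')"
| "similar V r r' \<Longrightarrow> similar V (RandomPriority p r) (RandomPriority p r')"
| "(\<And>s. similar V (h s) (h' s)) \<Longrightarrow> similar V (ReadStatus p h) (ReadStatus p h')"
| "(\<And>d. similar V (i d) (i' d)) \<Longrightarrow> similar V (CasStatus p x y i) (CasStatus p x y i')"
| "(\<And>v. similar V (j v) (j' v)) \<Longrightarrow> similar V (Read R a j) (Read R a j')"
| "similar V r r' \<Longrightarrow> similar V (Write R a b r) (Write R a b r')"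
| "(\<And>d. similar V (i d) (i' d)) \<Longrightarrow> similar V (Cas R a b c i) (Cas R a b c i')"
| "similar V r r' \<Longrightarrow> similar V (Event e r) (Event e r')"
| "similar V r r' \<Longrightarrow> similar V (DelayUntil n r) (DelayUntil n r')"

lemma similar_bind:
  "similar V r r' \<Longrightarrow> (\<And>a. similar V (g a) (g' a)) \<Longrightarrow> similar V (bind_prog r g) (bind_prog r' g')"
  by (induction rule: similar.induct) (auto intro: similar.intros)

lemma similar_for_each: "(\<And>x. similar V (f x) (f x)) \<Longrightarrow> similar V (for_each xs f) (for_each xs f)"
  by (induction xs) (auto intro: similar.intros similar_bind)

lemma similar_exec_code: "similar V (exec_code R d) (exec_code R d)"
  by (induction d) (auto intro: similar.intros)

lemma similar_Return: "similar V r r' \<Longrightarrow> r = Return a \<longleftrightarrow> r' = Return a"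
  by (erule similar.cases) auto

text \<open>The assumptions match all uses of priority values in the code: the constant -1 written
  by clearing, positivity in \<open>getFlag\<close>, and the comparison in
  \<open>compete\<close>.\<close>

locale order_relation =
  fixes V :: "real \<Rightarrow> real \<Rightarrow> bool"
  assumes minus_one: "V (- 1) (- 1)"
    and positive: "V v w \<Longrightarrow> 0 < v \<longleftrightarrow> 0 < w"
    and less: "V v w \<Longrightarrow> V v' w' \<Longrightarrow> v < v' \<longleftrightarrow> w < w'"
begin

lemma similar_flagged: "similar V (flagged xs) (flagged xs)"
  using positive by (induction xs) (auto simp: getFlag_def intro!: similar.intros similar_bind)

lemma similar_getSet: "similar V (getSet S l) (getSet S l)"
  unfolding getSet_def raw_getSet_def
  by (auto intro!: similar.intros similar_bind similar_exec_code similar_flagged)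

lemma similar_celebrate: "similar V (celebrateIfWon S p) (celebrateIfWon S p)"
  unfolding celebrateIfWon_def run_thunk_def
  by (auto intro!: similar.intros similar_bind similar_exec_code)

lemma similar_compete: "similar V (compete p p') (compete p p')"
proof -
  have e: "similar V (eliminate z) (eliminate z)" for z
    unfolding eliminate_def by (auto intro!: similar.intros)
  show ?thesis
    unfolding compete_def using less by (auto intro!: similar.intros e)
qed

lemma similar_run: "similar V (run S p) (run S p)"
  unfolding run_def decide_def
  by (auto intro!: similar.intros similar_bind similar_for_each similar_getSet similar_compete similar_celebrate)

lemma similar_tryLocks: "similar V (tryLocks S p) (tryLocks S p)"
  unfolding tryLocks_def multiInsert_def multiRemove_def clearFlag_def setFlag_def
    lock_insert_def lock_remove_def
  using minus_one
  by (auto intro!: similar.intros similar_bind similar_for_each similar_getSet similar_run similar_exec_code)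

definition similar_memory :: "memory \<Rightarrow> memory \<Rightarrow> bool" where
  "similar_memory m m' \<longleftrightarrow> stat m = stat m' \<and> word m = word m' \<and> (\<forall>p. V (priority m p) (priority m' p))"

definition similar_state :: "proc_state \<Rightarrow> proc_state \<Rightarrow> bool" where
  "similar_state a a' \<longleftrightarrow> (a = Idle \<and> a' = Idle) \<or>
     (\<exists>r r' n. a = Busy r n \<and> a' = Busy r' n \<and> similar V r r')"

definition similar_config :: "config \<Rightarrow> config \<Rightarrow> bool" where
  "similar_config c c' \<longleftrightarrow> similar_memory (shared c) (shared c') \<and>
     (\<forall>q. similar_state (local c q) (local c' q))"

text \<open>Only events are compared, since labels of priority accesses carry the differing
  values.\<close>

definition similar_label :: "label \<Rightarrow> label \<Rightarrow> bool" where
  "similar_label l l' \<longleftrightarrow> (\<forall>e. l = Ev e \<longleftrightarrow> l' = Ev e)"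

lemma similar_prog_step:
  assumes "similar V r r'" "V u u'" "similar_memory m m'"
  shows "prog_step u n m r = (l, m1, r1) \<Longrightarrow> prog_step u' n m' r' = (l', m1', r1') \<Longrightarrow>
    similar_label l l' \<and> similar_memory m1 m1' \<and> similar V r1 r1'"
  using assms
proof (induction arbitrary: l m1 r1 l' m1' r1' rule: similar.induct)
  case (11 r r' k)
  then show ?case by (auto split: if_splits simp: similar_label_def intro: similar.intros)
qed (auto simp: similar_label_def similar_memory_def Let_def intro: similar.intros)

lemma similar_system_step:
  assumes c: "similar_config c c'" and V: "V u u'"
    and pl: "player S h (sched S t) = player S h' (sched S t)"
    and s: "system_step S t u h c = (l, c1)" "system_step S t u' h' c' = (l', c1')"
  shows "similar_label l l' \<and> similar_config c1 c1'"
proof (cases "local c (sched S t)")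
  case Idle
  then have Idle': "local c' (sched S t) = Idle"
    using c by (force simp: similar_config_def similar_state_def)
  have "similar_state (Busy (tryLocks S p) 1) (Busy (tryLocks S p) 1)" for p
    by (auto simp: similar_state_def similar_tryLocks)
  then show ?thesis
    using Idle Idle' c pl s
    by (auto simp: system_step_def Let_def similar_config_def similar_label_def split: option.splits)
next
  case (Busy r n)
  then obtain r' where Busy': "local c' (sched S t) = Busy r' n" and r: "similar V r r'"
  proof -
    have "similar_state (local c (sched S t)) (local c' (sched S t))"
      using c by (simp add: similar_config_def)
    with Busy that show ?thesis by (auto simp: similar_state_def)
  qed
  obtain k m r1 where st: "prog_step u n (shared c) r = (k, m, r1)" by (metis prod_cases3)
  obtain k' m' r1' where st': "prog_step u' n (shared c') r' = (k', m', r1')" by (metis prod_cases3)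
  have "similar_memory (shared c) (shared c')" using c by (simp add: similar_config_def)
  from similar_prog_step[OF r V this st st']
  have sim: "similar_label k k'" "similar_memory m m'" "similar V r1 r1'" by auto
  have "similar_state (if r1 = Return () then Idle else Busy r1 (Suc n))
     (if r1' = Return () then Idle else Busy r1' (Suc n))"
    using similar_Return[OF sim(3)] sim(3) by (auto simp: similar_state_def)
  then show ?thesis
    using Busy Busy' st st' sim s c by (auto simp: system_step_def similar_config_def)
qed

end

section \<open>Countable codes of executions\<close>

definition trace_code :: "system \<Rightarrow> nat \<Rightarrow> (nat \<Rightarrow> real) \<Rightarrow> (lock list \<times> nat) option list \<times> bool list" where
  "trace_code S n \<omega> = (map (\<lambda>i. player S (hist S \<omega> i) (sched S i)) [0..<n],
     map (\<lambda>(i, j). \<omega> i < \<omega> j) (List.product [0..<n] [0..<n]))"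

text \<open>The history shows priority values to the player, so equal order patterns alone would not
  force equal answers; the code therefore records the answers too. Given both, the executions run in
  lockstep by induction on time.\<close>

lemma trace_code_similar:
  assumes code: "trace_code S n \<omega> = trace_code S n \<omega>'"
    and pos: "\<And>i. 0 < \<omega> i" "\<And>i. 0 < \<omega>' i" and "t \<le> n"
  shows "t < n \<Longrightarrow> step_at S \<omega> t = (q, Ev e) \<longleftrightarrow> step_at S \<omega>' t = (q, Ev e)"
    and "local (config_at S \<omega> t) q = Idle \<longleftrightarrow> local (config_at S \<omega>' t) q = Idle"
proof -
  \<comment> \<open>Pairs draws of equal time, and -1 with itself; equality of the order patterns
    makes this an order isomorphism.\<close>
  define V where "V = (\<lambda>v w. (v = -1 \<and> w = -1) \<or> (\<exists>i<n. v = \<omega> i \<and> w = \<omega>' i))"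
  have lt: "\<omega> i < \<omega> j \<longleftrightarrow> \<omega>' i < \<omega>' j" if "i < n" "j < n" for i j
  proof -
    from code have "map (\<lambda>(i, j). \<omega> i < \<omega> j) (List.product [0..<n] [0..<n]) =
       map (\<lambda>(i, j). \<omega>' i < \<omega>' j) (List.product [0..<n] [0..<n])" by (simp add: trace_code_def)
    moreover have "(i, j) \<in> set (List.product [0..<n] [0..<n])" using that by auto
    ultimately show ?thesis unfolding map_eq_conv by blast
  qed
  have pl: "player S (hist S \<omega> i) (sched S i) = player S (hist S \<omega>' i) (sched S i)" if "i < n" for i
    using code that by (auto simp: trace_code_def)
  have neg: "\<not> \<omega> i \<le> -1" "\<not> \<omega>' i \<le> -1" "\<not> \<omega> i < -1" "\<not> \<omega>' i < -1" "-1 < \<omega> i" "-1 < \<omega>' i" for i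
    using pos[of i] by linarith+
  interpret order_relation V
    by unfold_locales (use pos lt neg in \<open>auto simp: V_def\<close>)
  have step: "similar_label (snd (step_at S \<omega> i)) (snd (step_at S \<omega>' i)) \<and>
     similar_config (config_at S \<omega> (Suc i)) (config_at S \<omega>' (Suc i))"
    if "i < n" "similar_config (config_at S \<omega> i) (config_at S \<omega>' i)" for i
    unfolding execution.step_at_eq execution.config_Suc snd_conv
    by (rule similar_system_step[OF that(2) _ pl[OF that(1)] surjective_pairing surjective_pairing])
      (use that in \<open>auto simp: V_def\<close>)
  have conf: "similar_config (config_at S \<omega> i) (config_at S \<omega>' i)" if "i \<le> n" for i
    using that
  proof (induction i)
    case 0
    have "similar_config (init_config S) (init_config S)"
      using minus_one
      by (simp add: similar_config_def init_config_def similar_memory_def similar_state_def)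
    then show ?case by (simp add: config_at_def)
  next
    case (Suc i)
    with step[of i] show ?case by simp
  qed
  show "step_at S \<omega> t = (q, Ev e) \<longleftrightarrow> step_at S \<omega>' t = (q, Ev e)" if "t < n"
    using step[OF that conf] that execution.fst_step_at[of S \<omega> t] execution.fst_step_at[of S \<omega>' t]
    by (cases "step_at S \<omega> t"; cases "step_at S \<omega>' t") (auto simp: similar_label_def)
  show "local (config_at S \<omega> t) q = Idle \<longleftrightarrow> local (config_at S \<omega>' t) q = Idle"
    using conf[OF assms(4)] by (force simp: similar_config_def similar_state_def)
qed

lemma trace_code_started:
  assumes "trace_code S n \<omega> = trace_code S n \<omega>'" "\<And>i. 0 < \<omega> i" "\<And>i. 0 < \<omega>' i" "ident x < n"
  shows "execution.started S \<omega> x \<longleftrightarrow> execution.started S \<omega>' x"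
proof -
  have "player S (hist S \<omega> (ident x)) (sched S (ident x)) = player S (hist S \<omega>' (ident x)) (sched S (ident x))"
    using assms(1,4) by (auto simp: trace_code_def)
  with trace_code_similar(2)[OF assms(1-3), of "ident x"] assms(4) show ?thesis
    by (auto simp: execution.started_def execution.owner_def)
qed

lemma space_priorities: "space priorities = {\<omega>. \<forall>t. 0 < \<omega> t \<and> \<omega> t < 1}"
  by (auto simp: priorities_def space_PiM space_restrict_space PiE_def)

lemma measurable_map_list:
  fixes f :: "'i \<Rightarrow> 'a \<Rightarrow> 'b :: countable"
  assumes "\<And>i. i \<in> set is \<Longrightarrow> f i \<in> M \<rightarrow>\<^sub>M count_space UNIV"
  shows "(\<lambda>x. map (\<lambda>i. f i x) is) \<in> M \<rightarrow>\<^sub>M count_space UNIV"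
  using assms
proof (induction "is")
  case (Cons i js)
  have "(\<lambda>x. a # map (\<lambda>i. f i x) js) \<in> M \<rightarrow>\<^sub>M count_space UNIV" for a
    by (rule measurable_compose[of _ M "count_space UNIV" "(#) a"]) (use Cons in auto)
  from measurable_compose_countable[OF this, of "f i"] Cons show ?case by simp
qed simp

lemma measurable_coordinate: "(\<lambda>\<omega>. \<omega> t) \<in> priorities \<rightarrow>\<^sub>M borel"
proof -
  have "(\<lambda>\<omega>. \<omega> t) \<in> priorities \<rightarrow>\<^sub>M restrict_space lborel {0<..<1}"
    unfolding priorities_def by (rule measurable_component_singleton) simp
  then show ?thesis by (simp add: measurable_restrict_space2_iff)
qed

text \<open>By \<open>sat\<close> the set is a union of fibres of the code, hence the preimage of a
  set of codes, and the code is a measurable map into a countable discrete space.\<close>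

lemma trace_code_sets:
  assumes "measurable_player S"
    and sat: "\<And>\<omega> \<omega>'. \<omega> \<in> space priorities \<Longrightarrow> \<omega>' \<in> space priorities \<Longrightarrow>
      trace_code S n \<omega> = trace_code S n \<omega>' \<Longrightarrow> P \<omega> \<Longrightarrow> P \<omega>'"
  shows "{\<omega> \<in> space priorities. P \<omega>} \<in> sets priorities"
proof -
  have 1: "(\<lambda>\<omega>. map (\<lambda>i. player S (hist S \<omega> i) (sched S i)) [0..<n]) \<in> priorities \<rightarrow>\<^sub>M count_space UNIV"
    by (rule measurable_map_list) (use assms(1) in \<open>auto simp: measurable_player_def\<close>)
  have "(\<lambda>\<omega>. map (\<lambda>p. \<omega> (fst p) < \<omega> (snd p)) (List.product [0..<n] [0..<n])) \<in> priorities \<rightarrow>\<^sub>M count_space UNIV"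
    by (rule measurable_map_list) (auto intro!: borel_measurable_pred_less measurable_coordinate)
  then have 2: "(\<lambda>\<omega>. map (\<lambda>(i, j). \<omega> i < \<omega> j) (List.product [0..<n] [0..<n])) \<in> priorities \<rightarrow>\<^sub>M count_space UNIV"
    by (simp add: case_prod_beta')
  have "(\<lambda>\<omega>. (a, map (\<lambda>(i, j). \<omega> i < \<omega> j) (List.product [0..<n] [0..<n]))) \<in> priorities \<rightarrow>\<^sub>M count_space UNIV"
    for a :: "(lock list \<times> nat) option list"
    by (rule measurable_compose[OF 2]) simp
  from measurable_compose_countable[OF this 1]
  have "trace_code S n \<in> priorities \<rightarrow>\<^sub>M count_space UNIV" by (simp add: trace_code_def[abs_def])
  then have "trace_code S n -` (trace_code S n ` {\<omega> \<in> space priorities. P \<omega>}) \<inter> space priorities \<in> sets priorities"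
    by (rule measurable_sets) simp
  also have "trace_code S n -` (trace_code S n ` {\<omega> \<in> space priorities. P \<omega>}) \<inter> space priorities =
     {\<omega> \<in> space priorities. P \<omega>}"
  proof (intro set_eqI iffI)
    fix \<omega> assume "\<omega> \<in> trace_code S n -` (trace_code S n ` {\<omega> \<in> space priorities. P \<omega>}) \<inter> space priorities"
    then obtain \<omega>' where "\<omega> \<in> space priorities" "\<omega>' \<in> space priorities" "P \<omega>'"
      "trace_code S n \<omega>' = trace_code S n \<omega>" by auto
    with sat[of \<omega>' \<omega>] show "\<omega> \<in> {\<omega> \<in> space priorities. P \<omega>}" by simp
  qed simp
  finally show ?thesis .
qed

section \<open>Predictable selection of independent priorities\<close>

definition uniform :: "real measure" where
  "uniform = restrict_space lborel {0<..<1}"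

lemma priorities_eq: "priorities = (\<Pi>\<^sub>M t\<in>(UNIV :: nat set). uniform)"
  by (simp add: priorities_def uniform_def)

interpretation U: prob_space uniform
  unfolding uniform_def by (rule prob_space_restrict_space) auto

interpretation product: product_prob_space "\<lambda>_. uniform" "UNIV :: nat set"
  by unfold_locales

interpretation priorities: prob_space priorities
  unfolding priorities_eq by (rule prob_space_PiM) (rule U.prob_space_axioms)

text \<open>The endpoints are null sets; the closed interval suits the fundamental theorem of
  calculus.\<close>

lemma nn_integral_uniform:
  "f \<in> borel_measurable borel \<Longrightarrow>
    (\<integral>\<^sup>+x. f x \<partial>uniform) = (\<integral>\<^sup>+x. f x * indicator {0..1} x \<partial>lborel)"
proof -
  assume f: "f \<in> borel_measurable borel"
  have "(\<integral>\<^sup>+x. f x \<partial>uniform) = (\<integral>\<^sup>+x. f x * indicator {0<..<1} x \<partial>lborel)"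
    unfolding uniform_def by (rule nn_integral_restrict_space) simp
  also have "\<dots> = (\<integral>\<^sup>+x. f x * indicator {0..1} x \<partial>lborel)"
  proof (rule nn_integral_cong_AE)
    show "AE x in lborel. f x * indicator {0<..<1} x = f x * indicator {0..1} x"
      using AE_lborel_singleton[of "0::real"] AE_lborel_singleton[of "1::real"]
      by eventually_elim (auto simp: indicator_def)
  qed
  finally show ?thesis .
qed

lemma measurable_uniform: "f \<in> borel_measurable borel \<Longrightarrow> f \<in> borel_measurable uniform"
  unfolding uniform_def by (rule measurable_restrict_space1) simp

text \<open>The source of the bound 1 / C_p: the chance that a uniform value exceeds
  \<open>m\<close> independent others.\<close>

lemma uniform_power: "(\<integral>\<^sup>+x. ennreal (x ^ m) \<partial>uniform) = ennreal (1 / (real m + 1))"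
proof -
  have "(\<integral>\<^sup>+x. ennreal (x ^ m) \<partial>uniform) = (\<integral>\<^sup>+x. ennreal (x ^ m) * indicator {0..1} x \<partial>lborel)"
    by (rule nn_integral_uniform) simp
  also have "\<dots> = ennreal (1 ^ Suc m / real (Suc m) - 0 ^ Suc m / real (Suc m))"
    by (rule nn_integral_FTC_Icc)
      (auto intro!: derivative_eq_intros, cases m, auto simp: field_simps)
  finally show ?thesis by (simp add: add.commute)
qed

lemma uniform_less: "0 \<le> c \<Longrightarrow> c \<le> 1 \<Longrightarrow> (\<integral>\<^sup>+x. indicator {..<c} x \<partial>uniform) = ennreal c"
proof -
  assume c: "0 \<le> c" "c \<le> 1"
  have "(\<integral>\<^sup>+x. indicator {..<c} x \<partial>uniform) = (\<integral>\<^sup>+x. indicator {..<c} x * indicator {0..1} x \<partial>lborel)"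
    by (rule nn_integral_uniform) simp
  also have "\<dots> = (\<integral>\<^sup>+x. indicator {0..<c} x \<partial>lborel)"
    by (rule nn_integral_cong) (use c in \<open>auto simp: indicator_def\<close>)
  also have "\<dots> = ennreal c" using c by simp
  finally show ?thesis .
qed

section \<open>Redrawing one coordinate or a whole tail\<close>

lemma measurable_into_priorities:
  "(\<And>t. (\<lambda>x. f x t) \<in> M \<rightarrow>\<^sub>M uniform) \<Longrightarrow> f \<in> M \<rightarrow>\<^sub>M priorities"
  unfolding priorities_eq by (rule measurable_PiM_single') (auto simp: measurable_def)

lemma measurable_coordinate_uniform [measurable]: "(\<lambda>\<omega>. \<omega> t) \<in> priorities \<rightarrow>\<^sub>M uniform"
  unfolding priorities_eq by (rule measurable_component_singleton) simp

lemma measurable_update: "(\<lambda>p. (snd p)(t := fst p)) \<in> uniform \<Otimes>\<^sub>M priorities \<rightarrow>\<^sub>M priorities"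
proof (rule measurable_into_priorities)
  fix i
  show "(\<lambda>p. ((snd p)(t := fst p)) i) \<in> uniform \<Otimes>\<^sub>M priorities \<rightarrow>\<^sub>M uniform"
    by (cases "i = t") (auto intro!: measurable_compose[OF measurable_snd])
qed

text \<open>Fubini for a single coordinate: replacing it by an independent draw leaves the product
  measure unchanged.\<close>

lemma resample:
  assumes f: "f \<in> borel_measurable priorities"
  shows "(\<integral>\<^sup>+\<omega>. f \<omega> \<partial>priorities) = (\<integral>\<^sup>+\<omega>. (\<integral>\<^sup>+x. f (fun_upd \<omega> t x) \<partial>uniform) \<partial>priorities)"
proof -
  interpret pair_sigma_finite uniform priorities by unfold_locales
  have "distr (uniform \<Otimes>\<^sub>M priorities) priorities (\<lambda>p. (snd p)(t := fst p)) = priorities"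
    using distr_pair_PiM_eq_PiM[of UNIV "\<lambda>_. uniform" t] U.prob_space_axioms
    by (simp add: priorities_eq case_prod_beta')
  then have "(\<integral>\<^sup>+\<omega>. f \<omega> \<partial>priorities) = (\<integral>\<^sup>+p. f ((snd p)(t := fst p)) \<partial>(uniform \<Otimes>\<^sub>M priorities))"
    using nn_integral_distr[OF measurable_update, of f t] f by simp
  also have "\<dots> = (\<integral>\<^sup>+\<omega>. (\<integral>\<^sup>+x. f (fun_upd \<omega> t x) \<partial>uniform) \<partial>priorities)"
    using nn_integral_snd[of "\<lambda>p. f ((snd p)(t := fst p))"] measurable_compose[OF measurable_update f]
    by simp
  finally show ?thesis .
qed

lemma measurable_resume2: "(\<lambda>p. resume n (fst p) (snd p)) \<in> priorities \<Otimes>\<^sub>M priorities \<rightarrow>\<^sub>M priorities"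
proof (rule measurable_into_priorities)
  fix i
  show "(\<lambda>p. resume n (fst p) (snd p) i) \<in> priorities \<Otimes>\<^sub>M priorities \<rightarrow>\<^sub>M uniform"
    unfolding resume_def by (cases "i < n") simp_all
qed

lemma measurable_resume:
  assumes "\<omega> \<in> space priorities"
  shows "resume n \<omega> \<in> priorities \<rightarrow>\<^sub>M priorities"
  using measurable_compose[OF measurable_Pair1'[OF assms, of priorities] measurable_resume2] by simp

text \<open>The tower rule for conditioning on the draws before \<open>n\<close>. The law of
  \<open>resume\<close> is the product measure because the two agree on finite-dimensional
  rectangles, whose factors below \<open>n\<close> come from the first sample and the others from
  the second.\<close>

lemma resume_integral:
  assumes f: "f \<in> borel_measurable priorities"
  shows "(\<integral>\<^sup>+\<omega>. f \<omega> \<partial>priorities) = (\<integral>\<^sup>+\<omega>. (\<integral>\<^sup>+\<omega>'. f (resume n \<omega> \<omega>') \<partial>priorities) \<partial>priorities)"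
proof -
  interpret pair_sigma_finite priorities priorities by unfold_locales
  let ?D = "distr (priorities \<Otimes>\<^sub>M priorities) priorities (\<lambda>p. resume n (fst p) (snd p))"
  have "?D = PiM UNIV (\<lambda>_. uniform)"
  proof (rule product.PiM_eq)
    show "sets ?D = sets (PiM UNIV (\<lambda>_. uniform))" by (simp add: priorities_eq)
    fix J and F :: "nat \<Rightarrow> real set" assume J: "finite J" "\<And>j. j \<in> J \<Longrightarrow> F j \<in> sets uniform"
    let ?E = "\<lambda>J. {\<omega> \<in> space priorities. \<forall>j\<in>J. \<omega> j \<in> F j}"
    let ?J1 = "{j\<in>J. j < n}" and ?J2 = "{j\<in>J. \<not> j < n}"
    have emb: "prod_emb UNIV (\<lambda>_. uniform) J (\<Pi>\<^sub>E j\<in>J. F j) = ?E J"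
      unfolding priorities_eq
      by (auto simp: prod_emb_def space_PiM restrict_PiE_iff PiE_iff)
    have E: "emeasure priorities (?E J') = (\<Prod>j\<in>J'. emeasure uniform (F j))" if "J' \<subseteq> J" for J'
      unfolding priorities_eq
      by (rule product.emeasure_PiM_Collect) (use J that in \<open>auto intro: finite_subset\<close>)
    have sets: "?E J' \<in> sets priorities" if "J' \<subseteq> J" for J'
      using J that finite_subset[OF that J(1)] by (intro sets.sets_Collect_finite_All) (auto intro!: measurable_sets_Collect[OF measurable_coordinate_uniform])
    have cut: "(\<lambda>p. resume n (fst p) (snd p)) -` ?E J \<inter> space (priorities \<Otimes>\<^sub>M priorities) = ?E ?J1 \<times> ?E ?J2"
    proof (rule set_eqI, rule iffI)
      fix p assume "p \<in> (\<lambda>p. resume n (fst p) (snd p)) -` ?E J \<inter> space (priorities \<Otimes>\<^sub>M priorities)"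
      then have p: "\<And>j. j \<in> J \<Longrightarrow> resume n (fst p) (snd p) j \<in> F j"
        "fst p \<in> space priorities" "snd p \<in> space priorities"
        by (auto simp: space_pair_measure)
      have "fst p j \<in> F j" if "j \<in> J" "j < n" for j using p(1)[of j] that by (simp add: resume_def)
      moreover have "snd p j \<in> F j" if "j \<in> J" "\<not> j < n" for j
        using p(1)[of j] that by (simp add: resume_def)
      ultimately show "p \<in> ?E ?J1 \<times> ?E ?J2" using p(2,3) by (simp add: mem_Times_iff)
    next
      fix p assume p: "p \<in> ?E ?J1 \<times> ?E ?J2"
      then have sp: "p \<in> space (priorities \<Otimes>\<^sub>M priorities)"
        by (simp add: space_pair_measure mem_Times_iff)
      have "resume n (fst p) (snd p) j \<in> F j" if "j \<in> J" for j
        using p that by (simp add: resume_def mem_Times_iff)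
      with sp measurable_space[OF measurable_resume2 sp]
      show "p \<in> (\<lambda>p. resume n (fst p) (snd p)) -` ?E J \<inter> space (priorities \<Otimes>\<^sub>M priorities)"
        by simp
    qed
    have "emeasure ?D (prod_emb UNIV (\<lambda>_. uniform) J (\<Pi>\<^sub>E j\<in>J. F j)) =
       emeasure (priorities \<Otimes>\<^sub>M priorities) (?E ?J1 \<times> ?E ?J2)"
      unfolding emb cut[symmetric] by (rule emeasure_distr[OF measurable_resume2 sets]) simp
    also have "\<dots> = emeasure priorities (?E ?J1) * emeasure priorities (?E ?J2)"
      by (rule priorities.emeasure_pair_measure_Times[OF sets sets]) auto
    also have "\<dots> = (\<Prod>j\<in>?J1. emeasure uniform (F j)) * (\<Prod>j\<in>?J2. emeasure uniform (F j))"
      using E[of ?J1] E[of ?J2] by (simp only: Collect_subset)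
    also have "\<dots> = (\<Prod>j\<in>?J1 \<union> ?J2. emeasure uniform (F j))"
      by (rule prod.union_disjoint[symmetric]) (use J in auto)
    also have "\<dots> = (\<Prod>j\<in>J. emeasure uniform (F j))" by (rule prod.cong) auto
    finally show "emeasure ?D (prod_emb UNIV (\<lambda>_. uniform) J (\<Pi>\<^sub>E j\<in>J. F j)) =
       (\<Prod>j\<in>J. emeasure uniform (F j))" .
  qed
  then have "(\<integral>\<^sup>+\<omega>. f \<omega> \<partial>priorities) = (\<integral>\<^sup>+\<omega>. f \<omega> \<partial>?D)" by (simp add: priorities_eq)
  also have "\<dots> = (\<integral>\<^sup>+p. f (resume n (fst p) (snd p)) \<partial>(priorities \<Otimes>\<^sub>M priorities))"
    by (rule nn_integral_distr[OF measurable_resume2]) (use f in simp)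
  also have "\<dots> = (\<integral>\<^sup>+\<omega>. (\<integral>\<^sup>+\<omega>'. f (resume n \<omega> \<omega>') \<partial>priorities) \<partial>priorities)"
    using priorities.nn_integral_fst[of "\<lambda>p. f (resume n (fst p) (snd p))" priorities]
      measurable_compose[OF measurable_resume2 f] by simp
  finally show ?thesis .
qed

text \<open>
  The adversary selects at most \<open>m\<close> times whose values compete with the value at time \<open>r\<close>, each
  without knowing the selected value.  Given the value \<open>x\<close> at \<open>r\<close>, weighting each won comparison by
  \<open>1 / x\<close> yields a martingale, so the product of all weights has expectation 1.
\<close>

lemma selection:
  fixes D :: "nat \<Rightarrow> (nat \<Rightarrow> real) \<Rightarrow> bool" and m r N :: nat
  assumes meas: "\<And>t. {\<omega> \<in> space priorities. D t \<omega>} \<in> sets priorities"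
    and dep: "\<And>t \<omega> \<omega>'. (\<And>i. i < r \<Longrightarrow> i < t \<Longrightarrow> \<omega> i = \<omega>' i) \<Longrightarrow> D t \<omega> = D t \<omega>'"
    and irr: "\<And>\<omega>. \<not> D r \<omega>"
    and bound: "\<And>t \<omega>. D t \<omega> \<Longrightarrow> t < N"
    and card: "\<And>\<omega>. \<omega> \<in> space priorities \<Longrightarrow> card {t. D t \<omega>} \<le> m"
  shows "{\<omega> \<in> space priorities. \<forall>t. D t \<omega> \<longrightarrow> \<omega> t < \<omega> r} \<in> sets priorities" (is "?A \<in> _")
    and "1 / (real m + 1) \<le> measure priorities {\<omega> \<in> space priorities. \<forall>t. D t \<omega> \<longrightarrow> \<omega> t < \<omega> r}"
proof -
  have D [measurable]: "Measurable.pred priorities (D t)" for t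
    using meas[of t] by (simp add: pred_def)
  have co [measurable]: "(\<lambda>\<omega>. \<omega> t) \<in> borel_measurable priorities" for t
    by (rule measurable_coordinate)
  show A: "?A \<in> sets priorities" by measurable
  define h where "h = (\<lambda>t \<omega>. if D t \<omega> then ennreal (1 / \<omega> r) * indicator {..<\<omega> r} (\<omega> t) else 1)"
  have h [measurable]: "h t \<in> borel_measurable priorities" for t
  proof -
    have "h t = (\<lambda>\<omega>. if D t \<omega> then ennreal (1 / \<omega> r) * (if \<omega> t < \<omega> r then 1 else 0) else 1)"
      by (auto simp: h_def fun_eq_iff)
    also have "\<dots> \<in> borel_measurable priorities" by measurable
    finally show ?thesis .
  qed
  \<comment> \<open>The factor \<open>\<omega> r ^ m\<close> pays for the at most \<open>m\<close>
    weights \<open>1 / \<omega> r\<close>, which keeps the final product at most 1.\<close>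
  define F where "F = (\<lambda>n \<omega>. ennreal (\<omega> r ^ m) * (\<Prod>t<n. h t \<omega>))"
  have F [measurable]: "F n \<in> borel_measurable priorities" for n
    unfolding F_def by measurable
  have int: "(\<integral>\<^sup>+\<omega>. F n \<omega> \<partial>priorities) = ennreal (1 / (real m + 1))" for n
  proof (induction n)
    case 0
    have "(\<integral>\<^sup>+\<omega>. F 0 \<omega> \<partial>priorities) = (\<integral>\<^sup>+x. ennreal (x ^ m) \<partial>distr priorities uniform (\<lambda>\<omega>. \<omega> r))"
      unfolding F_def by (subst nn_integral_distr[OF measurable_coordinate_uniform])
        (auto intro!: measurable_uniform)
    also have "distr priorities uniform (\<lambda>\<omega>. \<omega> r) = uniform"
      unfolding priorities_eq by (rule product.PiM_component) simp
    finally show ?case by (simp add: uniform_power)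
  next
    case (Suc n)
    have "(\<integral>\<^sup>+x. F (Suc n) (fun_upd \<omega> n x) \<partial>uniform) = F n \<omega>" if \<omega>: "\<omega> \<in> space priorities" and "n \<noteq> r" for \<omega>
    proof -
      \<comment> \<open>Up to time \<open>n\<close> the selection looks only at draws before
        \<open>n\<close>, so redrawing coordinate \<open>n\<close> affects the newest weight
        only.\<close>
      have *: "D t (fun_upd \<omega> n x) = D t \<omega>" if "t \<le> n" for t x
        by (rule dep) (use that in auto)
      have Fn: "F n (fun_upd \<omega> n x) = F n \<omega>" for x
        unfolding F_def h_def using \<open>n \<noteq> r\<close> * by (intro arg_cong2[of _ _ _ _ "(*)"] prod.cong) auto
      have "F (Suc n) (fun_upd \<omega> n x) =
          F n \<omega> * (if D n \<omega> then ennreal (1 / \<omega> r) * indicator {..<\<omega> r} x else 1)" for x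
      proof -
        have "F (Suc n) (fun_upd \<omega> n x) = F n (fun_upd \<omega> n x) * h n (fun_upd \<omega> n x)"
          by (simp add: F_def mult.assoc)
        moreover have "h n (fun_upd \<omega> n x) = (if D n \<omega> then ennreal (1 / \<omega> r) * indicator {..<\<omega> r} x else 1)"
          using \<open>n \<noteq> r\<close> *[of n x] by (simp add: h_def)
        ultimately show ?thesis using Fn by simp
      qed
      moreover have "(\<integral>\<^sup>+x. (if D n \<omega> then ennreal (1 / \<omega> r) * indicator {..<\<omega> r} x else 1) \<partial>uniform) = 1"
      proof (cases "D n \<omega>")
        case True
        have r: "0 < \<omega> r" "\<omega> r < 1" using \<omega> by (auto simp: space_priorities)
        have "(\<integral>\<^sup>+x. ennreal (1 / \<omega> r) * indicator {..<\<omega> r} x \<partial>uniform) = ennreal (1 / \<omega> r) * ennreal (\<omega> r)"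
          using r by (subst nn_integral_cmult) (auto simp: uniform_less intro!: measurable_uniform)
        also have "\<dots> = 1" using r by (simp flip: ennreal_mult)
        finally show ?thesis using True by simp
      qed (simp add: U.emeasure_space_1)
      ultimately show ?thesis
        by (simp, subst nn_integral_cmult)
          (auto intro!: measurable_uniform)
    qed
    then have "n \<noteq> r \<Longrightarrow> (\<integral>\<^sup>+\<omega>. F (Suc n) \<omega> \<partial>priorities) = (\<integral>\<^sup>+\<omega>. F n \<omega> \<partial>priorities)"
      by (subst resample[OF F, where t=n]) (simp cong: nn_integral_cong)
    moreover have "n = r \<Longrightarrow> F (Suc n) = F n"
      using irr by (auto simp: F_def h_def fun_eq_iff)
    ultimately show ?case using Suc by (cases "n = r") auto
  qed
  \<comment> \<open>If all comparisons are won, \<open>F N\<close> is a natural power of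
    \<open>\<omega> r\<close>; a lost one contributes the factor 0.\<close>
  have "F N \<omega> \<le> indicator ?A \<omega>" if \<omega>: "\<omega> \<in> space priorities" for \<omega>
  proof (cases "\<omega> \<in> ?A")
    case True
    have r: "0 < \<omega> r" "\<omega> r < 1" using \<omega> by (auto simp: space_priorities)
    have "(\<Prod>t<N. h t \<omega>) = (\<Prod>t<N. if t \<in> {t. D t \<omega>} then ennreal (1 / \<omega> r) else 1)"
      using True by (intro prod.cong) (auto simp: h_def)
    also have "\<dots> = ennreal (1 / \<omega> r) ^ card {t. D t \<omega>}"
      using bound[of _ \<omega>] by (subst prod.inter_restrict[symmetric]) (auto simp: Int_absorb1 subset_iff)
    also have "\<dots> = ennreal ((1 / \<omega> r) ^ card {t. D t \<omega>})" using r by (simp add: ennreal_power)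
    finally have "F N \<omega> = ennreal (\<omega> r ^ m * (1 / \<omega> r) ^ card {t. D t \<omega>})"
      using r by (simp add: F_def ennreal_mult)
    also have "\<omega> r ^ m * (1 / \<omega> r) ^ card {t. D t \<omega>} = \<omega> r ^ (m - card {t. D t \<omega>})"
      using card[OF \<omega>] r by (simp add: power_divide power_diff)
    finally have "F N \<omega> = ennreal (\<omega> r ^ (m - card {t. D t \<omega>}))" .
    moreover have "\<omega> r ^ (m - card {t. D t \<omega>}) \<le> 1" using r by (intro power_le_one) auto
    ultimately show ?thesis using True by simp
  next
    case False
    then obtain t where t: "D t \<omega>" "\<not> \<omega> t < \<omega> r" using \<omega> by auto
    then have "h t \<omega> = 0" by (simp add: h_def)
    then have "(\<Prod>t<N. h t \<omega>) = 0" using bound[OF t(1)] by (intro prod_zero) auto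
    then have "F N \<omega> = 0" by (simp only: F_def mult_zero_right)
    then show ?thesis by simp
  qed
  then have "(\<integral>\<^sup>+\<omega>. F N \<omega> \<partial>priorities) \<le> (\<integral>\<^sup>+\<omega>. indicator ?A \<omega> \<partial>priorities)"
    by (rule nn_integral_mono)
  then have "ennreal (1 / (real m + 1)) \<le> ennreal (measure priorities ?A)"
    using A by (simp add: int priorities.emeasure_eq_measure)
  then show "1 / (real m + 1) \<le> measure priorities ?A" by (simp add: ennreal_le_iff)
qed

section \<open>Success probability and wait-freedom\<close>

lemma resume_space: "\<omega> \<in> space priorities \<Longrightarrow> \<omega>' \<in> space priorities \<Longrightarrow> resume s \<omega> \<omega>' \<in> space priorities"
  by (simp add: space_priorities resume_def)

lemma resume_sets:
  assumes "{\<omega> \<in> space priorities. P \<omega>} \<in> sets priorities" "\<omega> \<in> space priorities"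
  shows "{\<omega>' \<in> space priorities. P (resume s \<omega> \<omega>')} \<in> sets priorities"
proof -
  have "{\<omega>' \<in> space priorities. P (resume s \<omega> \<omega>')} =
     resume s \<omega> -` {\<omega> \<in> space priorities. P \<omega>} \<inter> space priorities"
    using assms(2) resume_space by auto
  with measurable_sets[OF measurable_resume[OF assms(2)] assms(1)] show ?thesis by simp
qed

lemma succeeded_cong:
  assumes "\<And>i. i < t \<Longrightarrow> \<omega> i = \<omega>' i" "succeeded S \<omega> q s t"
  shows "succeeded S \<omega>' q s t"
proof -
  obtain i p where i: "s \<le> i" "i < t" "step_at S \<omega> i = (q, Ev (TryResp p True))"
    using assms(2) by (auto simp: succeeded_def)
  have "exec S \<omega> (Suc i) = exec S \<omega>' (Suc i)"
    by (rule exec_cong) (use assms(1) i(2) in auto)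
  with i show ?thesis by (auto simp: succeeded_def step_at_def hist_def)
qed

lemma succeeded_mono: "succeeded S \<omega> q s t \<Longrightarrow> t \<le> t' \<Longrightarrow> succeeded S \<omega> q s t'"
  unfolding succeeded_def using less_le_trans by blast

lemma taken_add:
  assumes "ident x \<le> ident y" "ident y \<le> t" "execution.owner S x = execution.owner S y"
  shows "execution.taken S x t = execution.taken S x (ident y) + execution.taken S y t"
proof -
  let ?A = "{i. ident x \<le> i \<and> i < ident y \<and> sched S i = execution.owner S x}"
  let ?B = "{i. ident y \<le> i \<and> i < t \<and> sched S i = execution.owner S y}"
  have "{i. ident x \<le> i \<and> i < t \<and> sched S i = execution.owner S x} = ?A \<union> ?B"
    using assms by auto
  moreover have "card (?A \<union> ?B) = card ?A + card ?B" by (rule card_Un_disjoint) auto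
  ultimately show ?thesis by (simp only: execution.taken_def)
qed

locale lock_system =
  fixes S :: system and b \<kappa> L T :: nat and k :: "lock \<Rightarrow> nat"
  assumes algorithm: "\<omega> \<in> space priorities \<Longrightarrow> lock_algorithm S \<omega> b \<kappa> L T k"
    and player: "measurable_player S"
begin

lemma response_sets:
  "{\<omega> \<in> space priorities. step_at S \<omega> t = (q, Ev e)} \<in> sets priorities"
  by (rule trace_code_sets[OF player, where n="Suc t"])
    (metis (no_types, lifting) trace_code_similar(1) lessI less_imp_le mem_Collect_eq space_priorities)

lemma succeeded_sets:
  "{\<omega> \<in> space priorities. \<not> succeeded S \<omega> q s t} \<in> sets priorities"
proof (rule trace_code_sets[OF player, where n=t])
  fix \<omega> \<omega>' assume w: "\<omega> \<in> space priorities" "\<omega>' \<in> space priorities"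
    "trace_code S t \<omega> = trace_code S t \<omega>'" "\<not> succeeded S \<omega> q s t"
  have "step_at S \<omega> i = (q, Ev e) \<longleftrightarrow> step_at S \<omega>' i = (q, Ev e)" if "i < t" for i e
    by (rule trace_code_similar(1)[OF w(3)]) (use w that in \<open>auto simp: space_priorities\<close>)
  with w(4) show "\<not> succeeded S \<omega>' q s t" unfolding succeeded_def by blast
qed

text \<open>All starts that \<open>rival\<close> mentions lie before \<open>r\<close> and the rest
  is schedule, so the code up to \<open>r\<close> decides it.\<close>

lemma rival_sets:
  "{\<omega> \<in> space priorities. execution.rival S \<omega> x r t} \<in> sets priorities"
proof (rule trace_code_sets[OF player, where n=r])
  fix \<omega> \<omega>' assume w: "\<omega> \<in> space priorities" "\<omega>' \<in> space priorities"
    "trace_code S r \<omega> = trace_code S r \<omega>'" "execution.rival S \<omega> x r t"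
  have "execution.started S \<omega> y \<longleftrightarrow> execution.started S \<omega>' y" if "ident y < r" for y
    by (rule trace_code_started[OF w(3)]) (use w that in \<open>auto simp: space_priorities\<close>)
  with w(4) show "execution.rival S \<omega>' x r t" unfolding execution.rival_def by blast
qed

text \<open>A rival starts before \<open>r\<close> and counts at the one time when the schedule has
  given it \<open>T0 S\<close> steps. Finitely many starts yield finitely many times, the same for
  all outcomes.\<close>

lemma rival_bounded: "\<exists>N. \<forall>\<omega> t. execution.rival S \<omega> x r t \<longrightarrow> t < N"
proof -
  \<comment> \<open>\<open>Desc a [] 0\<close> is a dummy: \<open>taken\<close> looks only at the
    identity.\<close>
  define g where "g = (\<lambda>a t. a < t \<and> sched S t = sched S a \<and> execution.taken S (Desc a [] 0) t = T0 S)"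
  have "finite {t. g a t}" for a
  proof (cases "\<exists>t. g a t")
    case True
    then obtain t0 where t0: "g a t0" by blast
    have "t = t0" if "g a t" for t
    proof (rule ccontr)
      assume "t \<noteq> t0"
      then show False
        using execution.taken_strict[of "Desc a [] 0" t t0 S] execution.taken_strict[of "Desc a [] 0" t0 t S]
          that t0 by (auto simp: g_def execution.owner_def neq_iff)
    qed
    then have "{t. g a t} \<subseteq> {t0}" by blast
    then show ?thesis by (rule finite_subset) simp
  qed simp
  then have "finite (\<Union>a<r. {t. g a t})" by blast
  then obtain N where N: "\<And>t. t \<in> (\<Union>a<r. {t. g a t}) \<Longrightarrow> t < N"
    by (auto simp: finite_nat_set_iff_bounded)
  have "t < N" if "execution.rival S \<omega> x r t" for \<omega> t
  proof (rule N)
    from that obtain y where "ident y < r" "ident y < t" "sched S t = execution.owner S y"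
      "execution.taken S y t = T0 S" by (auto simp: execution.rival_def)
    then have "g (ident y) t" by (simp add: g_def execution.owner_def execution.taken_def)
    with \<open>ident y < r\<close> show "t \<in> (\<Union>a<r. {t. g a t})" by blast
  qed
  then show ?thesis by blast
qed

abbreviation contenders :: "desc \<Rightarrow> nat" where
  "contenders p \<equiv> (\<Sum>l\<in>set (lockList p). k l)"

text \<open>The natural subtraction makes the bound 1 for an empty lock list, where there are no
  rivals. This form also serves wait-freedom.\<close>

lemma success:
  assumes \<omega>: "\<omega> \<in> space priorities" and p: "step_at S \<omega> s = (q, Ev (TryInv p))"
    and fin: "allowed_to_finish S q s"
  shows "1 / (real (contenders p - 1) + 1) \<le> success_probability S \<omega> q s p"
    and "lockList p \<noteq> [] \<Longrightarrow> 1 \<le> contenders p"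
    and "{\<omega>' \<in> space priorities. \<exists>t. step_at S (resume s \<omega> \<omega>') t = (q, Ev (TryResp p True))}
      \<in> sets priorities"
proof -
  interpret A: lock_algorithm S \<omega> b \<kappa> L T k by (rule algorithm[OF \<omega>])
  have p: "A.started p" "ident p = s" "A.owner p = q" using A.TryInvD[OF p] by auto
  obtain t where "T0 S + T1 S + 1 \<le> card {i. s \<le> i \<and> i < t \<and> sched S i = q}"
    using fin by (auto simp: allowed_to_finish_def)
  then have t: "T0 S + T1 S < A.taken p t" by (simp add: A.taken_def p)
  obtain r where r: "A.reveal p r" using A.responds[OF p(1) t] by metis
  have rt: "s < r" "sched S r = q" "A.taken p r = T0 S"
    using A.revealD[OF r] A.reveal_time(1)[OF r] A.step_at_sched p by auto
  \<comment> \<open>The time of the reveal is settled by the schedule, so all continuations of the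
    history share \<open>r\<close>; \<open>selection\<close> needs this fixed index.\<close>
  have ends: "\<exists>e d. step_at S (resume s \<omega> \<omega>') e = (q, Ev (TryResp p d)) \<and>
      execution.reveal S (resume s \<omega> \<omega>') p r" if \<omega>': "\<omega>' \<in> space priorities" for \<omega>'
  proof -
    interpret B: lock_algorithm S "resume s \<omega> \<omega>'" b \<kappa> L T k
      by (rule algorithm[OF resume_space[OF \<omega> \<omega>']])
    have "B.started p"
      using started_cong[of p "resume s \<omega> \<omega>'" \<omega> S] p by (simp add: resume_def)
    from B.responds[OF this t] obtain e d r'
      where e: "step_at S (resume s \<omega> \<omega>') e = (A.owner p, Ev (TryResp p d))" "B.reveal p r'" by metis
    have r': "s < r'" "sched S r' = q" "A.taken p r' = T0 S"
      using B.revealD[OF e(2)] B.reveal_time(1)[OF e(2)] B.step_at_sched p by auto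
    have "r' = r"
    proof (rule ccontr)
      assume "r' \<noteq> r"
      then show False
        using A.taken_strict[of p r r'] A.taken_strict[of p r' r] rt r' p by (auto simp: neq_iff)
    qed
    with e p show ?thesis by blast
  qed
  let ?D = "\<lambda>t \<omega>'. execution.rival S (resume s \<omega> \<omega>') p r t"
  let ?m = "contenders p - 1"
  obtain N where N: "\<And>\<omega> t. execution.rival S \<omega> p r t \<Longrightarrow> t < N" using rival_bounded by blast
  have card: "card {t. ?D t \<omega>'} \<le> ?m \<and> (lockList p \<noteq> [] \<longrightarrow> 1 \<le> contenders p)" if \<omega>': "\<omega>' \<in> space priorities" for \<omega>'
  proof -
    interpret B: lock_algorithm S "resume s \<omega> \<omega>'" b \<kappa> L T k
      by (rule algorithm[OF resume_space[OF \<omega> \<omega>']])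
    have rev: "B.reveal p r" using ends[OF \<omega>'] by blast
    show ?thesis
      using B.rival_card(2)[OF rev] B.rival_card(3)[OF rev] by (cases "lockList p = []") auto
  qed
  have "\<omega> \<in> space priorities" by (rule \<omega>)
  with card show "lockList p \<noteq> [] \<Longrightarrow> 1 \<le> contenders p" by blast
  have sel: "1 / (real ?m + 1) \<le> measure priorities {\<omega>' \<in> space priorities. \<forall>t. ?D t \<omega>' \<longrightarrow> \<omega>' t < \<omega>' r}"
  proof (rule selection(2)[where D="?D" and N=N])
    show "{\<omega>' \<in> space priorities. ?D t \<omega>'} \<in> sets priorities" for t
      by (rule resume_sets[OF rival_sets \<omega>])
    show "?D t \<omega>1 = ?D t \<omega>2" if "\<And>i. i < r \<Longrightarrow> i < t \<Longrightarrow> \<omega>1 i = \<omega>2 i" for t \<omega>1 \<omega>2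
      by (rule rival_cong) (use that in \<open>auto simp: resume_def\<close>)
    show "\<not> ?D r \<omega>'" for \<omega>' by (simp add: execution.rival_def)
  qed (use N card in auto)
  show meas: "{\<omega>' \<in> space priorities. \<exists>t. step_at S (resume s \<omega> \<omega>') t = (q, Ev (TryResp p True))}
      \<in> sets priorities"
  proof -
    have "{\<omega>' \<in> space priorities. \<exists>t. step_at S (resume s \<omega> \<omega>') t = (q, Ev (TryResp p True))} =
      (\<Union>t. {\<omega>' \<in> space priorities. step_at S (resume s \<omega> \<omega>') t = (q, Ev (TryResp p True))})" by auto
    also have "\<dots> \<in> sets priorities"
      by (intro sets.countable_UN image_subsetI resume_sets[OF response_sets \<omega>])
    finally show ?thesis .
  qed
  have "measure priorities {\<omega>' \<in> space priorities. \<forall>t. ?D t \<omega>' \<longrightarrow> \<omega>' t < \<omega>' r}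
     \<le> success_probability S \<omega> q s p"
    unfolding success_probability_def
  proof (rule priorities.finite_measure_mono[OF _ meas], safe)
    fix \<omega>' assume \<omega>': "\<omega>' \<in> space priorities" and win: "\<forall>t. ?D t \<omega>' \<longrightarrow> \<omega>' t < \<omega>' r"
    interpret B: lock_algorithm S "resume s \<omega> \<omega>'" b \<kappa> L T k
      by (rule algorithm[OF resume_space[OF \<omega> \<omega>']])
    obtain e d where e: "step_at S (resume s \<omega> \<omega>') e = (q, Ev (TryResp p d))" "B.reveal p r"
      using ends[OF \<omega>'] by blast
    have d
    proof (rule ccontr)
      assume "\<not> d"
      with e B.failure_rival[OF e(2)] obtain t where t: "?D t \<omega>'" "resume s \<omega> \<omega>' r \<le> resume s \<omega> \<omega>' t"
        by auto
      \<comment> \<open>After \<open>s\<close>, \<open>resume\<close> takes the fresh draws, so the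
        inequality compares two values of \<open>\<omega>'\<close>.\<close>
      then have "s < t" using p by (simp add: execution.rival_def)
      with t win rt show False by (auto simp: resume_def)
    qed
    with e show "\<exists>t. step_at S (resume s \<omega> \<omega>') t = (q, Ev (TryResp p True))" by auto
  qed
  with sel show "1 / (real ?m + 1) \<le> success_probability S \<omega> q s p" by linarith
qed

lemma resume_resume:
  "s \<le> a \<Longrightarrow> resume s \<omega> (resume a \<omega>1 \<omega>2) = resume a (resume s \<omega> \<omega>1) \<omega>2"
  by (auto simp: resume_def fun_eq_iff)

text \<open>
  As attempts have a fixed length, the start times of the retries depend only on the schedule.
\<close>

lemma retry:
  fixes M :: nat
  assumes \<omega>: "\<omega> \<in> space priorities" and p: "step_at S \<omega> s = (q, Ev (TryInv p))"
    and retry: "\<And>\<omega>'. \<omega>' \<in> space priorities \<Longrightarrow> retries S (resume s \<omega> \<omega>') q s p"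
    and M: "M = Suc (T0 S + T1 S)" and x: "x = 1 - 1 / (real (contenders p - 1) + 1)"
  defines "fail \<equiv> \<lambda>a. {\<omega>' \<in> space priorities. \<not> succeeded S (resume s \<omega> \<omega>') q s a}"
  assumes "s \<le> a" "sched S a = q" "execution.taken S p a = j * M"
  shows "(\<forall>\<omega>'\<in>fail a. execution.started S (resume s \<omega> \<omega>') (Desc a (lockList p) (thunk p))) \<and>
    emeasure priorities (fail a) \<le> ennreal (x ^ j)"
  using assms(7-9)
proof (induction j arbitrary: a)
  interpret A: lock_algorithm S \<omega> b \<kappa> L T k by (rule algorithm[OF \<omega>])
  have p': "A.started p" "ident p = s" "A.owner p = q" using A.TryInvD[OF p] by auto
  have sq: "sched S s = q" using p' by (simp add: A.owner_def)
  {
    case 0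
    have "a = s"
      using A.taken_strict[of p s a] 0 sq p' by (cases "a = s") auto
    moreover have "Desc s (lockList p) (thunk p) = p" using p'(2) by (cases p) simp
    moreover have "execution.started S (resume s \<omega> \<omega>') p" for \<omega>'
      using started_cong[of p "resume s \<omega> \<omega>'" \<omega> S] p' by (simp add: resume_def)
    ultimately show ?case using priorities.emeasure_le_1 by simp
  next
    case (Suc j)
    have "j * M < A.taken p a" using Suc.prems(3) M by simp
    \<comment> \<open>Attempts have length \<open>M\<close>, so \<open>a0\<close> is the start of
      the one preceding the start at \<open>a\<close>.\<close>
    then obtain a0 where a0: "a0 < a" "s \<le> a0" "sched S a0 = q" "A.taken p a0 = j * M"
      using A.taken_attained p' by metis
    note IH = Suc.IH[OF a0(2-4)]
    let ?x = "Desc a0 (lockList p) (thunk p)"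
    have ox: "A.owner ?x = q" using a0 by (simp add: A.owner_def)
    have tx: "A.taken ?x a = M"
      using taken_add[of p ?x a S] a0 Suc.prems p' ox by simp
    have fail_mono: "fail a \<subseteq> fail a0"
      using succeeded_mono[of S _ q s a0 a] a0 by (auto simp: fail_def)
    have "execution.started S (resume s \<omega> \<omega>') (Desc a (lockList p) (thunk p))" if f: "\<omega>' \<in> fail a" for \<omega>'
    proof -
      have \<omega>': "\<omega>' \<in> space priorities" using f by (simp add: fail_def)
      interpret B: lock_algorithm S "resume s \<omega> \<omega>'" b \<kappa> L T k
        by (rule algorithm[OF resume_space[OF \<omega> \<omega>']])
      have "B.started ?x" using IH f fail_mono by blast
      then have "local (config_at S (resume s \<omega> \<omega>') a) q = Idle"
        using B.idle_after(1)[of ?x a] a0 Suc.prems tx ox M by simp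
      moreover from this have "player S (hist S (resume s \<omega> \<omega>') a) q = Some (lockList p, thunk p)"
        using retry[OF \<omega>'] f a0 Suc.prems by (auto simp: retries_def fail_def)
      ultimately show ?thesis using Suc.prems by (simp add: B.started_def B.owner_def)
    qed
    moreover have "emeasure priorities (fail a) \<le> ennreal (x ^ Suc j)"
    proof -
      have sets: "fail t \<in> sets priorities" for t
        unfolding fail_def by (rule resume_sets[OF succeeded_sets \<omega>])
      \<comment> \<open>Failure up to \<open>a\<close> requires failure up to \<open>a0\<close> and
        failure of the attempt started there; given the draws before \<open>a0\<close>, the latter
        has probability at most \<open>x\<close>.\<close>
      have inner: "(\<integral>\<^sup>+\<omega>2. indicator (fail a) (resume a0 \<omega>1 \<omega>2) \<partial>priorities) \<le> ennreal x * indicator (fail a0) \<omega>1"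
        if \<omega>1: "\<omega>1 \<in> space priorities" for \<omega>1
      proof (cases "\<omega>1 \<in> fail a0")
        case False
        have "resume a0 \<omega>1 \<omega>2 \<notin> fail a" for \<omega>2
        proof -
          have "succeeded S (resume s \<omega> \<omega>1) q s a0" using False \<omega>1 by (simp add: fail_def)
          then have "succeeded S (resume s \<omega> (resume a0 \<omega>1 \<omega>2)) q s a0"
            by (rule succeeded_cong[rotated]) (simp add: resume_def)
          with succeeded_mono[OF this] a0 show ?thesis by (simp add: fail_def)
        qed
        then show ?thesis by simp
      next
        case True
        let ?W = "resume s \<omega> \<omega>1"
        interpret B: lock_algorithm S ?W b \<kappa> L T k by (rule algorithm[OF resume_space[OF \<omega> \<omega>1]])
        have "B.started ?x" using IH True by blast
        from B.started_TryInv[OF this] ox have inv: "step_at S ?W a0 = (q, Ev (TryInv ?x))" by simp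
        have fin: "allowed_to_finish S q a0"
          unfolding allowed_to_finish_def using tx ox M by (intro exI[of _ a]) (simp add: A.taken_def)
        note succ = success[OF resume_space[OF \<omega> \<omega>1] inv fin]
        let ?G = "{\<omega>2 \<in> space priorities. \<exists>t. step_at S (resume a0 ?W \<omega>2) t = (q, Ev (TryResp ?x True))}"
        have "indicator (fail a) (resume a0 \<omega>1 \<omega>2) \<le> (indicator (space priorities - ?G) \<omega>2 :: ennreal)"
          if \<omega>2: "\<omega>2 \<in> space priorities" for \<omega>2
        proof -
          have "resume a0 \<omega>1 \<omega>2 \<notin> fail a" if g: "\<omega>2 \<in> ?G"
          proof -
            obtain t where t: "step_at S (resume a0 ?W \<omega>2) t = (q, Ev (TryResp ?x True))" using g by blast
            interpret C: lock_algorithm S "resume a0 ?W \<omega>2" b \<kappa> L T k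
              by (rule algorithm[OF resume_space[OF resume_space[OF \<omega> \<omega>1] \<omega>2]])
            \<comment> \<open>A response comes at count \<open>M - 1\<close>, hence before
              \<open>a\<close>, where the count is \<open>M\<close>.\<close>
            have "A.taken ?x t < A.taken ?x a" using C.response_time[OF t] tx M by simp
            then have "t < a" using A.taken_mono[of a t ?x] by (meson not_le)
            moreover have "s \<le> t" using C.TryRespD[OF t] a0 by simp
            ultimately have "succeeded S (resume a0 ?W \<omega>2) q s a" using t by (auto simp: succeeded_def)
            then show ?thesis using resume_resume[OF a0(2)] by (simp add: fail_def)
          qed
          then show ?thesis using \<omega>2 by (auto simp: indicator_def)
        qed
        then have "(\<integral>\<^sup>+\<omega>2. indicator (fail a) (resume a0 \<omega>1 \<omega>2) \<partial>priorities)
           \<le> (\<integral>\<^sup>+\<omega>2. indicator (space priorities - ?G) \<omega>2 \<partial>priorities)"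
          by (rule nn_integral_mono)
        also have "\<dots> = emeasure priorities (space priorities - ?G)"
          by (rule nn_integral_indicator) (intro sets.compl_sets succ(3))
        also have "\<dots> = ennreal (1 - success_probability S ?W q a0 ?x)"
          unfolding priorities.emeasure_eq_measure priorities.prob_compl[OF succ(3)] success_probability_def ..
        also have "\<dots> \<le> ennreal x"
          using succ(1) by (intro ennreal_leI) (simp add: x)
        finally show ?thesis using True by simp
      qed
      have "emeasure priorities (fail a) = (\<integral>\<^sup>+\<omega>'. indicator (fail a) \<omega>' \<partial>priorities)"
        using sets by simp
      also have "\<dots> = (\<integral>\<^sup>+\<omega>1. (\<integral>\<^sup>+\<omega>2. indicator (fail a) (resume a0 \<omega>1 \<omega>2) \<partial>priorities) \<partial>priorities)"
        by (rule resume_integral) (use sets in simp)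
      also have "\<dots> \<le> (\<integral>\<^sup>+\<omega>1. ennreal x * indicator (fail a0) \<omega>1 \<partial>priorities)"
        by (rule nn_integral_mono) (rule inner)
      also have "\<dots> = ennreal x * emeasure priorities (fail a0)"
        using sets by (simp add: nn_integral_cmult_indicator)
      also have "\<dots> \<le> ennreal x * ennreal (x ^ j)" using IH by (intro mult_left_mono) auto
      also have "\<dots> = ennreal (x ^ Suc j)"
      proof -
        have "0 \<le> x" by (simp add: x)
        then show ?thesis by (simp add: ennreal_mult)
      qed
      finally show ?thesis .
    qed
    ultimately show ?case by blast
  }
qed

text \<open>Reindexes from global times to the owner's own step numbers.\<close>

lemma taken_sum:
  fixes h :: "nat \<Rightarrow> ennreal"
  shows "(\<Sum>t<n. if ident p \<le> t \<and> sched S t = execution.owner S p then h (execution.taken S p t) else 0) =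
    (\<Sum>c<execution.taken S p n. h c)"
proof (induction n)
  case 0
  then show ?case by (simp add: execution.taken_def)
next
  case (Suc n)
  show ?case
  proof (cases "ident p \<le> n")
    case True
    with Suc show ?thesis by (simp add: execution.taken_Suc)
  next
    case False
    then have "{i. ident p \<le> i \<and> i < Suc n \<and> sched S i = execution.owner S p} = {}"
      "{i. ident p \<le> i \<and> i < n \<and> sched S i = execution.owner S p} = {}" by auto
    then have "execution.taken S p (Suc n) = 0" "execution.taken S p n = 0"
      unfolding execution.taken_def by (simp_all only: card.empty)
    with False Suc show ?thesis by simp
  qed
qed

text \<open>Each attempt contributes a block of \<open>M\<close> equal terms, and the blocks form a
  geometric series.\<close>

lemma block_sum:
  fixes x :: real and M :: nat
  assumes "0 \<le> x" "x < 1" "0 < M"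
  shows "(\<Sum>c<n. ennreal (x ^ (c div M))) \<le> ennreal (real M / (1 - x))"
proof -
  have "(\<Sum>c<n. x ^ (c div M)) \<le> (\<Sum>c<n * M. x ^ (c div M))"
    by (rule sum_mono2) (use assms in auto)
  also have "\<dots> = (\<Sum>j<n. \<Sum>c = j * M..<j * M + M. x ^ (c div M))" by (rule sum.nat_group[symmetric])
  also have "\<dots> = (\<Sum>j<n. real M * x ^ j)"
  proof (rule sum.cong[OF refl])
    fix j
    have "(\<Sum>c = j * M..<j * M + M. x ^ (c div M)) = (\<Sum>c = j * M..<j * M + M. x ^ j)"
      by (intro sum.cong refl arg_cong[of _ _ "(^) x"] div_nat_eqI) (auto simp: mult.commute)
    then show "(\<Sum>c = j * M..<j * M + M. x ^ (c div M)) = real M * x ^ j" by simp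
  qed
  also have "\<dots> = real M * ((1 - x ^ n) / (1 - x))"
    using assms by (simp add: sum_distrib_left[symmetric] sum_gp_strict)
  also have "\<dots> = real M * (1 - x ^ n) / (1 - x)" by simp
  also have "\<dots> \<le> real M / (1 - x)"
    using assms by (intro divide_right_mono mult_left_le) auto
  finally show ?thesis using assms by (simp add: sum_ennreal ennreal_leI)
qed

text \<open>The expectation is the sum, over the steps of \<open>q\<close>, of the probability that
  success is still missing. At own step number \<open>c\<close> this is at most
  \<open>x ^ (c div M)\<close>, as without success \<open>c div M\<close> attempts are over by
  then.\<close>

lemma wait_free: "wait_free S"
  unfolding wait_free_def
proof (intro ballI allI impI, elim conjE)
  fix \<omega> s q p
  assume \<omega>: "\<omega> \<in> space priorities" and p: "step_at S \<omega> s = (q, Ev (TryInv p))"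
    and retries: "\<forall>\<omega>'\<in>space priorities. retries S (resume s \<omega> \<omega>') q s p"
  interpret A: lock_algorithm S \<omega> b \<kappa> L T k by (rule algorithm[OF \<omega>])
  have p': "ident p = s" "A.owner p = q" using A.TryInvD[OF p] by auto
  define M where "M = Suc (T0 S + T1 S)"
  define x where "x = 1 - 1 / (real (contenders p - 1) + 1)"
  have x01: "0 \<le> x" "x < 1" by (auto simp: x_def field_simps)
  let ?fail = "\<lambda>a. {\<omega>' \<in> space priorities. \<not> succeeded S (resume s \<omega> \<omega>') q s a}"
  have bound: "emeasure priorities (?fail t) \<le> ennreal (x ^ (A.taken p t div M))"
    if t: "s \<le> t" "sched S t = q" for t
  proof -
    let ?j = "A.taken p t div M"
    \<comment> \<open>Without earlier success, \<open>a\<close> is the start of the attempt to which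
      the step at \<open>t\<close> belongs.\<close>
    obtain a where a: "s \<le> a" "a \<le> t" "sched S a = q" "A.taken p a = ?j * M"
    proof (cases "?j * M = A.taken p t")
      case True
      with t that show ?thesis by auto
    next
      case False
      then have "?j * M < A.taken p t" using div_times_less_eq_dividend le_neq_implies_less by blast
      from A.taken_attained[OF this] p' that show ?thesis by auto
    qed
    have "?fail t \<subseteq> ?fail a" using succeeded_mono a(2) by blast
    then have "emeasure priorities (?fail t) \<le> emeasure priorities (?fail a)"
      by (rule emeasure_mono) (rule resume_sets[OF succeeded_sets \<omega>])
    also have "\<dots> \<le> ennreal (x ^ ?j)"
      using retry[OF \<omega> p _ M_def x_def a(1,3,4)] retries by blast
    finally show ?thesis .
  qed
  let ?f = "\<lambda>t \<omega>'. if s \<le> t \<and> sched S t = q then indicator (?fail t) \<omega>' else (0 :: ennreal)"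
  have "(\<integral>\<^sup>+\<omega>'. steps_until_success S q s (resume s \<omega> \<omega>') \<partial>priorities) =
    (\<integral>\<^sup>+\<omega>'. (\<Sum>t. ?f t \<omega>') \<partial>priorities)"
    unfolding steps_until_success_def
    by (intro nn_integral_cong suminf_cong) (auto simp: indicator_def)
  also have "\<dots> = (\<Sum>t. \<integral>\<^sup>+\<omega>'. ?f t \<omega>' \<partial>priorities)"
    by (rule nn_integral_suminf)
      (use resume_sets[OF succeeded_sets \<omega>] in \<open>auto intro!: borel_measurable_indicator\<close>)
  also have "\<dots> \<le> (\<Sum>t. if ident p \<le> t \<and> sched S t = A.owner p then ennreal (x ^ (A.taken p t div M)) else 0)"
  proof (intro suminf_le allI)
    show "(\<integral>\<^sup>+\<omega>'. ?f t \<omega>' \<partial>priorities) \<le>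
      (if ident p \<le> t \<and> sched S t = A.owner p then ennreal (x ^ (A.taken p t div M)) else 0)" for t
      using bound[of t] p' resume_sets[OF succeeded_sets \<omega>] by auto
  qed auto
  also have "\<dots> \<le> ennreal (real M / (1 - x))"
  proof (rule suminf_le_const)
    show "(\<Sum>t<n. if ident p \<le> t \<and> sched S t = A.owner p then ennreal (x ^ (A.taken p t div M)) else 0)
      \<le> ennreal (real M / (1 - x))" for n
      unfolding taken_sum[where h="\<lambda>c. ennreal (x ^ (c div M))"]
      by (rule block_sum) (use x01 in \<open>auto simp: M_def\<close>)
  qed simp
  also have "\<dots> < \<infinity>" by simp
  finally show "(\<integral>\<^sup>+\<omega>'. steps_until_success S q s (resume s \<omega> \<omega>') \<partial>priorities) < \<infinity>" .
qed

lemma mutual_exclusion: "mutual_exclusion_with_idempotence S"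
  unfolding mutual_exclusion_with_idempotence_def
proof (intro ballI allI conjI impI; (elim conjE)?)
  fix \<omega> t q p
  assume \<omega>: "\<omega> \<in> space priorities"
  interpret A: lock_algorithm S \<omega> b \<kappa> L T k by (rule algorithm[OF \<omega>])
  {
    assume "step_at S \<omega> t = (q, Ev (TryResp p True))"
    from A.response_finished[OF this]
    show "\<exists>i<t. \<exists>q'. step_at S \<omega> i = (q', Ev (ThunkResp p))"
      by (auto simp: A.finished_def A.occurs_def)
  next
    fix p' assume "p' \<noteq> p" "set (lockList p) \<inter> set (lockList p') \<noteq> {}"
    then show "thunk_interval S \<omega> p \<inter> thunk_interval S \<omega> p' = {}"
      by (intro A.intervals_disjoint) (auto simp: A.conflict_def)
  next
    fix i q' assume "step_at S \<omega> t = (q, Ev (TryResp p False))"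
    then show "step_at S \<omega> i \<noteq> (q', Ev (ThunkInv p))" by (rule A.failed_no_run)
  }
qed

end

text \<open>In the proof, \<open>Y\<close> is \<kappa> L T and \<open>Z\<close> is \<kappa>^2 L^2 T,
  the orders of the two delays. A run costs at most (b + 17) Y, updating all locks (b + 2) Y, and
  helping (2 b + 20) Z. Adding the remaining single steps, 2 before the reveal and 3 from it on,
  gives the factors 3 b + 24 and 2 b + 22.\<close>

lemma (in lock_execution) sufficient_delays:
  assumes params: "0 < \<kappa>" "0 < L" "0 < T"
    and c: "3 * b + 24 \<le> c" "2 * b + 22 \<le> c'"
    and T0: "T0 S = c * \<kappa>\<^sup>2 * L\<^sup>2 * T" and T1: "T1 S = c' * \<kappa> * L * T"
  shows "lock_algorithm S \<omega> b \<kappa> L T k"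
proof -
  define A where "A = \<kappa> * T"
  define Y where "Y = L * A"
  define Z where "Z = L * (\<kappa> * Y)"
  have A: "\<kappa> \<le> A" "T \<le> A" "1 \<le> A" using params by (auto simp: A_def)
  have Y: "A \<le> Y" "L \<le> Y" "1 \<le> Y" using params A by (auto simp: Y_def)
  have Z: "Y \<le> Z" "1 \<le> Z" using params Y by (auto simp: Z_def)
  have bm: "b \<le> b * N" if "1 \<le> N" for N :: nat using that by simp
  have "\<kappa> * (4 + (T + 3)) = A + 7 * \<kappa>" by (simp add: A_def algebra_simps)
  then have "b + 2 + \<kappa> + Suc (\<kappa> * (4 + (T + 3))) \<le> (b + 12) * A"
    using A bm[OF A(3)] by (simp only: add_mult_distrib)
  then have "L * (b + 2 + \<kappa> + Suc (\<kappa> * (4 + (T + 3)))) \<le> L * ((b + 12) * A)" by (rule mult_le_mono2)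
  also have "\<dots> = (b + 12) * Y" by (simp add: Y_def)
  finally have run: "run_cost \<le> (b + 17) * Y"
    using A Y unfolding run_cost_def by (simp add: algebra_simps)
  have "\<kappa> * L \<le> Y" using A by (simp add: Y_def)
  then have "b * (\<kappa> * L) \<le> b * Y" by (rule mult_le_mono2)
  moreover have "update_cost = b * (\<kappa> * L) + 2 * L" by (simp add: update_cost_def algebra_simps)
  ultimately have upd: "update_cost \<le> (b + 2) * Y"
    using Y unfolding add_mult_distrib by linarith
  have "\<kappa> \<le> \<kappa> * Y" "1 \<le> \<kappa> * Y" using params Y by auto
  moreover have "\<kappa> * run_cost \<le> (b + 17) * (\<kappa> * Y)"
    using mult_le_mono2[OF run, of \<kappa>] by (simp only: mult.left_commute)
  ultimately have "b + 2 + \<kappa> + \<kappa> * run_cost \<le> (2 * b + 20) * (\<kappa> * Y)"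
    using bm[of "\<kappa> * Y"] unfolding add_mult_distrib by linarith
  then have "L * (b + 2 + \<kappa> + \<kappa> * run_cost) \<le> L * ((2 * b + 20) * (\<kappa> * Y))" by (rule mult_le_mono2)
  then have help_cost: "help_cost \<le> (2 * b + 20) * Z" by (simp add: help_cost_def Z_def algebra_simps)
  have "(b + 2) * Y \<le> (b + 2) * Z" using Z by (intro mult_le_mono2)
  then have "1 + (help_cost + (1 + update_cost)) \<le> (3 * b + 24) * Z"
    using help_cost upd Z by (simp add: algebra_simps)
  also have "\<dots> \<le> c * Z" using c by (intro mult_le_mono1)
  also have "\<dots> = T0 S" by (simp add: T0 Z_def Y_def A_def power2_eq_square algebra_simps)
  finally have 0: "1 + (help_cost + (1 + update_cost)) \<le> T0 S" .
  have "run_cost + (1 + update_cost) + 2 \<le> (2 * b + 22) * Y"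
    using run upd Y by (simp add: algebra_simps)
  also have "\<dots> \<le> c' * Y" using c by (intro mult_le_mono1)
  also have "\<dots> = T1 S" by (simp add: T1 Y_def A_def algebra_simps)
  finally show ?thesis using 0 by unfold_locales
qed

theorem theorem6p9:
  fixes b :: nat
  shows "\<exists>c0 c0'. \<forall>c\<ge>c0. \<forall>c'\<ge>c0'. \<forall>\<kappa> L T :: nat. \<forall>(k :: lock \<Rightarrow> nat) S.
    0 < \<kappa> \<and> 0 < L \<and> 0 < T \<and>
    T0 S = c * \<kappa>\<^sup>2 * L\<^sup>2 * T \<and> T1 S = c' * \<kappa> * L * T \<and>
    active_sets_ok b \<kappa> S \<and> respects_bounds \<kappa> L T k S \<and> measurable_player S \<longrightarrow>
      mutual_exclusion_with_idempotence S \<and>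
      wait_free S \<and>
      (\<forall>\<omega>\<in>space priorities. \<forall>s q p.
         step_at S \<omega> s = (q, Ev (TryInv p)) \<and> allowed_to_finish S q s \<longrightarrow>
         success_probability S \<omega> q s p \<ge> 1 / (\<Sum>l\<in>set (lockList p). real (k l)))"
proof (rule exI[of _ "3 * b + 24"], rule exI[of _ "2 * b + 22"], intro allI impI; elim conjE)
  fix c c' \<kappa> L T :: nat and k :: "lock \<Rightarrow> nat" and S :: system
  assume c: "3 * b + 24 \<le> c" "2 * b + 22 \<le> c'" and params: "0 < \<kappa>" "0 < L" "0 < T"
    and delays: "T0 S = c * \<kappa>\<^sup>2 * L\<^sup>2 * T" "T1 S = c' * \<kappa> * L * T"
    and ok: "active_sets_ok b \<kappa> S" "respects_bounds \<kappa> L T k S" and player: "measurable_player S"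
  interpret lock_system S b \<kappa> L T k
  proof (rule lock_system.intro)
    fix \<omega> assume \<omega>: "\<omega> \<in> space priorities"
    interpret lock_execution S \<omega> b \<kappa> L T k
      by unfold_locales
        (use ok \<omega> in \<open>auto simp: active_sets_ok_def respects_bounds_def space_priorities\<close>)
    show "lock_algorithm S \<omega> b \<kappa> L T k" by (rule sufficient_delays[OF params c delays])
  qed (rule player)
  show "mutual_exclusion_with_idempotence S \<and> wait_free S \<and>
      (\<forall>\<omega>\<in>space priorities. \<forall>s q p.
         step_at S \<omega> s = (q, Ev (TryInv p)) \<and> allowed_to_finish S q s \<longrightarrow>
         success_probability S \<omega> q s p \<ge> 1 / (\<Sum>l\<in>set (lockList p). real (k l)))"
  proof (intro conjI mutual_exclusion wait_free ballI allI impI)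
    fix \<omega> s q p assume \<omega>: "\<omega> \<in> space priorities"
      and p: "step_at S \<omega> s = (q, Ev (TryInv p)) \<and> allowed_to_finish S q s"
    note succ = success[OF \<omega> conjunct1[OF p] conjunct2[OF p]]
    show "success_probability S \<omega> q s p \<ge> 1 / (\<Sum>l\<in>set (lockList p). real (k l))"
    proof (cases "lockList p = []")
      \<comment> \<open>The sum is empty and \<open>1 / 0 = 0\<close> in HOL, so only nonnegativity
        is claimed here.\<close>
      case True
      then show ?thesis by (simp add: success_probability_def)
    next
      case False
      then have "real (contenders p - 1) + 1 = (\<Sum>l\<in>set (lockList p). real (k l))"
        using succ(2) by (simp add: of_nat_diff)
      with succ(1) show ?thesis by simp
    qed
  qed
qed

end
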